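(* Let $K$ be a field, let $E$ be an arbitrary directed graph, let $L=L_K(E)$ be the Leavitt path algebra of $E$ over $K$, and let $P$ be a non-zero prime ideal of $L$. Then: (i) the set of all the $P$-primary ideals of $L$ is totally ordered under set inclusion; (ii) there is no ideal $A$ of $L$ satisfying $P^2\subsetneq A\subsetneq P$.
   Context: Directed graph: $E=(E^0,E^1,r,s)$ consists of two countable sets $E^0$ (vertices) and $E^1$ (edges) and functions $r,s:E^1\to E^0$ (range and source). A vertex $v$ is regular if $s^{-1}(v)$ is non-empty and finite. Leavitt path algebra: $L_K(E)$ is the (associative, not necessarily unital) $K$-algebra generated by $E^0\cup E^1\cup\{e^*: e\in E^1\}$ subject to the relations - $vw=\delta_{v,w}v$ for $v,w\in E^0$; - $s(e)e=e=e\,r(e)$ and $r(e)e^*=e^*=e^*s(e)$ for $e\in E^1$; - (CK1) $e^*f=\delta_{e,f}\,r(f)$ for $e,f\in E^1$; - (CK2) $v=\sum_{e\in s^{-1}(v)}ee^*$ for every regular vertex $v$. Ideals are two-sided; the product $AB$ of ideals is the set of finite sums of elements $ab$ with $a\in A$, $b\in B$, and $P^2=PP$. A prime ideal is a proper ideal $P$ such that, for ideals $A,B$, $AB\subseteq P$ implies $A\subseteq P$ or $B\subseteq P$. The radical $\sqrt I$ of an ideal $I$ is the intersection of all the prime ideals containing $I$. Given a non-zero prime ideal $P$, an ideal $I$ is called $P$-primary if $\sqrt I=P$. *)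

theory Defs
  imports
    "HOL-Library.Poly_Mapping"
    "HOL-Library.Countable_Set"
    "HOL-Algebra.QuotRing"
    "HOL-Algebra.Ideal_Product"
    "Graph_Theory.Digraph"
begin

section \<open>Ideals of rings that need not have a unit\<close>

text \<open>
  The locale \<^locale>\<open>ideal\<close> presupposes a ring with unit, which a Leavitt path algebra need
  not have. The following predicate is \<^locale>\<open>ideal\<close> without that assumption. In particular
  it never refers to the \<open>one\<close> component of the record.
\<close>

definition two_sided_ideal :: "'a set \<Rightarrow> ('a, 'm) ring_scheme \<Rightarrow> bool" where
  "two_sided_ideal I R \<longleftrightarrow>
     additive_subgroup I R \<and>
     (\<forall>a\<in>I. \<forall>x\<in>carrier R. x \<otimes>\<^bsub>R\<^esub> a \<in> I \<and> a \<otimes>\<^bsub>R\<^esub> x \<in> I)"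

definition prime_ideal :: "'a set \<Rightarrow> ('a, 'm) ring_scheme \<Rightarrow> bool" where
  "prime_ideal P R \<longleftrightarrow>
     two_sided_ideal P R \<and> P \<noteq> carrier R \<and>
     (\<forall>A B. two_sided_ideal A R \<longrightarrow> two_sided_ideal B R \<longrightarrow>
        A \<cdot>\<^bsub>R\<^esub> B \<subseteq> P \<longrightarrow> A \<subseteq> P \<or> B \<subseteq> P)"

text \<open>The empty intersection is the whole ring.\<close>

definition prime_radical :: "'a set \<Rightarrow> ('a, 'm) ring_scheme \<Rightarrow> 'a set" where
  "prime_radical I R = carrier R \<inter> \<Inter>{Q. prime_ideal Q R \<and> I \<subseteq> Q}"

definition primary_ideal :: "'a set \<Rightarrow> 'a set \<Rightarrow> ('a, 'm) ring_scheme \<Rightarrow> bool" where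
  "primary_ideal P I R \<longleftrightarrow> two_sided_ideal I R \<and> prime_radical I R = P"


section \<open>Free associative algebras\<close>

text \<open>
  The free monoid, written additively so that \<open>'x free_word \<Rightarrow>\<^sub>0 'k\<close> is, with the convolution
  product of finitely supported functions, the free associative unital algebra over \<open>'k\<close>.
\<close>

datatype 'x free_word = Word (letters: "'x list")

instantiation free_word :: (type) monoid_add
begin

definition "0 = Word []"

definition "u + w = Word (letters u @ letters w)"

instance
  by standard (simp_all add: zero_free_word_def plus_free_word_def)

end

text \<open>
  The free associative algebra without unit on \<open>X\<close> consists of the combinations of nonempty
  words over \<open>X\<close>. Its \<open>one\<close> component is a mere filler for the record type and lies outside
  the carrier.
\<close>

definition free_algebra :: "'x set \<Rightarrow> ('x free_word \<Rightarrow>\<^sub>0 'k::field) ring" where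
  "free_algebra X =
     \<lparr>carrier = {p. \<forall>w\<in>Poly_Mapping.keys p. w \<noteq> 0 \<and> set (letters w) \<subseteq> X},
      mult = (*), one = 1, zero = 0, add = (+)\<rparr>"

text \<open>
  The algebra ideal generated by \<open>S\<close>. Closure under scalars has to be demanded separately,
  because the free algebra has no unit.
\<close>

definition generated_ideal ::
    "'x set \<Rightarrow> ('x free_word \<Rightarrow>\<^sub>0 'k::field) set \<Rightarrow> ('x free_word \<Rightarrow>\<^sub>0 'k) set" where
  "generated_ideal X S =
     \<Inter>{I. two_sided_ideal I (free_algebra X) \<and>
          (\<forall>c. \<forall>p\<in>I. Poly_Mapping.single 0 c * p \<in> I) \<and> S \<subseteq> I}"


section \<open>Leavitt path algebras\<close>

text \<open>
  In \<^typ>\<open>('v, 'e) pre_digraph\<close>, \<open>tail\<close> is the source map and \<open>head\<close> is the range map.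
\<close>

datatype ('v, 'e) generator = Vertex 'v | Edge 'e | Ghost 'e

definition generators :: "('v, 'e) pre_digraph \<Rightarrow> ('v, 'e) generator set" where
  "generators E = Vertex ` verts E \<union> Edge ` arcs E \<union> Ghost ` arcs E"

type_synonym ('v, 'e, 'k) free_elem = "('v, 'e) generator free_word \<Rightarrow>\<^sub>0 'k"

definition vx :: "'v \<Rightarrow> ('v, 'e, 'k::field) free_elem" where
  "vx v = Poly_Mapping.single (Word [Vertex v]) 1"

definition ed :: "'e \<Rightarrow> ('v, 'e, 'k::field) free_elem" where
  "ed e = Poly_Mapping.single (Word [Edge e]) 1"

definition gh :: "'e \<Rightarrow> ('v, 'e, 'k::field) free_elem" where
  "gh e = Poly_Mapping.single (Word [Ghost e]) 1"

definition regular_vertex :: "('v, 'e) pre_digraph \<Rightarrow> 'v \<Rightarrow> bool" where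
  "regular_vertex E v \<longleftrightarrow> v \<in> verts E \<and> out_arcs E v \<noteq> {} \<and> finite (out_arcs E v)"

definition leavitt_relations ::
    "('v, 'e) pre_digraph \<Rightarrow> ('v, 'e, 'k::field) free_elem set" where
  "leavitt_relations E =
     {vx v * vx w - (if v = w then vx v else 0) | v w. v \<in> verts E \<and> w \<in> verts E} \<union>
     {vx (tail E e) * ed e - ed e | e. e \<in> arcs E} \<union>
     {ed e * vx (head E e) - ed e | e. e \<in> arcs E} \<union>
     {vx (head E e) * gh e - gh e | e. e \<in> arcs E} \<union>
     {gh e * vx (tail E e) - gh e | e. e \<in> arcs E} \<union>
     {gh e * ed f - (if e = f then vx (head E f) else 0) | e f. e \<in> arcs E \<and> f \<in> arcs E} \<union>
     {vx v - (\<Sum>e\<in>out_arcs E v. ed e * gh e) | v. regular_vertex E v}"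

text \<open>The elements are cosets, so they are sets of elements of the free algebra.\<close>

type_synonym ('v, 'e, 'k) lpa_elem = "('v, 'e, 'k) free_elem set"

definition leavitt_path_algebra ::
    "('v, 'e) pre_digraph \<Rightarrow> ('v, 'e, 'k::field) lpa_elem ring" where
  "leavitt_path_algebra E =
     free_algebra (generators E) Quot generated_ideal (generators E) (leavitt_relations E)"

end

theory Submission
  imports Defs "HOL-Computational_Algebra.Polynomial"
begin

text \<open>
  Every ideal \<open>I\<close> with \<open>\<surd>I = P\<close>, and also \<open>P\<^sup>2\<close>, contains all idempotents of \<open>P\<close>: an element
  of \<open>\<surd>I\<close> has a power in \<open>I\<close>, by Zorn's lemma. So everything happens modulo the ideal \<open>N\<close>
  generated by these idempotents. If a polynomial with nonzero constant term in closed paths at a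
  vertex \<open>w\<close> outside \<open>P\<close> lies in \<open>P\<close>, then modulo \<open>N\<close> the vertex \<open>w\<close> lies on a cycle without
  exits. Cutting down the elements of an ideal between \<open>N\<close> and \<open>P\<close> by paths yields such
  polynomials, so the ideal is determined by its corners \<open>v I v\<close> at vertices of such cycles.
  As \<open>P\<close> is prime, all these cycles are connected, so one corner suffices. Modulo \<open>N\<close> the corner
  at \<open>v\<close> is a quotient of \<open>K[x, x\<^sup>-\<^sup>1]\<close>, in which \<open>P\<close> becomes zero or a maximal ideal \<open>(f)\<close>, and
  an ideal between \<open>(f\<^sup>n)\<close> and \<open>(f)\<close> is a power of \<open>(f)\<close>.

  To work with ideals of a ring type, the ideals of the Leavitt path algebra are pulled back to the
  free unital algebra, along the map that kills all words containing letters outside the graph.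
\<close>

section \<open>Ideals of a ring type and congruences modulo them\<close>

text \<open>The idempotents that do the work are the elements \<open>gap w F\<close>: a vertex minus
  the products \<open>D e * H e\<close> over a finite set F of edges leaving it. The obstacle is
  infinite emitters. Products \<open>a * D e\<close> have shorter ghost parts, but finitely many of
  them determine a only where w is a finite sum of \<open>D e * H e\<close>. So w is split as
  \<open>gap w F\<close> plus such a sum, with F containing the edges at which the ghost parts of a
  begin. Multiplying by the gap removes the ghost parts. If a polynomial with nonzero constant term
  \<kappa> then appears, a larger gap on both sides leaves only \<kappa> times that gap, which thus
  lies in P and, being idempotent, in N; modulo N the first gap has become a finite sum as well.
  Passing to N is harmless because an idempotent lies in every ideal that contains one of its
  positive powers, and, as its own square, in the square of P. Laurent polynomials are avoided: the
  loop at a cycle is invertible in its corner, so a power of it turns each element of the corner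
  into an ordinary polynomial, and division with remainder in K[x] suffices.\<close>

definition ring_ideal :: "'a::ring_1 set \<Rightarrow> bool" where
  "ring_ideal J \<longleftrightarrow> 0 \<in> J \<and> (\<forall>x\<in>J. \<forall>y\<in>J. x + y \<in> J) \<and> (\<forall>x\<in>J. \<forall>a. a * x \<in> J \<and> x * a \<in> J)"

lemma ring_idealD:
  assumes "ring_ideal J"
  shows "0 \<in> J"
    and "x \<in> J \<Longrightarrow> y \<in> J \<Longrightarrow> x + y \<in> J"
    and "x \<in> J \<Longrightarrow> a * x \<in> J"
    and "x \<in> J \<Longrightarrow> x * a \<in> J"
    and "x \<in> J \<Longrightarrow> - x \<in> J"
    and "x \<in> J \<Longrightarrow> y \<in> J \<Longrightarrow> x - y \<in> J"
proof -
  show m: "x \<in> J \<Longrightarrow> - x \<in> J" for x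
    using assms unfolding ring_ideal_def by (metis mult_minus1)
  show "x \<in> J \<Longrightarrow> y \<in> J \<Longrightarrow> x - y \<in> J"
    using assms m unfolding ring_ideal_def by (metis add_uminus_conv_diff)
qed (use assms in \<open>auto simp: ring_ideal_def\<close>)

lemma ring_ideal_sum:
  "ring_ideal J \<Longrightarrow> (\<And>x. x \<in> S \<Longrightarrow> f x \<in> J) \<Longrightarrow> (\<Sum>x\<in>S. f x) \<in> J"
  by (induction S rule: infinite_finite_induct) (auto intro: ring_idealD)

text \<open>
  The product of the quotients of \<^typ>\<open>'a\<close> by all of its ideals. It is a type that contains a
  copy of every quotient, so that a congruence modulo an ideal becomes an equation in a ring.
\<close>

quotient_type (overloaded) 'a quotients = "'a::ring_1 set \<Rightarrow> 'a" /
  "\<lambda>F F'. \<forall>J. ring_ideal J \<longrightarrow> F J - F' J \<in> J"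
proof (rule equivpI)
  show "reflp (\<lambda>F F'. \<forall>J. ring_ideal J \<longrightarrow> F J - (F' J :: 'a) \<in> J)"
    by (simp add: reflp_def ring_idealD(1))
  show "symp (\<lambda>F F'. \<forall>J. ring_ideal J \<longrightarrow> F J - (F' J :: 'a) \<in> J)"
    by (rule sympI) (metis minus_diff_eq ring_idealD(5))
  show "transp (\<lambda>F F'. \<forall>J. ring_ideal J \<longrightarrow> F J - (F' J :: 'a) \<in> J)"
  proof (rule transpI, intro allI impI)
    fix F F' F'' :: "'a set \<Rightarrow> 'a" and J :: "'a set"
    assume "\<forall>J. ring_ideal J \<longrightarrow> F J - F' J \<in> J" "\<forall>J. ring_ideal J \<longrightarrow> F' J - F'' J \<in> J"
      and "ring_ideal J"
    then have "(F J - F' J) + (F' J - F'' J) \<in> J" by (simp only: ring_idealD(2))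
    then show "F J - F'' J \<in> J" by simp
  qed
qed

instantiation quotients :: (ring_1) ring
begin

lift_definition zero_quotients :: "'a quotients" is "\<lambda>_. 0" .

lift_definition plus_quotients :: "'a quotients \<Rightarrow> 'a quotients \<Rightarrow> 'a quotients"
  is "\<lambda>F F' J. F J + F' J"
  by (metis add_diff_add ring_idealD(2))

lift_definition minus_quotients :: "'a quotients \<Rightarrow> 'a quotients \<Rightarrow> 'a quotients"
  is "\<lambda>F F' J. F J - F' J"
proof goal_cases
  case (1 F F1 F' F1' J)
  then have "(F J - F1 J) - (F' J - F1' J) \<in> J" by (simp add: ring_idealD(6))
  then show ?case by (simp add: algebra_simps)
qed

lift_definition uminus_quotients :: "'a quotients \<Rightarrow> 'a quotients"
  is "\<lambda>F J. - F J"
  by (metis minus_diff_minus ring_idealD(5))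

lift_definition times_quotients :: "'a quotients \<Rightarrow> 'a quotients \<Rightarrow> 'a quotients"
  is "\<lambda>F F' J. F J * F' J"
proof goal_cases
  case (1 F F1 F' F1' J)
  then have "F J * (F' J - F1' J) + (F J - F1 J) * F1' J \<in> J" by (simp add: ring_idealD)
  then show ?case by (simp add: algebra_simps)
qed

instance
  by standard (transfer; simp add: algebra_simps ring_idealD(1))+

end

text \<open>The class of x sits at the index J, with zero at every other ideal. This respects sums
  and products; \<open>proj J 1\<close> acts as an identity only on the image of
  \<open>proj J\<close>.\<close>

lift_definition proj :: "'a::ring_1 set \<Rightarrow> 'a \<Rightarrow> 'a quotients"
  is "\<lambda>J x J'. if J' = J then x else 0" .

lemma proj_hom [simp]:
  "proj J 0 = 0"
  "proj J (x + y) = proj J x + proj J y"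
  "proj J (x - y) = proj J x - proj J y"
  "proj J (- x) = - proj J x"
  "proj J (x * y) = proj J x * proj J y"
  by (transfer; simp add: ring_idealD(1))+

lemma proj_sum [simp]: "proj J (\<Sum>i\<in>S. f i) = (\<Sum>i\<in>S. proj J (f i))"
  by (induction S rule: infinite_finite_induct) auto

lemma proj_eq_iff: "ring_ideal J \<Longrightarrow> proj J x = proj J y \<longleftrightarrow> x - y \<in> J"
  by transfer (auto simp: ring_idealD(1))

lemma proj_eq_0_iff: "ring_ideal J \<Longrightarrow> proj J x = 0 \<longleftrightarrow> x \<in> J"
  using proj_eq_iff[of J x 0] by simp

lemma proj_mem:
  assumes "ring_ideal N" "ring_ideal J" "N \<subseteq> J" "proj N x = proj N y" "y \<in> J"
  shows "x \<in> J"
proof -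
  have "x - y \<in> J" using assms proj_eq_iff by blast
  then have "(x - y) + y \<in> J" using assms ring_idealD(2) by blast
  then show ?thesis by simp
qed


section \<open>Ideals of the polynomial ring over a field\<close>

definition poly_ideal :: "'k::field poly set \<Rightarrow> bool" where
  "poly_ideal Q \<longleftrightarrow> 0 \<in> Q \<and> (\<forall>p\<in>Q. \<forall>q\<in>Q. p + q \<in> Q) \<and> (\<forall>p\<in>Q. \<forall>q. q * p \<in> Q)"

lemma poly_ideal_principal:
  fixes Q :: "'k::field poly set"
  assumes "poly_ideal Q"
  obtains f where "f \<in> Q" "\<And>p. p \<in> Q \<Longrightarrow> f dvd p"
proof (cases "Q = {0}")
  case True
  then show ?thesis using that by auto
next
  case False
  then obtain p0 where "p0 \<in> Q" "p0 \<noteq> 0" using assms by (auto simp: poly_ideal_def)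
  then obtain f where f: "f \<in> Q" "f \<noteq> 0" "\<And>p. p \<in> Q \<Longrightarrow> p \<noteq> 0 \<Longrightarrow> degree f \<le> degree p"
    using ex_has_least_nat[of "\<lambda>p. p \<in> Q \<and> p \<noteq> 0" p0 degree] by auto
  have "f dvd p" if "p \<in> Q" for p
  proof -
    have "p + (- (p div f)) * f \<in> Q"
      using that f(1) assms unfolding poly_ideal_def by blast
    then have "p mod f \<in> Q" by (simp add: minus_div_mult_eq_mod)
    moreover have "p mod f = 0 \<or> degree (p mod f) < degree f"
      using degree_mod_less f(2) by blast
    ultimately have "p mod f = 0" using f(3) by fastforce
    then show ?thesis by auto
  qed
  then show ?thesis using that f(1) by blast
qed

text \<open>Nonzero primes of K[x] are maximal, by Bezout: the generator d of the ideal spanned by q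
  and f is not in Q because it divides q, so f = d e and primeness give e \<in> Q; then f divides e
  and d is a unit.\<close>

lemma poly_prime_ideal_inverse:
  fixes Q :: "'k::field poly set"
  assumes Q: "poly_ideal Q" and prime: "\<And>p q. p * q \<in> Q \<Longrightarrow> p \<in> Q \<or> q \<in> Q"
    and f: "f \<in> Q" "f \<noteq> 0" "\<And>p. p \<in> Q \<Longrightarrow> f dvd p" and "q \<notin> Q"
  obtains u where "f dvd 1 - u * q"
proof -
  let ?Q' = "{a * q + b * f | a b. True}"
  have "poly_ideal ?Q'"
    unfolding poly_ideal_def
  proof (intro conjI ballI allI)
    show "0 \<in> ?Q'" by (rule CollectI, rule exI[of _ 0], rule exI[of _ 0]) simp
    show "x + y \<in> ?Q'" if xy: "x \<in> ?Q'" "y \<in> ?Q'" for x y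
    proof -
      from xy obtain a b a' b' where "x = a * q + b * f" "y = a' * q + b' * f" by blast
      then have "x + y = (a + a') * q + (b + b') * f" by (simp add: algebra_simps)
      then show ?thesis by blast
    qed
    show "c * x \<in> ?Q'" if x: "x \<in> ?Q'" for x c
    proof -
      from x obtain a b where "x = a * q + b * f" by blast
      then have "c * x = (c * a) * q + (c * b) * f" by (simp add: algebra_simps)
      then show ?thesis by blast
    qed
  qed
  then obtain d where d: "d \<in> ?Q'" "\<And>p. p \<in> ?Q' \<Longrightarrow> d dvd p"
    using poly_ideal_principal by blast
  have "q = 1 * q + 0 * f" "f = 0 * q + 1 * f" by auto
  then have "q \<in> ?Q'" "f \<in> ?Q'" by blast+
  then have "d dvd q" "d dvd f" using d(2) by blast+
  then obtain e h where e: "f = d * e" and h: "q = h * d" by (metis dvd_def mult.commute)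
  have "d \<notin> Q" using \<open>q \<notin> Q\<close> h Q by (auto simp: poly_ideal_def)
  then have "e \<in> Q" using prime f(1) e by blast
  then obtain g where "e = d * e * g" using f(3) e by (metis dvd_def)
  then have "1 = d * g"
    using e f(2) by (metis mult.left_commute mult.right_neutral mult_cancel_left mult_eq_0_iff)
  moreover obtain a b where "d = a * q + b * f" using d(1) by blast
  ultimately have "1 - (g * a) * q = f * (b * g)" by (simp add: algebra_simps)
  then show ?thesis using that by (metis dvd_triv_left)
qed

text \<open>Let k be the least exponent with \<open>f ^ k \<in> J\<close>, and let f^j q be in J
  with j < k. If f did not divide q, then 1 = f t + u q, and multiplication by f^(k-1) would put
  f^(k-1) into J. So every element of J gains factors f until it has k of them.\<close>

lemma poly_ideal_power:
  fixes J :: "'k::field poly set"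
  assumes J: "poly_ideal J" and sub: "\<And>p. p \<in> J \<Longrightarrow> f dvd p" and "f ^ n \<in> J"
    and inv: "\<And>q. \<not> f dvd q \<Longrightarrow> \<exists>u. f dvd 1 - u * q"
  obtains k where "k \<le> n" "J = {p. f ^ k dvd p}"
proof -
  define k where "k = (LEAST k. f ^ k \<in> J)"
  have k: "f ^ k \<in> J" and least: "\<And>j. f ^ j \<in> J \<Longrightarrow> k \<le> j"
    unfolding k_def using \<open>f ^ n \<in> J\<close> by (auto intro: LeastI Least_le)
  have "f ^ j dvd p" if "p \<in> J" "j \<le> k" for p j
    using that(2)
  proof (induction j)
    case (Suc j)
    then obtain q where q: "p = f ^ j * q" by auto
    have "f dvd q"
    proof (rule ccontr)
      assume "\<not> f dvd q"
      then obtain u t where "1 - u * q = f * t" using inv by (metis dvd_def)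
      then have "1 = f * t + u * q" by (simp add: algebra_simps)
      then have "f ^ (k - 1) = f ^ (k - 1) * (f * t + u * q)" by simp
      also have "\<dots> = t * (f ^ (k - 1) * f) + u * (f ^ (k - 1) * q)" by (simp add: algebra_simps)
      also have "f ^ (k - 1) * f = f ^ k" using Suc.prems by (cases k) simp_all
      also have "f ^ (k - 1) * q = f ^ (k - 1 - j) * p"
      proof -
        have "f ^ (k - 1) = f ^ (k - 1 - j) * f ^ j" using Suc.prems by (simp flip: power_add)
        then show ?thesis using q by (simp add: mult.assoc)
      qed
      also have "u * (f ^ (k - 1 - j) * p) = (u * f ^ (k - 1 - j)) * p" by (simp add: mult.assoc)
      finally have eq: "f ^ (k - 1) = t * f ^ k + (u * f ^ (k - 1 - j)) * p" .
      have "f ^ (k - 1) \<in> J"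
        using k \<open>p \<in> J\<close> J unfolding eq poly_ideal_def by blast
      then show False using least[of "k - 1"] Suc.prems by simp
    qed
    then show ?case using q by (simp add: mult_dvd_mono mult.commute)
  qed simp
  then have "J = {p. f ^ k dvd p}"
    using k J by (auto simp: poly_ideal_def dvd_def mult.commute)
  then show ?thesis using that least \<open>f ^ n \<in> J\<close> by blast
qed

section \<open>Paths and ghost paths modulo an ideal\<close>

text \<open>
  \<open>V\<close>, \<open>D\<close> and \<open>H\<close> are the vertices, edges and ghost edges; they satisfy, modulo \<open>N\<close>, all
  relations of a Leavitt path algebra except (CK2), which the argument does not need.
  \<open>M\<close> is the augmentation ideal, that is, the span of the nonempty words in the generators.
\<close>

locale leavitt_family =
  fixes N M :: "'a::ring_1 set"
    and sc :: "'k::field \<Rightarrow> 'a"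
    and V :: "'v \<Rightarrow> 'a" and D H :: "'e \<Rightarrow> 'a"
    and A :: "'e set" and s r :: "'e \<Rightarrow> 'v"
  assumes N: "ring_ideal N" and M: "ring_ideal M" and N_M: "N \<subseteq> M"
    and sc_add: "sc (a + b) = sc a + sc b" and sc_mult: "sc (a * b) = sc a * sc b"
    and sc_1 [simp]: "sc 1 = 1" and sc_comm: "x * sc a = sc a * x"
    and V_M: "V v \<in> M"
    and VV: "V v * V w - (if v = w then V v else 0) \<in> N"
    and VD: "e \<in> A \<Longrightarrow> V (s e) * D e - D e \<in> N"
    and DV: "e \<in> A \<Longrightarrow> D e * V (r e) - D e \<in> N"
    and VH: "e \<in> A \<Longrightarrow> V (r e) * H e - H e \<in> N"
    and HV: "e \<in> A \<Longrightarrow> H e * V (s e) - H e \<in> N"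
    and HD: "e \<in> A \<Longrightarrow> f \<in> A \<Longrightarrow> H e * D f - (if e = f then V (r f) else 0) \<in> N"
    and M_subset: "\<lbrakk>\<And>x. x \<in> N \<Longrightarrow> x \<in> S; \<And>x y. x \<in> S \<Longrightarrow> y \<in> S \<Longrightarrow> x + y \<in> S;
      \<And>v. V v \<in> S; \<And>e. e \<in> A \<Longrightarrow> D e \<in> S; \<And>e. e \<in> A \<Longrightarrow> H e \<in> S;
      \<And>k x. x \<in> S \<Longrightarrow> sc k * x \<in> S; \<And>v x. x \<in> S \<Longrightarrow> V v * x \<in> S;
      \<And>e x. e \<in> A \<Longrightarrow> x \<in> S \<Longrightarrow> D e * x \<in> S; \<And>e x. e \<in> A \<Longrightarrow> x \<in> S \<Longrightarrow> H e * x \<in> S\<rbrakk> \<Longrightarrow> M \<subseteq> S"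
begin

abbreviation \<phi> :: "'a \<Rightarrow> 'a quotients" where "\<phi> \<equiv> proj N"

lemma \<phi>_eq_iff: "\<phi> x = \<phi> y \<longleftrightarrow> x - y \<in> N"
  by (rule proj_eq_iff[OF N])

lemma \<phi>_eq_0_iff: "\<phi> x = 0 \<longleftrightarrow> x \<in> N"
  by (rule proj_eq_0_iff[OF N])

lemma \<phi>_mem: "ring_ideal J \<Longrightarrow> N \<subseteq> J \<Longrightarrow> \<phi> x = \<phi> y \<Longrightarrow> y \<in> J \<Longrightarrow> x \<in> J"
  by (rule proj_mem[OF N])

lemma sc_0 [simp]: "sc 0 = 0"
  using sc_add[of 0 0] by simp

lemma sc_cancel: "\<kappa> \<noteq> 0 \<Longrightarrow> ring_ideal J \<Longrightarrow> sc \<kappa> * x \<in> J \<Longrightarrow> x \<in> J"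
proof -
  assume "\<kappa> \<noteq> 0" "ring_ideal J" "sc \<kappa> * x \<in> J"
  then have "sc (1 / \<kappa>) * (sc \<kappa> * x) \<in> J" by (simp add: ring_idealD(3))
  then show ?thesis using \<open>\<kappa> \<noteq> 0\<close> by (simp flip: mult.assoc sc_mult)
qed

text \<open>Products are normalised by associating to the right, where the two factors of a rule may
  be followed by a third; this supplies the matching form of each rule.\<close>

lemma \<phi>_assoc: "\<phi> a * \<phi> b = c \<Longrightarrow> \<phi> a * (\<phi> b * z) = c * z"
  by (simp flip: mult.assoc)

lemma \<phi>_1 [simp]: "\<phi> 1 * \<phi> x = \<phi> x" "\<phi> x * \<phi> 1 = \<phi> x"
  by (simp_all flip: proj_hom(5))

lemma \<phi>_sc: "\<phi> x * \<phi> (sc k) = \<phi> (sc k) * \<phi> x"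
  using arg_cong[OF sc_comm[of x k], of \<phi>] by simp

lemma \<phi>_sc_left: "\<phi> x * (\<phi> (sc k) * y) = \<phi> (sc k) * (\<phi> x * y)"
  using \<phi>_sc[of x k] by (simp flip: mult.assoc)

lemma \<phi>_VV: "\<phi> (V v) * \<phi> (V w) = (if v = w then \<phi> (V v) else 0)"
  using VV[of v w] \<phi>_eq_iff[of "V v * V w" "if v = w then V v else 0"] by (auto split: if_splits)

lemma \<phi>_VD: "e \<in> A \<Longrightarrow> \<phi> (V v) * \<phi> (D e) = (if v = s e then \<phi> (D e) else 0)"
proof -
  assume "e \<in> A"
  then have *: "\<phi> (D e) = \<phi> (V (s e)) * \<phi> (D e)"
    using VD \<phi>_eq_iff by (metis proj_hom(5))
  then have "\<phi> (V v) * \<phi> (D e) = \<phi> (V v) * \<phi> (V (s e)) * \<phi> (D e)"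
    by (metis mult.assoc)
  then show ?thesis by (simp add: \<phi>_VV *[symmetric])
qed

lemma \<phi>_DV: "e \<in> A \<Longrightarrow> \<phi> (D e) * \<phi> (V v) = (if v = r e then \<phi> (D e) else 0)"
proof -
  assume "e \<in> A"
  then have *: "\<phi> (D e) = \<phi> (D e) * \<phi> (V (r e))"
    using DV \<phi>_eq_iff by (metis proj_hom(5))
  then have "\<phi> (D e) * \<phi> (V v) = \<phi> (D e) * (\<phi> (V (r e)) * \<phi> (V v))"
    by (metis mult.assoc)
  then show ?thesis by (simp add: \<phi>_VV *[symmetric])
qed

lemma \<phi>_VH: "e \<in> A \<Longrightarrow> \<phi> (V v) * \<phi> (H e) = (if v = r e then \<phi> (H e) else 0)"
proof -
  assume "e \<in> A"
  then have *: "\<phi> (H e) = \<phi> (V (r e)) * \<phi> (H e)"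
    using VH \<phi>_eq_iff by (metis proj_hom(5))
  then have "\<phi> (V v) * \<phi> (H e) = \<phi> (V v) * \<phi> (V (r e)) * \<phi> (H e)"
    by (metis mult.assoc)
  then show ?thesis by (simp add: \<phi>_VV *[symmetric])
qed

lemma \<phi>_HV: "e \<in> A \<Longrightarrow> \<phi> (H e) * \<phi> (V v) = (if v = s e then \<phi> (H e) else 0)"
proof -
  assume "e \<in> A"
  then have *: "\<phi> (H e) = \<phi> (H e) * \<phi> (V (s e))"
    using HV \<phi>_eq_iff by (metis proj_hom(5))
  then have "\<phi> (H e) * \<phi> (V v) = \<phi> (H e) * (\<phi> (V (s e)) * \<phi> (V v))"
    by (metis mult.assoc)
  then show ?thesis by (simp add: \<phi>_VV *[symmetric])
qed

lemma \<phi>_HD: "e \<in> A \<Longrightarrow> f \<in> A \<Longrightarrow> \<phi> (H e) * \<phi> (D f) = (if e = f then \<phi> (V (r f)) else 0)"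
  using HD[of e f] \<phi>_eq_iff[of "H e * D f" "if e = f then V (r f) else 0"]
  by (auto split: if_splits)

lemmas \<phi>_rules = \<phi>_VV \<phi>_VD \<phi>_DV \<phi>_VH \<phi>_HV \<phi>_HD
  \<phi>_VV[THEN \<phi>_assoc] \<phi>_VD[THEN \<phi>_assoc] \<phi>_DV[THEN \<phi>_assoc] \<phi>_VH[THEN \<phi>_assoc]
  \<phi>_HV[THEN \<phi>_assoc] \<phi>_HD[THEN \<phi>_assoc]

section \<open>Paths, ghost paths and their products\<close>

primrec walk :: "'v \<Rightarrow> 'e list \<Rightarrow> 'v \<Rightarrow> bool" where
  "walk u [] w \<longleftrightarrow> u = w"
| "walk u (e # \<alpha>) w \<longleftrightarrow> e \<in> A \<and> s e = u \<and> walk (r e) \<alpha> w"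

text \<open>\<open>pe u \<alpha>\<close> is the path \<alpha>, \<open>ge u \<alpha>\<close> its
  ghost \<alpha>^*. An empty list of edges does not determine a vertex, hence the argument u; the
  empty path is the vertex u and not 1.\<close>

primrec pe :: "'v \<Rightarrow> 'e list \<Rightarrow> 'a" where
  "pe u [] = V u"
| "pe u (e # \<alpha>) = D e * pe (r e) \<alpha>"

primrec ge :: "'v \<Rightarrow> 'e list \<Rightarrow> 'a" where
  "ge u [] = V u"
| "ge u (e # \<alpha>) = ge (r e) \<alpha> * H e"

lemma walk_append: "walk u (\<alpha> @ \<beta>) w \<longleftrightarrow> (\<exists>v. walk u \<alpha> v \<and> walk v \<beta> w)"
  by (induction \<alpha> arbitrary: u) auto

lemma walk_unique: "walk u \<alpha> v \<Longrightarrow> walk u \<alpha> w \<Longrightarrow> v = w"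
  by (induction \<alpha> arbitrary: u) auto

lemma walk_snoc: "walk u \<alpha> w \<Longrightarrow> e \<in> A \<Longrightarrow> s e = w \<Longrightarrow> walk u (\<alpha> @ [e]) (r e)"
  by (auto simp: walk_append)

lemma V_pe: "walk u \<alpha> w \<Longrightarrow> \<phi> (V x) * \<phi> (pe u \<alpha>) = (if x = u then \<phi> (pe u \<alpha>) else 0)"
  by (cases \<alpha>) (auto simp: \<phi>_rules)

lemma pe_V: "walk u \<alpha> w \<Longrightarrow> \<phi> (pe u \<alpha>) * \<phi> (V x) = (if x = w then \<phi> (pe u \<alpha>) else 0)"
  by (induction \<alpha> arbitrary: u) (auto simp: \<phi>_rules mult.assoc)

lemma ge_V: "walk u \<alpha> w \<Longrightarrow> \<phi> (ge u \<alpha>) * \<phi> (V x) = (if x = u then \<phi> (ge u \<alpha>) else 0)"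
  by (cases \<alpha>) (auto simp: \<phi>_rules mult.assoc)

lemma V_ge: "walk u \<alpha> w \<Longrightarrow> \<phi> (V x) * \<phi> (ge u \<alpha>) = (if x = w then \<phi> (ge u \<alpha>) else 0)"
  by (induction \<alpha> arbitrary: u) (auto simp: \<phi>_rules simp flip: mult.assoc)

lemmas path_rules = V_pe pe_V ge_V V_ge
  V_pe[THEN \<phi>_assoc] pe_V[THEN \<phi>_assoc] ge_V[THEN \<phi>_assoc] V_ge[THEN \<phi>_assoc]

lemma pe_append:
  "walk u \<alpha> w \<Longrightarrow> walk w \<beta> z \<Longrightarrow> \<phi> (pe u (\<alpha> @ \<beta>)) = \<phi> (pe u \<alpha>) * \<phi> (pe w \<beta>)"
  by (induction \<alpha> arbitrary: u) (auto simp: path_rules mult.assoc)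

lemma pe_snoc: "walk u \<alpha> (s e) \<Longrightarrow> e \<in> A \<Longrightarrow> \<phi> (pe u (\<alpha> @ [e])) = \<phi> (pe u \<alpha>) * \<phi> (D e)"
  using pe_append[of u \<alpha> "s e" "[e]" "r e"] by (simp add: \<phi>_rules)

lemma ge_append:
  "walk u \<alpha> w \<Longrightarrow> walk w \<beta> z \<Longrightarrow> \<phi> (ge u (\<alpha> @ \<beta>)) = \<phi> (ge w \<beta>) * \<phi> (ge u \<alpha>)"
  by (induction \<alpha> arbitrary: u) (auto simp: path_rules simp flip: mult.assoc)

lemma ge_snoc: "walk u \<alpha> (s e) \<Longrightarrow> e \<in> A \<Longrightarrow> \<phi> (ge u (\<alpha> @ [e])) = \<phi> (H e) * \<phi> (ge u \<alpha>)"
  using ge_append[of u \<alpha> "s e" "[e]" "r e"] by (simp add: \<phi>_rules)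

lemma ge_pe_prefix:
  "walk u \<alpha> w \<Longrightarrow> walk w \<beta> z \<Longrightarrow> \<phi> (ge u \<alpha>) * \<phi> (pe u (\<alpha> @ \<beta>)) = \<phi> (pe w \<beta>)"
proof (induction \<alpha> arbitrary: u)
  case (Cons e \<alpha>)
  then have "walk (r e) (\<alpha> @ \<beta>) z" by (auto simp: walk_append)
  then show ?case using Cons by (simp add: \<phi>_rules mult.assoc V_pe)
qed (simp add: V_pe)

lemma ge_pe: "walk u \<alpha> w \<Longrightarrow> \<phi> (ge u \<alpha>) * \<phi> (pe u \<alpha>) = \<phi> (V w)"
  using ge_pe_prefix[of u \<alpha> w "[]" w] by simp

lemma ge_pe_zero:
  "walk u \<alpha> w \<Longrightarrow> walk u \<beta> z \<Longrightarrow> length \<alpha> \<le> length \<beta> \<Longrightarrow> take (length \<alpha>) \<beta> \<noteq> \<alpha> \<Longrightarrow>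
    \<phi> (ge u \<alpha>) * \<phi> (pe u \<beta>) = 0"
proof (induction \<alpha> arbitrary: u \<beta>)
  case (Cons e \<alpha>)
  then obtain f \<beta>' where \<beta>: "\<beta> = f # \<beta>'" by (cases \<beta>) auto
  show ?case
    using Cons.prems Cons.IH[of "r e" \<beta>'] by (auto simp: \<beta> \<phi>_rules mult.assoc V_pe)
qed simp

text \<open>Finite sums of vertices are local units. \<open>M_subset\<close> serves as induction
  over words. The property proved speaks of all finite sets above some U0 rather than of one set, so
  that two summands can share a set; a letter on the left adds to U0 only the vertex that fixes it
  from the left.\<close>

lemma M_local_units:
  assumes "a \<in> M"
  obtains U where "finite U" "\<phi> a = (\<Sum>u\<in>U. \<Sum>w\<in>U. \<phi> (V u * a * V w))"
proof -
  define unit where "unit U = (\<Sum>u\<in>U. \<phi> (V u))" for U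
  have unitL: "unit U * y = y" if "finite U" "v \<in> U" "\<And>u. \<phi> (V u) * y = (if u = v then y else 0)" for U v y
    using that by (simp add: unit_def sum_distrib_right)
  have unitR: "y * unit U = y" if "finite U" "v \<in> U" "\<And>u. y * \<phi> (V u) = (if u = v then y else 0)" for U v y
    using that by (simp add: unit_def sum_distrib_left)
  let ?S = "{a. \<exists>U0. finite U0 \<and>
    (\<forall>U. finite U \<longrightarrow> U0 \<subseteq> U \<longrightarrow> unit U * \<phi> a = \<phi> a \<and> \<phi> a * unit U = \<phi> a)}"
  have letter: "a * x \<in> ?S"
    if x: "x \<in> ?S" and v: "\<And>u. \<phi> (V u) * \<phi> a = (if u = v then \<phi> a else 0)" for a v x
  proof -
    obtain U0 where U0: "finite U0"
      "\<forall>U. finite U \<longrightarrow> U0 \<subseteq> U \<longrightarrow> unit U * \<phi> x = \<phi> x \<and> \<phi> x * unit U = \<phi> x"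
      using x by blast
    have "unit U * \<phi> (a * x) = \<phi> (a * x) \<and> \<phi> (a * x) * unit U = \<phi> (a * x)"
      if "finite U" "insert v U0 \<subseteq> U" for U
      using that unitL[of U v "\<phi> a", OF _ _ v] U0(2) by (simp add: mult.assoc) (simp flip: mult.assoc)
    moreover have "finite (insert v U0)" using U0(1) by simp
    ultimately show ?thesis by blast
  qed
  have single: "a \<in> ?S"
    if v: "\<And>u. \<phi> (V u) * \<phi> a = (if u = v then \<phi> a else 0)"
      and w: "\<And>u. \<phi> a * \<phi> (V u) = (if u = w then \<phi> a else 0)" for a v w
  proof -
    have "unit U * \<phi> a = \<phi> a \<and> \<phi> a * unit U = \<phi> a" if "finite U" "{v, w} \<subseteq> U" for U
      using that unitL[of U v, OF _ _ v] unitR[of U w, OF _ _ w] by simp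
    moreover have "finite {v, w}" by simp
    ultimately show ?thesis by blast
  qed
  have "M \<subseteq> ?S"
  proof (rule M_subset)
    fix x assume "x \<in> N"
    then have "\<phi> x = 0" by (simp add: \<phi>_eq_0_iff)
    then show "x \<in> ?S" by (auto intro: exI[of _ "{}"])
  next
    fix x y assume "x \<in> ?S" "y \<in> ?S"
    then obtain U1 U2 where U12: "finite U1" "finite U2"
      "\<forall>U. finite U \<longrightarrow> U1 \<subseteq> U \<longrightarrow> unit U * \<phi> x = \<phi> x \<and> \<phi> x * unit U = \<phi> x"
      "\<forall>U. finite U \<longrightarrow> U2 \<subseteq> U \<longrightarrow> unit U * \<phi> y = \<phi> y \<and> \<phi> y * unit U = \<phi> y"
      by blast
    have "unit U * \<phi> (x + y) = \<phi> (x + y) \<and> \<phi> (x + y) * unit U = \<phi> (x + y)"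
      if "finite U" "U1 \<union> U2 \<subseteq> U" for U
      using that U12(3,4) by (simp add: distrib_left distrib_right)
    moreover have "finite (U1 \<union> U2)" using U12 by simp
    ultimately show "x + y \<in> ?S" by blast
  next
    fix v
    show "V v \<in> ?S" by (rule single[of _ v v]) (auto simp: \<phi>_VV)
  next
    fix e assume e: "e \<in> A"
    show "D e \<in> ?S" by (rule single[of _ "s e" "r e"]) (auto simp: \<phi>_rules e)
    show "H e \<in> ?S" by (rule single[of _ "r e" "s e"]) (auto simp: \<phi>_rules e)
  next
    fix k x assume "x \<in> ?S"
    then obtain U0 where U0: "finite U0"
      "\<forall>U. finite U \<longrightarrow> U0 \<subseteq> U \<longrightarrow> unit U * \<phi> x = \<phi> x \<and> \<phi> x * unit U = \<phi> x"
      by blast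
    have "unit U * (\<phi> (sc k) * \<phi> x) = \<phi> (sc k) * (unit U * \<phi> x)" for U
      by (simp add: unit_def sum_distrib_left sum_distrib_right \<phi>_sc_left)
    then show "sc k * x \<in> ?S"
      using U0 by (auto simp: mult.assoc intro!: exI[of _ U0])
  next
    fix v x assume "x \<in> ?S"
    then show "V v * x \<in> ?S" by (rule letter[of _ _ v]) (auto simp: \<phi>_VV)
  next
    fix e x assume "e \<in> A" "x \<in> ?S"
    then show "D e * x \<in> ?S" by (intro letter[of _ _ "s e"]) (auto simp: \<phi>_VD)
  next
    fix e x assume "e \<in> A" "x \<in> ?S"
    then show "H e * x \<in> ?S" by (intro letter[of _ _ "r e"]) (auto simp: \<phi>_VH)
  qed
  then obtain U where U: "finite U" "unit U * \<phi> a = \<phi> a" "\<phi> a * unit U = \<phi> a"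
    using assms by blast
  then have "\<phi> a = unit U * \<phi> a * unit U" by simp
  also have "\<dots> = (\<Sum>u\<in>U. \<Sum>w\<in>U. \<phi> (V u * a * V w))"
    by (simp add: unit_def sum_distrib_left sum_distrib_right) (rule sum.swap)
  finally show ?thesis using that U(1) by blast
qed

lemma M_local:
  assumes "a \<in> M" "ring_ideal J" "N \<subseteq> J" "\<And>u w. V u * a * V w \<in> J"
  shows "a \<in> J"
proof -
  obtain U where U: "\<phi> a = (\<Sum>u\<in>U. \<Sum>w\<in>U. \<phi> (V u * a * V w))"
    using M_local_units[OF assms(1)] by blast
  have "(\<Sum>u\<in>U. \<Sum>w\<in>U. V u * a * V w) \<in> J"
    using assms(2,4) by (intro ring_ideal_sum)
  moreover have "\<phi> a = \<phi> (\<Sum>u\<in>U. \<Sum>w\<in>U. V u * a * V w)"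
    using U by (simp only: proj_sum)
  ultimately show ?thesis using \<phi>_mem[OF assms(2,3)] by blast
qed

section \<open>Vertices minus finitely many edge projections\<close>

definition out :: "'v \<Rightarrow> 'e set" where "out w = {e \<in> A. s e = w}"

text \<open>For empty F this is the vertex, for all edges leaving a regular vertex it is the element
  killed by (CK2), and at infinite emitters it has the shape of the idempotents attached to breaking
  vertices. Arbitrary finite F treat these cases alike.\<close>

definition gap :: "'v \<Rightarrow> 'e set \<Rightarrow> 'a" where "gap w F = V w - (\<Sum>e\<in>F. D e * H e)"

lemma \<phi>_gap: "\<phi> (gap w F) = \<phi> (V w) - (\<Sum>e\<in>F. \<phi> (D e) * \<phi> (H e))"
  by (simp add: gap_def)

lemma gap_D:
  assumes "finite F" "F \<subseteq> out w" "e \<in> out w"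
  shows "\<phi> (gap w F) * \<phi> (D e) = (if e \<in> F then 0 else \<phi> (D e))"
proof -
  have "(\<Sum>f\<in>F. \<phi> (D f) * (\<phi> (H f) * \<phi> (D e))) = (\<Sum>f\<in>F. if f = e then \<phi> (D e) else 0)"
    using assms by (intro sum.cong refl) (auto simp: \<phi>_rules out_def)
  then show ?thesis
    using assms by (simp add: \<phi>_gap left_diff_distrib sum_distrib_right mult.assoc \<phi>_rules out_def)
qed

lemma H_gap:
  assumes "finite F" "F \<subseteq> out w" "e \<in> out w"
  shows "\<phi> (H e) * \<phi> (gap w F) = (if e \<in> F then 0 else \<phi> (H e))"
proof -
  have "(\<Sum>f\<in>F. \<phi> (H e) * (\<phi> (D f) * \<phi> (H f))) = (\<Sum>f\<in>F. if f = e then \<phi> (H e) else 0)"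
    using assms by (intro sum.cong refl) (auto simp: \<phi>_rules out_def)
  then show ?thesis
    using assms by (simp add: \<phi>_gap right_diff_distrib sum_distrib_left \<phi>_rules out_def)
qed

lemma V_gap: "F \<subseteq> out w \<Longrightarrow> \<phi> (V w) * \<phi> (gap w F) = \<phi> (gap w F)"
proof -
  assume "F \<subseteq> out w"
  then have "(\<Sum>e\<in>F. \<phi> (V w) * (\<phi> (D e) * \<phi> (H e))) = (\<Sum>e\<in>F. \<phi> (D e) * \<phi> (H e))"
    by (intro sum.cong refl) (auto simp: \<phi>_rules out_def)
  then show ?thesis by (simp add: \<phi>_gap right_diff_distrib sum_distrib_left \<phi>_VV)
qed

lemma gap_V: "F \<subseteq> out w \<Longrightarrow> \<phi> (gap w F) * \<phi> (V w) = \<phi> (gap w F)"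
proof -
  assume "F \<subseteq> out w"
  then have "(\<Sum>e\<in>F. \<phi> (D e) * (\<phi> (H e) * \<phi> (V w))) = (\<Sum>e\<in>F. \<phi> (D e) * \<phi> (H e))"
    by (intro sum.cong refl) (auto simp: \<phi>_rules out_def)
  then show ?thesis by (simp add: \<phi>_gap left_diff_distrib sum_distrib_right \<phi>_VV mult.assoc)
qed

lemma gap_diff:
  "finite F' \<Longrightarrow> F \<subseteq> F' \<Longrightarrow> \<phi> (gap w F) = \<phi> (gap w F') + (\<Sum>e\<in>F' - F. \<phi> (D e) * \<phi> (H e))"
  by (simp add: \<phi>_gap sum_diff)

text \<open>The larger set has the smaller idempotent: \<open>gap w F'\<close> annihilates
  \<open>D e\<close> for each e in F, so only the vertex summand of \<open>gap w F\<close> survives.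
  The case F = F' is idempotency.\<close>

lemma gap_gap:
  assumes "finite F'" "F \<subseteq> F'" "F' \<subseteq> out w"
  shows "\<phi> (gap w F') * \<phi> (gap w F) = \<phi> (gap w F')"
proof -
  have "(\<Sum>e\<in>F. \<phi> (gap w F') * (\<phi> (D e) * \<phi> (H e))) = 0"
    using assms by (intro sum.neutral ballI) (simp add: subset_iff gap_D flip: mult.assoc)
  then show ?thesis
    using assms by (simp add: \<phi>_gap[of w F] right_diff_distrib sum_distrib_left gap_V)
qed

lemma gap_idempotent:
  assumes "finite F" "F \<subseteq> out w"
  shows "gap w F * gap w F - gap w F \<in> N"
  using gap_gap[of F F w] assms by (simp flip: \<phi>_eq_iff)

lemma gap_pe_Cons:
  assumes "finite F" "F \<subseteq> out w" "walk w (e # \<delta>) z"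
  shows "\<phi> (gap w F) * \<phi> (pe w (e # \<delta>)) = (if e \<in> F then 0 else \<phi> (pe w (e # \<delta>)))"
  using assms gap_D[of F w e] by (simp add: out_def flip: mult.assoc)

text \<open>Linear combinations of paths are kept as lists in which a path may occur repeatedly; the
  number of entries is the measure of the later inductions.\<close>

definition val :: "'v \<Rightarrow> ('k \<times> 'e list) list \<Rightarrow> 'a" where
  "val u bs = (\<Sum>(k, \<gamma>)\<leftarrow>bs. sc k * pe u \<gamma>)"

lemma val_simps [simp]:
  "val u [] = 0"
  "val u ((k, \<gamma>) # bs) = sc k * pe u \<gamma> + val u bs"
  "val u (bs @ cs) = val u bs + val u cs"
  by (simp_all add: val_def)

definition walks :: "'v \<Rightarrow> 'v \<Rightarrow> ('k \<times> 'e list) list \<Rightarrow> bool" where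
  "walks u w bs \<longleftrightarrow> (\<forall>(k, \<gamma>)\<in>set bs. walk u \<gamma> w)"

lemma walks_simps [simp]:
  "walks u w []"
  "walks u w ((k, \<gamma>) # bs) \<longleftrightarrow> walk u \<gamma> w \<and> walks u w bs"
  "walks u w (bs @ cs) \<longleftrightarrow> walks u w bs \<and> walks u w cs"
  by (auto simp: walks_def)

lemma walks_filter [simp]: "walks u w bs \<Longrightarrow> walks u w (filter Q bs)"
  by (auto simp: walks_def)

lemma val_V: "walks u w bs \<Longrightarrow> \<phi> (val u bs) * \<phi> (V w) = \<phi> (val u bs)"
  by (induction bs) (auto simp: distrib_right pe_V mult.assoc)

lemma val_D:
  "walks u w bs \<Longrightarrow> e \<in> out w \<Longrightarrow>
    \<phi> (val u bs) * \<phi> (D e) = \<phi> (val u (map (\<lambda>(k, \<gamma>). (k, \<gamma> @ [e])) bs))"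
  by (induction bs) (auto simp: distrib_right mult.assoc pe_snoc out_def)

lemma walks_snoc:
  "walks u w bs \<Longrightarrow> e \<in> out w \<Longrightarrow> walks u (r e) (map (\<lambda>(k, \<gamma>). (k, \<gamma> @ [e])) bs)"
  by (induction bs) (auto simp: walk_snoc out_def)

text \<open>Relations persist modulo a larger ideal. This leads from the kernel given by the graph
  to the one enlarged by idempotents.\<close>

lemma change_kernel:
  assumes "ring_ideal N'" "N \<subseteq> N'" "N' \<subseteq> M"
  shows "leavitt_family N' M sc V D H A s r"
proof
  show "M \<subseteq> S"
    if "\<And>x. x \<in> N' \<Longrightarrow> x \<in> S" "\<And>x y. x \<in> S \<Longrightarrow> y \<in> S \<Longrightarrow> x + y \<in> S"
      "\<And>v. V v \<in> S" "\<And>e. e \<in> A \<Longrightarrow> D e \<in> S" "\<And>e. e \<in> A \<Longrightarrow> H e \<in> S"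
      "\<And>k x. x \<in> S \<Longrightarrow> sc k * x \<in> S" "\<And>v x. x \<in> S \<Longrightarrow> V v * x \<in> S"
      "\<And>e x. e \<in> A \<Longrightarrow> x \<in> S \<Longrightarrow> D e * x \<in> S" "\<And>e x. e \<in> A \<Longrightarrow> x \<in> S \<Longrightarrow> H e * x \<in> S" for S
  proof (rule M_subset)
    show "x \<in> S" if "x \<in> N" for x using \<open>\<And>x. x \<in> N' \<Longrightarrow> x \<in> S\<close> assms(2) that by blast
  qed (fact that)+
qed (fact assms M sc_add sc_mult sc_1 sc_comm V_M
    subsetD[OF assms(2) VV] subsetD[OF assms(2) VD] subsetD[OF assms(2) DV]
    subsetD[OF assms(2) VH] subsetD[OF assms(2) HV] subsetD[OF assms(2) HD])+

end

section \<open>Cycles without exits modulo a prime ideal\<close>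

text \<open>\<open>gap_N\<close> is the form in which the choice of N enters: gaps are idempotent,
  so those in P are in N. \<open>prime\<close> is primeness for elements, with y ranging over the
  whole unital ring.\<close>

locale leavitt_prime = leavitt_family N M sc V D H A s r
  for N M :: "'a::ring_1 set" and sc :: "'k::field \<Rightarrow> 'a"
    and V :: "'v \<Rightarrow> 'a" and D H :: "'e \<Rightarrow> 'a"
    and A :: "'e set" and s r :: "'e \<Rightarrow> 'v" +
  fixes P :: "'a set"
  assumes P: "ring_ideal P" and N_P: "N \<subseteq> P" and P_M: "P \<subseteq> M"
    and prime: "x \<in> M \<Longrightarrow> z \<in> M \<Longrightarrow> (\<And>y. x * y * z \<in> P) \<Longrightarrow> x \<in> P \<or> z \<in> P"
    and gap_N: "finite F \<Longrightarrow> F \<subseteq> out w \<Longrightarrow> gap w F \<in> P \<Longrightarrow> gap w F \<in> N"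
begin

lemma V_N: "V v \<in> P \<Longrightarrow> V v \<in> N"
  using gap_N[of "{}" v] by (simp add: gap_def)

text \<open>Modulo N, \<open>V (r e)\<close> equals \<open>H e * V (s e) * D e\<close>; thus the
  vertices in P form a hereditary set.\<close>

lemma walk_P: "walk u \<alpha> w \<Longrightarrow> V u \<in> P \<Longrightarrow> V w \<in> P"
proof (induction \<alpha> arbitrary: u)
  case (Cons e \<alpha>)
  then have "H e * (V (s e) * D e) \<in> P" using P by (auto intro: ring_idealD)
  moreover have "\<phi> (V (r e)) = \<phi> (H e * (V (s e) * D e))"
    using Cons.prems by (simp add: \<phi>_rules)
  ultimately have "V (r e) \<in> P" using \<phi>_mem[OF P N_P] by blast
  then show ?case using Cons.prems(1) Cons.IH by auto
qed simp

definition closed_walks :: "'v \<Rightarrow> ('k \<times> 'e list) list \<Rightarrow> bool" where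
  "closed_walks w ds \<longleftrightarrow> (\<forall>(k, \<delta>)\<in>set ds. walk w \<delta> w \<and> \<delta> \<noteq> [])"

lemma closed_walks_simps [simp]:
  "closed_walks w []"
  "closed_walks w ((k, \<delta>) # ds) \<longleftrightarrow> walk w \<delta> w \<and> \<delta> \<noteq> [] \<and> closed_walks w ds"
  by (auto simp: closed_walks_def)

text \<open>By (CK1) the gap kills \<open>D e\<close> for e in F, and with it every walk beginning
  with e. The walks in \<open>closed_walks\<close> are nonempty, so each has a first edge.\<close>

lemma gap_val:
  "closed_walks w ds \<Longrightarrow> finite F \<Longrightarrow> F \<subseteq> out w \<Longrightarrow> (\<And>k \<delta>. (k, \<delta>) \<in> set ds \<Longrightarrow> hd \<delta> \<in> F) \<Longrightarrow>
    \<phi> (gap w F) * \<phi> (val w ds) = 0"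
proof (induction ds)
  case (Cons kd ds)
  obtain k \<delta> where kd: "kd = (k, \<delta>)" by fastforce
  have "\<phi> (gap w F) * \<phi> (val w ds) = 0" using Cons kd by auto
  moreover have "\<phi> (gap w F) * \<phi> (pe w \<delta>) = 0"
    using Cons.prems(1,2,3) Cons.prems(4)[of k \<delta>] gap_pe_Cons[of F w "hd \<delta>" "tl \<delta>" w]
    by (cases \<delta>) (auto simp: kd)
  ultimately show ?case by (simp add: kd distrib_left \<phi>_sc_left)
qed simp

text \<open>The effect of multiplying by \<open>H e\<close> on the left and \<open>D e\<close> on
  the right: a closed walk e \<eta> turns into \<eta> e, and one with another first edge
  vanishes.\<close>

definition rotate_walks :: "'e \<Rightarrow> ('k \<times> 'e list) list \<Rightarrow> ('k \<times> 'e list) list" where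
  "rotate_walks e ds = map (\<lambda>(k, \<delta>). (k, tl \<delta> @ [e])) (filter (\<lambda>(k, \<delta>). hd \<delta> = e) ds)"

lemma closed_rotate: "closed_walks w ds \<Longrightarrow> e \<in> out w \<Longrightarrow> closed_walks (r e) (rotate_walks e ds)"
proof (induction ds)
  case (Cons kd ds)
  obtain k \<delta> where kd: "kd = (k, \<delta>)" by fastforce
  show ?case
    using Cons by (cases \<delta>) (auto simp: kd rotate_walks_def walk_append out_def)
qed (simp add: rotate_walks_def)

lemma H_val_D:
  "closed_walks w ds \<Longrightarrow> e \<in> out w \<Longrightarrow>
    \<phi> (H e) * (\<phi> (val w ds) * \<phi> (D e)) = \<phi> (val (r e) (rotate_walks e ds))"
proof (induction ds)
  case (Cons kd ds)
  obtain k f \<delta> where kd: "kd = (k, f # \<delta>)"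
    using Cons.prems(1) by (cases kd; cases "snd kd") auto
  have f: "f \<in> A" "s f = w" "walk (r f) \<delta> w" and e: "e \<in> A" "s e = w"
    using Cons.prems by (auto simp: kd out_def)
  have "\<phi> (H e) * (\<phi> (pe w (f # \<delta>)) * \<phi> (D e)) =
      (if f = e then \<phi> (pe (r e) (\<delta> @ [e])) else 0)"
    using f e by (auto simp: \<phi>_rules path_rules pe_snoc mult.assoc)
  then show ?case
    using Cons by (simp add: kd rotate_walks_def distrib_left distrib_right mult.assoc \<phi>_sc_left)
qed (simp add: rotate_walks_def)

definition poly_at :: "nat \<Rightarrow> 'v \<Rightarrow> bool" where
  "poly_at n w \<longleftrightarrow> V w \<notin> P \<and> (\<exists>\<kappa> ds. \<kappa> \<noteq> 0 \<and> length ds \<le> n \<and> closed_walks w ds \<and>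
     sc \<kappa> * V w + val w ds \<in> P)"

text \<open>Between \<open>H e\<close> and \<open>D e\<close> the constant term \<kappa> at w
  becomes \<kappa> at \<open>r e\<close>, so it stays nonzero while the walks are rotated.\<close>

lemma poly_at_rotate:
  assumes "closed_walks w ds" "e \<in> out w" "V (r e) \<notin> P" "\<kappa> \<noteq> 0" "sc \<kappa> * V w + val w ds \<in> P"
  shows "poly_at (length (rotate_walks e ds)) (r e)"
proof -
  have "H e * ((sc \<kappa> * V w + val w ds) * D e) \<in> P"
    using assms(5) P by (auto intro: ring_idealD)
  moreover have "\<phi> (sc \<kappa> * V (r e) + val (r e) (rotate_walks e ds)) =
      \<phi> (H e * ((sc \<kappa> * V w + val w ds) * D e))"
    using H_val_D[OF assms(1,2)] assms(2)
    by (simp add: out_def distrib_left distrib_right mult.assoc \<phi>_sc_left \<phi>_rules)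
  ultimately have "sc \<kappa> * V (r e) + val (r e) (rotate_walks e ds) \<in> P"
    using \<phi>_mem[OF P N_P] by blast
  then show ?thesis
    using assms closed_rotate unfolding poly_at_def by blast
qed

lemma poly_at_mono: "poly_at m w \<Longrightarrow> m \<le> n \<Longrightarrow> poly_at n w"
  unfolding poly_at_def using le_trans by blast

lemma poly_at_step: "poly_at n w \<Longrightarrow> e \<in> out w \<Longrightarrow> V (r e) \<notin> P \<Longrightarrow> poly_at n (r e)"
proof -
  assume n: "poly_at n w" and e: "e \<in> out w" "V (r e) \<notin> P"
  then obtain \<kappa> ds where ds: "\<kappa> \<noteq> 0" "length ds \<le> n" "closed_walks w ds"
    "sc \<kappa> * V w + val w ds \<in> P"
    unfolding poly_at_def by blast
  have "length (rotate_walks e ds) \<le> n"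
    using ds(2) le_trans[OF length_filter_le] by (simp add: rotate_walks_def)
  then show ?thesis using poly_at_rotate ds e poly_at_mono by blast
qed

lemma poly_at_walk: "poly_at n u \<Longrightarrow> walk u \<alpha> w \<Longrightarrow> V w \<notin> P \<Longrightarrow> poly_at n w"
proof (induction \<alpha> arbitrary: u)
  case (Cons e \<alpha>)
  then have "V (r e) \<notin> P" using walk_P by auto
  then have "poly_at n (r e)" using Cons.prems poly_at_step by (auto simp: out_def)
  then show ?case using Cons by auto
qed simp

text \<open>
  In a polynomial at \<open>w\<close> with the least number of terms all closed walks begin with the same edge: otherwise rotating it
  along one of the edges loses a term, and following a closed walk back to \<open>w\<close> gives a polynomial
  at \<open>w\<close> with fewer terms.
\<close>

lemma poly_at_unique_edge:
  assumes "poly_at n w"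
  obtains e where "e \<in> out w" "V (r e) \<notin> P" "gap w {e} \<in> N"
proof -
  define n0 where "n0 = (LEAST n. poly_at n w)"
  have n0: "poly_at n0 w" and least: "\<And>m. poly_at m w \<Longrightarrow> n0 \<le> m"
    unfolding n0_def using assms by (auto intro: LeastI Least_le)
  obtain \<kappa> ds where ds: "\<kappa> \<noteq> 0" "length ds \<le> n0" "closed_walks w ds"
    "sc \<kappa> * V w + val w ds \<in> P" and w: "V w \<notin> P"
    using n0 unfolding poly_at_def by blast
  define F where "F = (\<lambda>(k, \<delta>). hd \<delta>) ` set ds"
  have walk_F: "\<exists>\<delta>. walk (r e) \<delta> w" and F_out: "e \<in> out w" if e: "e \<in> F" for e
  proof -
    obtain k \<delta> where "(k, \<delta>) \<in> set ds" "e = hd \<delta>" using e by (auto simp: F_def)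
    with ds(3) have "walk w \<delta> w" "\<delta> = e # tl \<delta>" by (auto simp: closed_walks_def)
    then have "walk w (e # tl \<delta>) w" by metis
    then show "\<exists>\<delta>. walk (r e) \<delta> w" "e \<in> out w" by (auto simp: out_def)
  qed
  have F: "finite F" "F \<subseteq> out w" using F_out by (auto simp: F_def)
  \<comment> \<open>F contains all first edges, so the gap kills the walks and leaves \<kappa> times
    itself: a gap in P, hence in N.\<close>
  have "gap w F * (sc \<kappa> * V w + val w ds) \<in> P"
    using ds(4) P by (auto intro: ring_idealD)
  moreover have "\<phi> (gap w F) * \<phi> (val w ds) = 0"
    by (rule gap_val[OF ds(3) F]) (force simp: F_def)
  then have "\<phi> (sc \<kappa> * gap w F) = \<phi> (gap w F * (sc \<kappa> * V w + val w ds))"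
    using F by (simp add: distrib_left \<phi>_sc_left gap_V)
  ultimately have "sc \<kappa> * gap w F \<in> P" using \<phi>_mem[OF P N_P] by blast
  then have gapP: "gap w F \<in> P" using sc_cancel[OF ds(1) P] by blast
  then have gapN: "gap w F \<in> N" using gap_N F by blast
  have "F \<noteq> {}" using gapP w by (auto simp: gap_def)
  then obtain e where e: "e \<in> F" by blast
  have re: "V (r e) \<notin> P" using walk_F[OF e] walk_P w by blast
  have "F = {e}"
  proof (rule ccontr)
    assume "F \<noteq> {e}"
    then obtain f where f: "f \<in> F" "f \<noteq> e" using e by blast
    then obtain k \<delta> where "(k, \<delta>) \<in> set ds" "hd \<delta> \<noteq> e" by (auto simp: F_def)
    then have "length (rotate_walks e ds) < length ds"
      by (auto simp: rotate_walks_def intro!: length_filter_less[of "(k, \<delta>)"])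
    moreover have "poly_at (length (rotate_walks e ds)) (r e)"
      using poly_at_rotate ds re F_out e by blast
    then have "poly_at (length (rotate_walks e ds)) w"
      using poly_at_walk walk_F e w by blast
    ultimately show False using least ds(2) by fastforce
  qed
  then show ?thesis using that[of e] gapN e re F_out by blast
qed

section \<open>The cycle through a vertex and its exits\<close>

definition cyc :: "'v \<Rightarrow> bool" where "cyc w \<longleftrightarrow> (\<exists>n. poly_at n w)"

lemma cyc_not_P: "cyc w \<Longrightarrow> V w \<notin> P"
  by (auto simp: cyc_def poly_at_def)

definition next_edge :: "'v \<Rightarrow> 'e" where
  "next_edge w = (SOME e. e \<in> out w \<and> V (r e) \<notin> P \<and> gap w {e} \<in> N)"

lemma next_edge:
  assumes "cyc w"
  shows "next_edge w \<in> out w" "gap w {next_edge w} \<in> N" "cyc (r (next_edge w))"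
proof -
  have "\<exists>e. e \<in> out w \<and> V (r e) \<notin> P \<and> gap w {e} \<in> N"
    using assms poly_at_unique_edge unfolding cyc_def by metis
  then have *: "next_edge w \<in> out w \<and> V (r (next_edge w)) \<notin> P \<and> gap w {next_edge w} \<in> N"
    unfolding next_edge_def by (rule someI_ex)
  then show "next_edge w \<in> out w" "gap w {next_edge w} \<in> N" by auto
  show "cyc (r (next_edge w))" using assms * poly_at_step unfolding cyc_def by blast
qed

text \<open>Modulo N the vertex is \<open>D g * H g\<close> for the chosen edge g, and by (CK1) this
  annihilates all other edges leaving it. Exits may exist in the graph; they only vanish modulo
  N.\<close>

lemma other_edge:
  assumes "cyc w" "e \<in> out w" "e \<noteq> next_edge w"
  shows "D e \<in> N" "H e \<in> N"
proof -
  have "\<phi> (gap w {next_edge w}) = 0" using next_edge(2)[OF assms(1)] \<phi>_eq_0_iff by blast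
  then show "D e \<in> N" "H e \<in> N"
    using gap_D[of "{next_edge w}" w e] H_gap[of "{next_edge w}" w e] next_edge(1)[OF assms(1)] assms
    by (auto simp flip: \<phi>_eq_0_iff)
qed

definition next_vertex :: "'v \<Rightarrow> 'v" where "next_vertex w = r (next_edge w)"

primrec orbit :: "'v \<Rightarrow> nat \<Rightarrow> 'e list" where
  "orbit u 0 = []"
| "orbit u (Suc m) = next_edge u # orbit (next_vertex u) m"

lemma walk_orbit: "cyc u \<Longrightarrow> walk u (orbit u m) ((next_vertex ^^ m) u)"
proof (induction m arbitrary: u)
  case (Suc m)
  then have "walk (next_vertex u) (orbit (next_vertex u) m) ((next_vertex ^^ m) (next_vertex u))"
    using next_edge(3) by (metis next_vertex_def)
  then show ?case
    using Suc.prems next_edge(1) by (auto simp: out_def next_vertex_def[of u] funpow_swap1)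
qed simp

lemma orbit_add: "orbit u (m + n) = orbit u m @ orbit ((next_vertex ^^ m) u) n"
  by (induction m arbitrary: u) (auto simp: funpow_swap1)

text \<open>A walk that leaves the cycle contains an exit, which lies in N together with its
  ghost.\<close>

lemma walk_cases:
  "cyc u \<Longrightarrow> walk u \<alpha> z \<Longrightarrow> (pe u \<alpha> \<in> N \<and> ge u \<alpha> \<in> N) \<or> \<alpha> = orbit u (length \<alpha>)"
proof (induction \<alpha> arbitrary: u)
  case (Cons e \<alpha>)
  show ?case
  proof (cases "e = next_edge u")
    case True
    have "cyc (r e)" using Cons.prems True next_edge(3) by simp
    then have "(pe (r e) \<alpha> \<in> N \<and> ge (r e) \<alpha> \<in> N) \<or> \<alpha> = orbit (r e) (length \<alpha>)"
      using Cons by simp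
    then show ?thesis using True N by (auto simp: next_vertex_def intro: ring_idealD)
  next
    case False
    then have "D e \<in> N" "H e \<in> N" using Cons.prems other_edge[of u e] by (auto simp: out_def)
    then show ?thesis using N by (auto intro: ring_idealD)
  qed
qed simp

text \<open>At each vertex of the orbit, \<open>D e * H e\<close> for the chosen edge is the vertex
  modulo N, so the product telescopes from the inside.\<close>

lemma pe_ge_orbit: "cyc u \<Longrightarrow> \<phi> (pe u (orbit u m)) * \<phi> (ge u (orbit u m)) = \<phi> (V u)"
proof (induction m arbitrary: u)
  case (Suc m)
  let ?e = "next_edge u"
  have e: "?e \<in> A" "s ?e = u" using next_edge(1)[OF Suc.prems] by (auto simp: out_def)
  have "\<phi> (pe (r ?e) (orbit (r ?e) m)) * (\<phi> (ge (r ?e) (orbit (r ?e) m)) * y) = \<phi> (V (r ?e)) * y" for y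
    using Suc.IH[OF next_edge(3)[OF Suc.prems]] by (rule \<phi>_assoc)
  then have "\<phi> (pe u (orbit u (Suc m))) * \<phi> (ge u (orbit u (Suc m))) = \<phi> (D ?e) * \<phi> (H ?e)"
    using e by (simp add: next_vertex_def mult.assoc \<phi>_rules)
  moreover have "\<phi> (gap u {?e}) = 0" using next_edge(2)[OF Suc.prems] \<phi>_eq_0_iff by blast
  ultimately show ?case by (simp add: \<phi>_gap)
qed (simp add: \<phi>_VV)

text \<open>The polynomial at w has some closed walk \<delta>, as otherwise w would be in P. Since
  \<delta>^* \<delta> is w modulo N, \<delta> is not in N and therefore follows the orbit.\<close>

lemma orbit_returns:
  assumes "cyc w"
  obtains m where "m > 0" "(next_vertex ^^ m) w = w"
proof -
  obtain \<kappa> ds where ds: "\<kappa> \<noteq> 0" "closed_walks w ds" "sc \<kappa> * V w + val w ds \<in> P"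
    and w: "V w \<notin> P"
    using assms unfolding cyc_def poly_at_def by blast
  have "ds \<noteq> []" using ds w sc_cancel[OF ds(1) P] by auto
  then obtain k \<delta> where "(k, \<delta>) \<in> set ds" by (cases ds) auto
  then have \<delta>: "walk w \<delta> w" "\<delta> \<noteq> []" using ds(2) by (auto simp: closed_walks_def)
  have "pe w \<delta> \<notin> N"
  proof
    assume "pe w \<delta> \<in> N"
    then have "\<phi> (V w) = 0" using ge_pe[OF \<delta>(1)] \<phi>_eq_0_iff[of "pe w \<delta>"] by simp
    then show False using w N_P \<phi>_eq_0_iff by blast
  qed
  then have "\<delta> = orbit w (length \<delta>)" using walk_cases assms \<delta> by blast
  then have "walk w \<delta> ((next_vertex ^^ length \<delta>) w)" using walk_orbit[OF assms] by metis
  then show ?thesis using that[of "length \<delta>"] walk_unique \<delta> by auto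
qed


section \<open>Ideals contained in the prime ideal are generated at the cycles\<close>

text \<open>Combinations of monomials \<alpha> \<beta>^* from u to w modulo N. The bound n on the
  ghost part drops under right multiplication by an edge and carries a later induction.\<close>

inductive_set span :: "'v \<Rightarrow> 'v \<Rightarrow> nat \<Rightarrow> 'a set" for u w n where
  span_N: "x \<in> N \<Longrightarrow> x \<in> span u w n"
| span_add: "x \<in> span u w n \<Longrightarrow> y \<in> span u w n \<Longrightarrow> x + y \<in> span u w n"
| span_term: "walk u \<alpha> z \<Longrightarrow> walk w \<beta> z \<Longrightarrow> length \<beta> \<le> n \<Longrightarrow> sc k * (pe u \<alpha> * ge w \<beta>) \<in> span u w n"

lemma span_cong: "y \<in> span u w n \<Longrightarrow> \<phi> x = \<phi> y \<Longrightarrow> x \<in> span u w n"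
  using span_add[OF _ span_N, of y u w n "x - y"] by (simp add: \<phi>_eq_iff)

lemma span_mono: "x \<in> span u w m \<Longrightarrow> m \<le> n \<Longrightarrow> x \<in> span u w n"
proof (induction rule: span.induct)
  case (span_term \<alpha> z \<beta> k)
  then show ?case by (meson le_trans span.span_term)
qed (auto intro: span.intros)

lemma span_sc: "x \<in> span u w n \<Longrightarrow> sc k * x \<in> span u w n"
proof (induction rule: span.induct)
  case (span_N x)
  then show ?case using N by (auto intro: span.intros ring_idealD)
next
  case (span_add x y)
  then show ?case by (auto simp: distrib_left intro: span.intros)
next
  case (span_term \<alpha> z \<beta> l)
  have "sc (k * l) * (pe u \<alpha> * ge w \<beta>) \<in> span u w n" using span_term by (rule span.span_term)
  then show ?case by (simp add: sc_mult mult.assoc)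
qed

lemma span_D: "x \<in> span (r e) w n \<Longrightarrow> e \<in> A \<Longrightarrow> D e * x \<in> span (s e) w n"
proof (induction rule: span.induct)
  case (span_N x)
  then show ?case using N by (auto intro: span.intros ring_idealD)
next
  case (span_add x y)
  then show ?case by (auto simp: distrib_left intro: span.intros)
next
  case (span_term \<alpha> z \<beta> k)
  then have "sc k * (pe (s e) (e # \<alpha>) * ge w \<beta>) \<in> span (s e) w n"
    by (intro span.span_term) auto
  then show ?case by (rule span_cong) (simp add: \<phi>_sc_left mult.assoc)
qed

lemma span_H: "x \<in> span (s e) w n \<Longrightarrow> e \<in> A \<Longrightarrow> H e * x \<in> span (r e) w (Suc n)"
proof (induction rule: span.induct)
  case (span_N x)
  then show ?case using N by (auto intro: span.intros ring_idealD)
next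
  case (span_add x y)
  then show ?case by (auto simp: distrib_left intro: span.intros)
next
  case (span_term \<alpha> z \<beta> k)
  show ?case
  proof (cases \<alpha>)
    case Nil
    then have \<beta>: "walk w \<beta> (s e)" using span_term by simp
    then have "sc k * (pe (r e) [] * ge w (\<beta> @ [e])) \<in> span (r e) w (Suc n)"
      using span_term by (intro span.span_term[of _ _ "r e"]) (auto simp: walk_snoc)
    then show ?thesis
      by (rule span_cong)
        (use \<beta> span_term in \<open>simp add: Nil \<phi>_sc_left path_rules ge_snoc \<phi>_rules\<close>)
  next
    case (Cons f \<delta>)
    show ?thesis
    proof (cases "f = e")
      case True
      then have "sc k * (pe (r e) \<delta> * ge w \<beta>) \<in> span (r e) w (Suc n)"
        using span_term Cons by (intro span.span_term) auto
      then show ?thesis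
        by (rule span_cong)
          (use True span_term Cons in \<open>auto simp: \<phi>_sc_left \<phi>_rules path_rules mult.assoc\<close>)
    next
      case False
      then have "\<phi> (H e * (sc k * (pe (s e) \<alpha> * ge w \<beta>))) = 0"
        using span_term Cons by (auto simp: \<phi>_sc_left \<phi>_rules mult.assoc)
      then show ?thesis using \<phi>_eq_0_iff span_N by blast
    qed
  qed
qed

text \<open>Induction over words by \<open>M_subset\<close>, for all u and w at once because a new
  first letter changes the vertex at which the rest of the word begins.\<close>

lemma M_span: "a \<in> M \<Longrightarrow> \<exists>n. V u * a * V w \<in> span u w n"
proof -
  let ?S = "{a. \<forall>u w. \<exists>n. V u * a * V w \<in> span u w n}"
  have zero: "\<phi> x = 0 \<Longrightarrow> \<exists>n. x \<in> span u w n" for x u w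
    using \<phi>_eq_0_iff span_N by blast
  have "M \<subseteq> ?S"
  proof (rule M_subset; (intro CollectI allI)?)
    fix x u w assume "x \<in> N"
    then have "V u * x * V w \<in> N" using N by (auto intro: ring_idealD)
    then show "\<exists>n. V u * x * V w \<in> span u w n" using span_N by blast
  next
    fix x y u w assume "x \<in> ?S" "y \<in> ?S"
    then obtain m n where "V u * x * V w \<in> span u w m" "V u * y * V w \<in> span u w n" by blast
    then have "V u * x * V w \<in> span u w (max m n)" "V u * y * V w \<in> span u w (max m n)"
      using span_mono by (meson max.cobounded1 max.cobounded2)+
    from span_add[OF this] show "\<exists>n. V u * (x + y) * V w \<in> span u w n"
      by (auto simp: algebra_simps)
  next
    fix v u w
    show "\<exists>n. V u * V v * V w \<in> span u w n"
    proof (cases "u = v \<and> v = w")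
      case True
      have "sc 1 * (pe u [] * ge u []) \<in> span u u 0" by (rule span_term[of _ _ u]) auto
      then have "V u * V v * V w \<in> span u w 0"
        using True by (auto simp: \<phi>_VV elim!: span_cong)
      then show ?thesis by blast
    qed (rule zero, auto simp: \<phi>_VV)
  next
    fix e u w assume e: "e \<in> A"
    show "\<exists>n. V u * D e * V w \<in> span u w n"
    proof (cases "u = s e \<and> w = r e")
      case True
      have "sc 1 * (pe (s e) [e] * ge (r e) []) \<in> span (s e) (r e) 0"
        using e by (intro span_term[of _ _ "r e"]) auto
      then have "V u * D e * V w \<in> span u w 0"
        using True e by (auto simp: \<phi>_rules mult.assoc elim!: span_cong)
      then show ?thesis by blast
    qed (rule zero, use e in \<open>auto simp: \<phi>_rules\<close>)
  next
    fix e u w assume e: "e \<in> A"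
    show "\<exists>n. V u * H e * V w \<in> span u w n"
    proof (cases "u = r e \<and> w = s e")
      case True
      have "sc 1 * (pe (r e) [] * ge (s e) [e]) \<in> span (r e) (s e) 1"
        using e by (intro span_term[of _ _ "r e"]) auto
      then have "V u * H e * V w \<in> span u w 1"
        using True e by (auto simp: \<phi>_rules mult.assoc elim!: span_cong)
      then show ?thesis by blast
    qed (rule zero, use e in \<open>auto simp: \<phi>_rules\<close>)
  next
    fix k x u w assume "x \<in> ?S"
    then obtain n where "V u * x * V w \<in> span u w n" by blast
    then have "sc k * (V u * x * V w) \<in> span u w n" by (rule span_sc)
    then have "V u * (sc k * x) * V w \<in> span u w n"
      by (rule span_cong) (simp add: \<phi>_sc_left mult.assoc)
    then show "\<exists>n. V u * (sc k * x) * V w \<in> span u w n" by blast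
  next
    fix v x u w assume "x \<in> ?S"
    then obtain n where n: "V u * x * V w \<in> span u w n" by blast
    show "\<exists>n. V u * (V v * x) * V w \<in> span u w n"
    proof (cases "u = v")
      case True
      have "V u * (V v * x) * V w \<in> span u w n"
        by (rule span_cong[OF n]) (simp add: True \<phi>_rules mult.assoc)
      then show ?thesis by blast
    qed (rule zero, simp add: \<phi>_rules)
  next
    fix e x u w assume e: "e \<in> A" and "x \<in> ?S"
    then obtain n where n: "V (r e) * x * V w \<in> span (r e) w n" by blast
    show "\<exists>n. V u * (D e * x) * V w \<in> span u w n"
    proof (cases "u = s e")
      case True
      have "V u * (D e * x) * V w \<in> span u w n"
        unfolding True by (rule span_cong[OF span_D[OF n e]]) (use e in \<open>simp add: \<phi>_rules mult.assoc\<close>)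
      then show ?thesis by blast
    qed (rule zero, use e in \<open>simp add: \<phi>_rules\<close>)
  next
    fix e x u w assume e: "e \<in> A" and "x \<in> ?S"
    then obtain n where n: "V (s e) * x * V w \<in> span (s e) w n" by blast
    show "\<exists>n. V u * (H e * x) * V w \<in> span u w n"
    proof (cases "u = r e")
      case True
      have "V u * (H e * x) * V w \<in> span u w (Suc n)"
        unfolding True by (rule span_cong[OF span_H[OF n e]]) (use e in \<open>simp add: \<phi>_rules mult.assoc\<close>)
      then show ?thesis by blast
    qed (rule zero, use e in \<open>simp add: \<phi>_rules\<close>)
  qed
  then show "a \<in> M \<Longrightarrow> \<exists>n. V u * a * V w \<in> span u w n" by blast
qed

lemma val_filter: "val u bs = val u (filter Q bs) + val u (filter (\<lambda>b. \<not> Q b) bs)"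
  by (induction bs) (auto simp: algebra_simps)

text \<open>If no walk is shorter than \<gamma>, then \<gamma>^* sends copies of \<gamma> to w,
  proper extensions of \<gamma> to nonempty closed walks at w, and all else to zero. So \<kappa> is
  the total coefficient of \<gamma>; it can vanish, as entries may repeat.\<close>

lemma ge_val:
  assumes \<gamma>: "walk u \<gamma> w"
  shows "walks u w bs \<Longrightarrow> \<forall>b\<in>set bs. length \<gamma> \<le> length (snd b) \<Longrightarrow>
    \<exists>\<kappa> ds. closed_walks w ds \<and>
      \<phi> (ge u \<gamma>) * \<phi> (val u bs) = \<phi> (sc \<kappa>) * \<phi> (V w) + \<phi> (val w ds) \<and>
      \<phi> (val u bs) = \<phi> (sc \<kappa>) * \<phi> (pe u \<gamma>) + \<phi> (val u (filter (\<lambda>b. snd b \<noteq> \<gamma>) bs))"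
proof (induction bs)
  case Nil
  show ?case by (rule exI[of _ 0], rule exI[of _ "[]"]) simp
next
  case (Cons b bs)
  obtain k \<delta> where b: "b = (k, \<delta>)" by fastforce
  have len: "length \<gamma> \<le> length \<delta>" and \<delta>: "walk u \<delta> w" using Cons.prems by (auto simp: b)
  obtain \<kappa> ds where IH: "closed_walks w ds"
      "\<phi> (ge u \<gamma>) * \<phi> (val u bs) = \<phi> (sc \<kappa>) * \<phi> (V w) + \<phi> (val w ds)"
      "\<phi> (val u bs) = \<phi> (sc \<kappa>) * \<phi> (pe u \<gamma>) + \<phi> (val u (filter (\<lambda>b. snd b \<noteq> \<gamma>) bs))"
    using Cons.IH Cons.prems by (auto simp: b)
  have step: "\<phi> (ge u \<gamma>) * \<phi> (val u (b # bs)) =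
      \<phi> (sc k) * (\<phi> (ge u \<gamma>) * \<phi> (pe u \<delta>)) + (\<phi> (sc \<kappa>) * \<phi> (V w) + \<phi> (val w ds))"
    by (simp add: b distrib_left \<phi>_sc_left IH(2))
  consider "\<delta> = \<gamma>" | \<eta> where "\<delta> = \<gamma> @ \<eta>" "\<eta> \<noteq> []" | "take (length \<gamma>) \<delta> \<noteq> \<gamma>"
    by (metis append_Nil2 append_take_drop_id)
  then show ?case
  proof cases
    case 1
    show ?thesis
      using IH step ge_pe[OF \<gamma>] 1
      by (intro exI[of _ "k + \<kappa>"] exI[of _ ds]) (simp add: b sc_add distrib_right add.assoc)
  next
    case 2
    then have \<eta>: "walk w \<eta> w" using \<gamma> \<delta> walk_unique by (auto simp: walk_append)
    show ?thesis
      using IH step ge_pe_prefix[OF \<gamma> \<eta>] 2 \<eta>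
      by (intro exI[of _ "\<kappa>"] exI[of _ "(k, \<eta>) # ds"]) (simp add: b algebra_simps)
  next
    case 3
    then show ?thesis
      using IH step ge_pe_zero[OF \<gamma> \<delta> len]
      by (intro exI[of _ "\<kappa>"] exI[of _ ds]) (auto simp: b algebra_simps)
  qed
qed

text \<open>Left multiplication by \<gamma> \<gamma>^* is the projection onto the walks that begin
  with \<gamma>.\<close>

lemma pe_ge_val:
  assumes \<gamma>: "walk u \<gamma> w"
  shows "walks u w bs \<Longrightarrow> \<forall>b\<in>set bs. length \<gamma> \<le> length (snd b) \<Longrightarrow>
    \<phi> (pe u \<gamma>) * (\<phi> (ge u \<gamma>) * \<phi> (val u bs)) =
      \<phi> (val u (filter (\<lambda>b. take (length \<gamma>) (snd b) = \<gamma>) bs))"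
proof (induction bs)
  case (Cons b bs)
  obtain k \<delta> where b: "b = (k, \<delta>)" by fastforce
  have len: "length \<gamma> \<le> length \<delta>" and \<delta>: "walk u \<delta> w" using Cons.prems by (auto simp: b)
  have "\<phi> (pe u \<gamma>) * (\<phi> (ge u \<gamma>) * \<phi> (pe u \<delta>)) =
      (if take (length \<gamma>) \<delta> = \<gamma> then \<phi> (pe u \<delta>) else 0)"
  proof (cases "take (length \<gamma>) \<delta> = \<gamma>")
    case True
    then obtain \<eta> where \<eta>: "\<delta> = \<gamma> @ \<eta>" by (metis append_take_drop_id)
    then have "walk w \<eta> w" using \<gamma> \<delta> walk_unique by (auto simp: walk_append)
    then show ?thesis using ge_pe_prefix[OF \<gamma>] pe_append[OF \<gamma>] \<eta> by simp
  next
    case False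
    then show ?thesis using ge_pe_zero[OF \<gamma> \<delta> len] by simp
  qed
  then show ?case using Cons by (auto simp: b distrib_left \<phi>_sc_left)
qed simp

lemma shortest_walk:
  assumes "walks u w bs" "bs \<noteq> []"
  obtains k \<gamma> where "(k, \<gamma>) \<in> set bs" "walk u \<gamma> w" "\<forall>b\<in>set bs. length \<gamma> \<le> length (snd b)"
proof -
  obtain b where b: "b \<in> set bs" using assms(2) by (cases bs) auto
  obtain b where "b \<in> set bs" "\<And>b'. b' \<in> set bs \<Longrightarrow> length (snd b) \<le> length (snd b')"
    using ex_has_least_nat[of "\<lambda>b. b \<in> set bs", OF b, of "\<lambda>b. length (snd b)"] by blast
  then show ?thesis using that[of "fst b" "snd b"] assms(1) by (fastforce simp: walks_def)
qed

lemma val_N: "walks u w bs \<Longrightarrow> V w \<in> P \<Longrightarrow> val u bs \<in> N"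
  using val_V[of u w bs] V_N[of w] \<phi>_eq_0_iff[of "V w"] \<phi>_eq_0_iff[of "val u bs"] by simp

text \<open>The edge cancels the first edge of \<beta>, or gives zero, or lengthens \<alpha> when
  \<beta> is empty. For n = 0 only the last case occurs, which agrees with the truncated
  difference.\<close>

lemma span_D_right: "a \<in> span u w n \<Longrightarrow> e \<in> out w \<Longrightarrow> a * D e \<in> span u (r e) (n - 1)"
proof (induction rule: span.induct)
  case (span_N x)
  then show ?case using N by (auto intro: span.intros ring_idealD)
next
  case (span_add x y)
  then show ?case by (auto simp: distrib_right intro: span.intros)
next
  case (span_term \<alpha> z \<beta> k)
  have e: "e \<in> A" "s e = w" using span_term by (auto simp: out_def)
  show ?case
  proof (cases \<beta>)
    case Nil
    then have "walk u \<alpha> (s e)" using span_term e by simp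
    then have "sc k * (pe u (\<alpha> @ [e]) * ge (r e) []) \<in> span u (r e) (n - 1)"
      using span_term e by (intro span.span_term[of _ _ "r e"]) (auto simp: walk_append)
    then show ?thesis
      by (rule span_cong)
        (use \<open>walk u \<alpha> (s e)\<close> e Nil in \<open>simp add: pe_snoc mult.assoc \<phi>_rules\<close>)
  next
    case (Cons f \<delta>)
    show ?thesis
    proof (cases "f = e")
      case True
      then have "sc k * (pe u \<alpha> * ge (r e) \<delta>) \<in> span u (r e) (n - 1)"
        using span_term Cons by (intro span.span_term) auto
      then show ?thesis
        by (rule span_cong)
          (use True span_term Cons in \<open>auto simp: \<phi>_rules path_rules mult.assoc\<close>)
    next
      case False
      then have "\<phi> (sc k * (pe u \<alpha> * ge w \<beta>) * D e) = 0"
        using span_term e Cons by (auto simp: \<phi>_rules mult.assoc)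
      then show ?thesis using \<phi>_eq_0_iff span.span_N by blast
    qed
  qed
qed

text \<open>Take for F the first edges of the nonempty ghost parts: the gap annihilates those
  monomials, and a ghost-free combination is left. For n = 0 there are no such edges.\<close>

lemma span_gap:
  "a \<in> span u w n \<Longrightarrow> \<exists>bs F. walks u w bs \<and> finite F \<and> F \<subseteq> out w \<and> (n = 0 \<longrightarrow> F = {}) \<and>
    \<phi> a * \<phi> (gap w F) = \<phi> (val u bs) * \<phi> (gap w F)"
proof (induction rule: span.induct)
  case (span_N x)
  then have "\<phi> x = 0" by (simp add: \<phi>_eq_0_iff)
  then show ?case by (intro exI[of _ "[]"] exI[of _ "{}"]) simp
next
  case (span_add x y)
  then obtain bs F cs F' where *: "walks u w bs" "finite F" "F \<subseteq> out w" "n = 0 \<longrightarrow> F = {}"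
    "\<phi> x * \<phi> (gap w F) = \<phi> (val u bs) * \<phi> (gap w F)"
    "walks u w cs" "finite F'" "F' \<subseteq> out w" "n = 0 \<longrightarrow> F' = {}"
    "\<phi> y * \<phi> (gap w F') = \<phi> (val u cs) * \<phi> (gap w F')"
    by blast
  \<comment> \<open>An identity modulo a smaller set persists for the union, since the smaller gap
    times the larger one is the larger one.\<close>
  have more: "\<phi> z * \<phi> (gap w (F \<union> F')) = \<phi> t * \<phi> (gap w (F \<union> F'))"
    if "\<phi> z * \<phi> (gap w F1) = \<phi> t * \<phi> (gap w F1)" "F1 \<subseteq> F \<union> F'" for z t F1
  proof -
    have eq: "\<phi> (gap w F1) * \<phi> (gap w (F \<union> F')) = \<phi> (gap w (F \<union> F'))"
    proof -
      have "(\<Sum>e\<in>F1. \<phi> (D e) * (\<phi> (H e) * \<phi> (gap w (F \<union> F')))) = 0"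
        using * that(2) by (intro sum.neutral ballI) (subst H_gap, auto)
      then show ?thesis
        using * by (simp add: \<phi>_gap[of w F1] left_diff_distrib sum_distrib_right mult.assoc V_gap)
    qed
    have "\<phi> z * \<phi> (gap w F1) * \<phi> (gap w (F \<union> F')) = \<phi> t * \<phi> (gap w F1) * \<phi> (gap w (F \<union> F'))"
      using that(1) by simp
    then show ?thesis using eq by (simp add: mult.assoc)
  qed
  have "\<phi> (x + y) * \<phi> (gap w (F \<union> F')) = \<phi> (val u (bs @ cs)) * \<phi> (gap w (F \<union> F'))"
    using more[OF *(5)] more[OF *(10)] by (simp add: distrib_right)
  then show ?case using * by (intro exI[of _ "bs @ cs"] exI[of _ "F \<union> F'"]) auto
next
  case (span_term \<alpha> z \<beta> k)
  show ?case
  proof (cases \<beta>)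
    case Nil
    then have "walk u \<alpha> w" using span_term by simp
    then show ?thesis
      using Nil by (intro exI[of _ "[(k, \<alpha>)]"] exI[of _ "{}"]) (simp add: path_rules mult.assoc)
  next
    case (Cons e \<delta>)
    then have e: "e \<in> out w" using span_term by (auto simp: out_def)
    have "\<phi> (sc k * (pe u \<alpha> * ge w \<beta>)) * \<phi> (gap w {e}) = 0"
      using H_gap[of "{e}" w e] e Cons by (simp add: mult.assoc)
    then show ?thesis
      using e span_term Cons by (intro exI[of _ "[]"] exI[of _ "{e}"]) auto
  qed
qed

section \<open>Comparing ideals below P through their corners at cycles\<close>

context
  fixes I J :: "'a set"
  assumes I: "ring_ideal I" "N \<subseteq> I" "I \<subseteq> P" and J: "ring_ideal J" "N \<subseteq> J"
    and corners: "\<And>v x. cyc v \<Longrightarrow> x \<in> I \<Longrightarrow> V v * x * V v \<in> J"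
begin

lemma val_in_J: "walks u w bs \<Longrightarrow> val u bs \<in> I \<Longrightarrow> val u bs \<in> J"
proof (induction "length bs" arbitrary: bs rule: less_induct)
  case less
  show ?case
  proof (cases "V w \<in> P \<or> bs = []")
    case True
    then show ?thesis using val_N less.prems J ring_idealD(1) by fastforce
  next
    case False
    then obtain k0 \<gamma> where \<gamma>: "(k0, \<gamma>) \<in> set bs" "walk u \<gamma> w"
      and len: "\<forall>b\<in>set bs. length \<gamma> \<le> length (snd b)"
      using shortest_walk less.prems by metis
    obtain \<kappa> ds where ds: "closed_walks w ds"
      "\<phi> (ge u \<gamma>) * \<phi> (val u bs) = \<phi> (sc \<kappa>) * \<phi> (V w) + \<phi> (val w ds)"
      "\<phi> (val u bs) = \<phi> (sc \<kappa>) * \<phi> (pe u \<gamma>) + \<phi> (val u (filter (\<lambda>b. snd b \<noteq> \<gamma>) bs))"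
      using ge_val[OF \<gamma>(2) less.prems(1) len] by blast
    show ?thesis
    proof (cases "\<kappa> = 0")
      case True
      let ?bs = "filter (\<lambda>b. snd b \<noteq> \<gamma>) bs"
      have eq: "\<phi> (val u bs) = \<phi> (val u ?bs)" using ds(3) True by simp
      have "length ?bs < length bs" using \<gamma>(1) by (auto intro!: length_filter_less)
      moreover have "val u ?bs \<in> I" using \<phi>_mem[OF I(1,2)] eq less.prems(2) by metis
      ultimately have "val u ?bs \<in> J" using less by simp
      then show ?thesis using \<phi>_mem[OF J eq] by blast
    next
      case nz: False
      let ?d = "ge u \<gamma> * val u bs"
      let ?bs = "filter (\<lambda>b. \<not> take (length \<gamma>) (snd b) = \<gamma>) bs"
      have d: "?d \<in> I" using I less.prems(2) ring_idealD(3) by blast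
      have \<phi>d: "\<phi> ?d = \<phi> (sc \<kappa> * V w + val w ds)" using ds(2) by simp
      have "sc \<kappa> * V w + val w ds \<in> P"
        using \<phi>_mem[OF P N_P \<phi>d[symmetric]] d I(3) by blast
      then have "cyc w" using False nz ds(1) unfolding cyc_def poly_at_def by blast
      then have "V w * ?d * V w \<in> J" using corners d by blast
      moreover have "\<phi> ?d = \<phi> (V w * ?d * V w)"
        using \<gamma>(2) less.prems(1) by (simp add: path_rules val_V mult.assoc)
      ultimately have "?d \<in> J" using \<phi>_mem[OF J] by blast
      then have dJ: "pe u \<gamma> * ?d \<in> J" using J ring_idealD(3) by blast
      have bs: "\<phi> (val u bs) = \<phi> (pe u \<gamma> * ?d + val u ?bs)"
        using pe_ge_val[OF \<gamma>(2) less.prems(1) len]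
        by (subst val_filter[of u bs "\<lambda>b. take (length \<gamma>) (snd b) = \<gamma>"]) simp
      have eq: "\<phi> (val u ?bs) = \<phi> (val u bs - pe u \<gamma> * ?d)"
        unfolding proj_hom(3) bs by simp
      have "val u bs - pe u \<gamma> * ?d \<in> I"
        using I less.prems(2) d by (auto intro: ring_idealD)
      then have "val u ?bs \<in> I" using \<phi>_mem[OF I(1,2) eq] by blast
      moreover have "length ?bs < length bs" using \<gamma>(1) by (auto intro!: length_filter_less)
      ultimately have "val u ?bs \<in> J" using less by simp
      then have "pe u \<gamma> * ?d + val u ?bs \<in> J" using dJ J ring_idealD(2) by blast
      then show ?thesis using \<phi>_mem[OF J bs] by blast
    qed
  qed
qed

text \<open>Again a shortest walk \<gamma> either cancels or yields a polynomial with constant term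
  \<kappa> \<noteq> 0. In the latter case add the first edges of its walks to F: the larger gap on
  both sides leaves \<kappa> times itself in P, so it lies in N and \<open>gap w F\<close> is the
  sum of \<open>D e * H e\<close> over the added edges. Each \<open>val u bs * D e\<close> is then a
  combination of paths in I, covered by \<open>val_in_J\<close>.\<close>

lemma val_gap_in_J:
  assumes F: "finite F" "F \<subseteq> out w"
  shows "walks u w bs \<Longrightarrow> val u bs * gap w F \<in> I \<Longrightarrow> val u bs * gap w F \<in> J"
proof (induction "length bs" arbitrary: bs rule: less_induct)
  case less
  show ?case
  proof (cases "V w \<in> P \<or> bs = []")
    case True
    then have "val u bs \<in> J" using val_N less.prems J ring_idealD(1) by fastforce
    then show ?thesis using J ring_idealD(4) by blast
  next
    case False
    then obtain k0 \<gamma> where \<gamma>: "(k0, \<gamma>) \<in> set bs" "walk u \<gamma> w"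
      and len: "\<forall>b\<in>set bs. length \<gamma> \<le> length (snd b)"
      using shortest_walk less.prems by metis
    obtain \<kappa> ds where ds: "closed_walks w ds"
      "\<phi> (ge u \<gamma>) * \<phi> (val u bs) = \<phi> (sc \<kappa>) * \<phi> (V w) + \<phi> (val w ds)"
      "\<phi> (val u bs) = \<phi> (sc \<kappa>) * \<phi> (pe u \<gamma>) + \<phi> (val u (filter (\<lambda>b. snd b \<noteq> \<gamma>) bs))"
      using ge_val[OF \<gamma>(2) less.prems(1) len] by blast
    show ?thesis
    proof (cases "\<kappa> = 0")
      case True
      let ?bs = "filter (\<lambda>b. snd b \<noteq> \<gamma>) bs"
      have eq: "\<phi> (val u bs * gap w F) = \<phi> (val u ?bs * gap w F)" using ds(3) True by simp
      have "length ?bs < length bs" using \<gamma>(1) by (auto intro!: length_filter_less)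
      moreover have "val u ?bs * gap w F \<in> I" using \<phi>_mem[OF I(1,2)] eq less.prems(2) by metis
      ultimately have "val u ?bs * gap w F \<in> J" using less by simp
      then show ?thesis using \<phi>_mem[OF J eq] by blast
    next
      case nz: False
      let ?F = "F \<union> (\<lambda>b. hd (snd b)) ` set ds"
      have "hd (snd b) \<in> out w" if "b \<in> set ds" for b
      proof -
        have "walk w (snd b) w" "snd b \<noteq> []" using ds(1) that by (auto simp: closed_walks_def)
        then show ?thesis by (cases "snd b") (auto simp: out_def)
      qed
      then have F': "finite ?F" "F \<subseteq> ?F" "?F \<subseteq> out w" using F by auto
      have "gap w ?F * (ge u \<gamma> * (val u bs * gap w F) * gap w ?F) \<in> P"
        using I(3) less.prems(2) ring_idealD(3,4)[OF P] by blast
      moreover have "\<phi> (gap w ?F) * \<phi> (val w ds) = 0"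
        by (rule gap_val[OF ds(1) F'(1,3)]) force
      then have "\<phi> (gap w ?F) * (\<phi> (ge u \<gamma>) * \<phi> (val u bs)) = \<phi> (sc \<kappa>) * \<phi> (gap w ?F)"
        using ds(2) F' by (simp add: distrib_left \<phi>_sc_left gap_V)
      then have "\<phi> (gap w ?F * (ge u \<gamma> * (val u bs * gap w F) * gap w ?F)) =
          \<phi> (sc \<kappa>) * (\<phi> (gap w ?F) * (\<phi> (gap w F) * \<phi> (gap w ?F)))"
        by (simp flip: mult.assoc)
      then have "\<phi> (sc \<kappa> * gap w ?F) =
          \<phi> (gap w ?F * (ge u \<gamma> * (val u bs * gap w F) * gap w ?F))"
        by (simp only: \<phi>_assoc[OF gap_gap[OF F']] gap_gap[OF F'(1) subset_refl F'(3)] proj_hom(5))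
      ultimately have "sc \<kappa> * gap w ?F \<in> P" using \<phi>_mem[OF P N_P] by metis
      then have "gap w ?F \<in> N" using sc_cancel[OF nz P] gap_N F' by blast
      then have "\<phi> (gap w ?F) = 0" using \<phi>_eq_0_iff by blast
      then have "\<phi> (gap w F) = (\<Sum>e\<in>?F - F. \<phi> (D e) * \<phi> (H e))"
        using gap_diff[OF F'(1,2)] by simp
      then have eq: "\<phi> (val u bs * gap w F) = \<phi> (\<Sum>e\<in>?F - F. val u bs * D e * H e)"
        by (simp add: sum_distrib_left mult.assoc)
      have "val u bs * D e \<in> J" if "e \<in> ?F - F" for e
      proof -
        have e: "e \<in> out w" "e \<notin> F" using that F' by auto
        let ?bs = "map (\<lambda>(k, \<gamma>). (k, \<gamma> @ [e])) bs"
        have bs: "\<phi> (val u bs * D e) = \<phi> (val u ?bs)" using val_D less.prems(1) e by simp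
        have "\<phi> (val u ?bs) = \<phi> (val u bs * gap w F * D e)"
          using bs gap_D[OF F e(1)] e(2) by (simp add: mult.assoc)
        moreover have "val u bs * gap w F * D e \<in> I" using I less.prems(2) ring_idealD(4) by blast
        ultimately have "val u ?bs \<in> I" using \<phi>_mem[OF I(1,2)] by blast
        then have "val u ?bs \<in> J" using val_in_J walks_snoc less.prems(1) e(1) by blast
        then show ?thesis using \<phi>_mem[OF J bs] by blast
      qed
      then have "(\<Sum>e\<in>?F - F. val u bs * D e * H e) \<in> J"
        using ring_idealD(4)[OF J(1)] by (intro ring_ideal_sum[OF J(1)]) blast
      then show ?thesis using \<phi>_mem[OF J eq] by blast
    qed
  qed
qed

text \<open>Induction on the ghost length, splitting \<open>V w\<close> into a gap that removes all
  ghost parts and the products \<open>D e * H e\<close>; each \<open>a * D e\<close> has shorter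
  ghost parts.\<close>

lemma span_in_J: "a \<in> span u w n \<Longrightarrow> a \<in> I \<Longrightarrow> a * V w \<in> J"
proof (induction n arbitrary: a w)
  case 0
  then obtain bs where bs: "walks u w bs" "\<phi> (a * V w) = \<phi> (val u bs * gap w {})"
    using span_gap[OF 0(1)] by (auto simp: gap_def)
  have "a * V w \<in> I" using 0 I ring_idealD(4) by blast
  then have "val u bs * gap w {} \<in> I" using \<phi>_mem[OF I(1,2) bs(2)[symmetric]] by blast
  then have "val u bs * gap w {} \<in> J" using val_gap_in_J[of "{}" w] bs(1) by simp
  then show ?case using \<phi>_mem[OF J bs(2)] by blast
next
  case (Suc n)
  obtain bs F where bs: "walks u w bs" "\<phi> (a * gap w F) = \<phi> (val u bs * gap w F)"
    and F: "finite F" "F \<subseteq> out w"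
    using span_gap[OF Suc.prems(1)] by auto
  have "a * gap w F \<in> I" using Suc.prems I ring_idealD(4) by blast
  then have "val u bs * gap w F \<in> I" using \<phi>_mem[OF I(1,2) bs(2)[symmetric]] by blast
  then have "val u bs * gap w F \<in> J" using val_gap_in_J[OF F] bs(1) by simp
  then have gapJ: "a * gap w F \<in> J" using \<phi>_mem[OF J bs(2)] by blast
  have "a * D e * V (r e) \<in> J" if "e \<in> F" for e
  proof -
    have "a * D e \<in> span u (r e) n" using span_D_right[OF Suc.prems(1)] that F by fastforce
    moreover have "a * D e \<in> I" using Suc.prems I ring_idealD(4) by blast
    ultimately show ?thesis by (rule Suc.IH)
  qed
  then have "(\<Sum>e\<in>F. a * D e * V (r e) * H e) \<in> J"
    using ring_idealD(4)[OF J(1)] by (intro ring_ideal_sum[OF J(1)]) blast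
  then have "a * gap w F + (\<Sum>e\<in>F. a * D e * V (r e) * H e) \<in> J"
    using gapJ ring_idealD(2)[OF J(1)] by blast
  moreover have "\<phi> (a * V w) = \<phi> (a * gap w F + (\<Sum>e\<in>F. a * D e * V (r e) * H e))"
  proof -
    have "(\<Sum>e\<in>F. \<phi> a * (\<phi> (D e) * (\<phi> (V (r e)) * \<phi> (H e)))) = (\<Sum>e\<in>F. \<phi> a * (\<phi> (D e) * \<phi> (H e)))"
      using F by (intro sum.cong refl) (auto simp: \<phi>_rules out_def)
    then show ?thesis
      by (simp add: \<phi>_gap right_diff_distrib sum_distrib_left mult.assoc)
  qed
  ultimately show ?case using \<phi>_mem[OF J] by blast
qed

lemma subset_if_corners_subset: "I \<subseteq> J"
proof
  fix a assume a: "a \<in> I"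
  then have aM: "a \<in> M" using I P_M by blast
  show "a \<in> J"
  proof (rule M_local[OF aM J])
    fix u w
    obtain n where "V u * a * V w \<in> span u w n" using M_span[OF aM] by blast
    moreover have "V u * a * V w \<in> I" using a I by (auto intro: ring_idealD)
    ultimately have "V u * a * V w * V w \<in> J" by (rule span_in_J)
    moreover have "\<phi> (V u * a * V w) = \<phi> (V u * a * V w * V w)" by (simp add: \<phi>_rules mult.assoc)
    ultimately show "V u * a * V w \<in> J" using \<phi>_mem[OF J] by blast
  qed
qed

end

text \<open>As \<^term>\<open>P\<close> is prime, any two cycles without exits are connected.\<close>

lemma corners_transfer:
  assumes I: "ring_ideal I" and J: "ring_ideal J" "N \<subseteq> J"
    and v: "cyc v" and w: "cyc w"
    and corner: "\<And>x. x \<in> I \<Longrightarrow> V v * x * V v \<in> J" and x: "x \<in> I"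
  shows "V w * x * V w \<in> J"
proof -
  obtain y where y: "V v * y * V w \<notin> P"
    using prime[of "V v" "V w"] cyc_not_P v w V_M by blast
  obtain n where n: "V v * (V v * y) * V w \<in> span v w n"
    using M_span[of "V v * y"] V_M M ring_idealD(4) by blast
  have "V v * (V v * y) * V w \<notin> P"
    using y \<phi>_mem[OF P N_P, of "V v * y * V w" "V v * (V v * y) * V w"] by (auto simp: \<phi>_rules mult.assoc)
  moreover have "a \<in> P" if "a \<in> span v w n"
    and *: "\<And>\<alpha> \<beta> z. walk v \<alpha> z \<Longrightarrow> walk w \<beta> z \<Longrightarrow> pe v \<alpha> * ge w \<beta> \<in> P" for a
    using that(1)
  proof (induction rule: span.induct)
    case (span_term \<alpha> z \<beta> k)
    then show ?case using * P ring_idealD(3) by blast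
  qed (use N_P P in \<open>auto intro: ring_idealD\<close>)
  ultimately obtain \<alpha> \<beta> z where z: "walk v \<alpha> z" "walk w \<beta> z" "pe v \<alpha> * ge w \<beta> \<notin> P"
    using n by blast
  \<comment> \<open>Thus \<beta> follows the orbit and \<beta> \<beta>^* is w modulo N, while
    \<alpha>^* \<alpha> is z. So multiplying x by \<alpha> \<beta>^* and \<beta> \<alpha>^* moves
    its corner from w to v, and the reverse factors undo this.\<close>
  have "ge w \<beta> \<notin> N" using z(3) N_P P ring_idealD(3) by blast
  then have "\<beta> = orbit w (length \<beta>)" using walk_cases w z(2) by blast
  then have \<beta>: "\<phi> (pe w \<beta>) * \<phi> (ge w \<beta>) = \<phi> (V w)" using pe_ge_orbit[OF w] by metis
  let ?x = "pe v \<alpha> * ge w \<beta> * x * (pe w \<beta> * ge v \<alpha>)"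
  have "?x \<in> I" using x I by (auto intro: ring_idealD)
  then have "pe w \<beta> * ge v \<alpha> * (V v * ?x * V v) * (pe v \<alpha> * ge w \<beta>) \<in> J"
    using corner ring_idealD(3,4)[OF J(1)] by blast
  moreover have "\<phi> (V w * x * V w) =
      \<phi> (pe w \<beta> * ge v \<alpha> * (V v * ?x * V v) * (pe v \<alpha> * ge w \<beta>))"
    using \<beta> z(1,2) ge_pe[OF z(1)]
    by (simp add: path_rules mult.assoc \<phi>_assoc[OF \<beta>] \<phi>_assoc[OF ge_pe[OF z(1)]])
  ultimately show ?thesis using \<phi>_mem[OF J] by blast
qed

section \<open>The corner at a cycle without exits\<close>

text \<open>Evaluation at X by Horner's rule. A constant goes to a multiple of 1, the unit of the
  big ring and not of a corner, so values are used with a factor \<open>V v\<close>.\<close>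

definition ev :: "'a \<Rightarrow> 'k poly \<Rightarrow> 'a" where
  "ev X p = fold_coeffs (\<lambda>a y. sc a + y * X) p 0"

lemma ev_0 [simp]: "ev X 0 = 0"
  by (simp add: ev_def)

lemma ev_pCons [simp]: "ev X (pCons a p) = sc a + ev X p * X"
  by (cases "p = 0 \<and> a = 0") (auto simp: ev_def)

lemma ev_add: "ev X (p + q) = ev X p + ev X q"
  by (induction p q rule: poly_induct2) (simp_all add: sc_add algebra_simps)

lemma ev_smult: "ev X (smult a p) = sc a * ev X p"
  by (induction p) (simp_all add: sc_mult distrib_left mult.assoc)

lemma ev_X: "X * ev X p = ev X p * X"
  by (induction p) (simp_all add: distrib_left distrib_right sc_comm flip: mult.assoc)

lemma ev_mult: "ev X (p * q) = ev X p * ev X q"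
  by (induction p) (simp_all add: mult_pCons_left ev_add ev_smult distrib_right mult.assoc ev_X)

lemma ev_1 [simp]: "ev X 1 = 1"
  by (simp add: one_pCons)

lemma ev_comm: "ev X p * ev X q = ev X q * ev X p"
  by (metis ev_mult mult.commute)

context
  fixes v :: 'v
  assumes v: "cyc v"
begin

definition period :: nat where "period = (LEAST m. 0 < m \<and> (next_vertex ^^ m) v = v)"

definition X :: 'a where "X = pe v (orbit v period)"

definition Y :: 'a where "Y = ge v (orbit v period)"

lemma period: "0 < period" "(next_vertex ^^ period) v = v"
  and period_dvd: "(next_vertex ^^ m) v = v \<Longrightarrow> period dvd m"
proof -
  obtain m where m: "0 < m \<and> (next_vertex ^^ m) v = v" using orbit_returns[OF v] by blast
  have *: "0 < period \<and> (next_vertex ^^ period) v = v"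
    unfolding period_def by (rule LeastI, rule m)
  then show p: "0 < period" "(next_vertex ^^ period) v = v" by auto
  show "period dvd m" if "(next_vertex ^^ m) v = v" for m
  proof (rule ccontr)
    assume "\<not> period dvd m"
    then have "0 < m mod period" by (simp add: dvd_eq_mod_eq_0)
    moreover have "(next_vertex ^^ (m mod period)) v = v"
      using that funpow_mod_eq[OF p(2)] by metis
    ultimately have "period \<le> m mod period"
      unfolding period_def by (intro Least_le) auto
    then show False using mod_less_divisor[OF p(1), of m] by linarith
  qed
qed

lemma period_multiple: "(next_vertex ^^ (j * period)) v = v"
  by (induction j) (simp_all add: funpow_add period(2))

lemma walk_period: "walk v (orbit v period) v"
  using walk_orbit[OF v, of period] period(2) by simp

lemma walk_multiple: "walk v (orbit v (j * period)) v"
  using walk_orbit[OF v, of "j * period"] period_multiple by simp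

lemma VX: "\<phi> (V v) * \<phi> X = \<phi> X" and XV: "\<phi> X * \<phi> (V v) = \<phi> X"
  and VY: "\<phi> (V v) * \<phi> Y = \<phi> Y" and YV: "\<phi> Y * \<phi> (V v) = \<phi> Y"
  using path_rules(1-4)[OF walk_period, of v] by (simp_all add: X_def Y_def)

lemma XY: "\<phi> X * \<phi> Y = \<phi> (V v)"
  using pe_ge_orbit[OF v] by (simp add: X_def Y_def)

lemma V_ev: "\<phi> (V v) * \<phi> (ev X p) = \<phi> (ev X p) * \<phi> (V v)"
proof (induction p)
  case (pCons a p)
  have "\<phi> (V v) * (\<phi> (ev X p) * \<phi> X) = \<phi> (ev X p) * \<phi> X"
    by (simp add: \<phi>_assoc[OF pCons.IH] mult.assoc VX)
  then show ?case by (simp add: distrib_left distrib_right mult.assoc XV \<phi>_sc)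
qed simp

lemma V_ev_left: "\<phi> (V v) * (\<phi> (ev X p) * z) = \<phi> (ev X p) * (\<phi> (V v) * z)"
  by (simp add: \<phi>_assoc[OF V_ev] mult.assoc)

lemma ev_comm_left: "\<phi> (ev X p) * (\<phi> (ev X q) * z) = \<phi> (ev X q) * (\<phi> (ev X p) * z)"
  using arg_cong[OF ev_comm[of X p q], of \<phi>] by (simp flip: mult.assoc)

abbreviation indet :: "'k poly" where "indet \<equiv> [:0, 1:]"

lemma ev_indet_power: "ev X (indet ^ m) = X ^ m"
  by (induction m) (simp_all add: ev_mult del: ev_pCons, simp_all add: power_commutes)

lemma pe_multiple: "\<phi> (pe v (orbit v (j * period))) = \<phi> (V v * X ^ j)"
proof (induction j)
  case (Suc j)
  have "\<phi> (pe v (orbit v (Suc j * period))) = \<phi> X * \<phi> (pe v (orbit v (j * period)))"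
    using pe_append[OF walk_period walk_multiple[of j]] by (simp add: orbit_add period(2) X_def)
  then show ?case using Suc by (simp add: XV VX flip: mult.assoc)
qed simp

lemma ge_multiple: "\<phi> (ge v (orbit v (j * period))) = \<phi> (Y ^ j * V v)"
proof (induction j)
  case (Suc j)
  have "\<phi> (ge v (orbit v (Suc j * period))) = \<phi> (ge v (orbit v (j * period))) * \<phi> Y"
    using ge_append[OF walk_period walk_multiple[of j]] by (simp add: orbit_add period(2) Y_def)
  then show ?case using Suc by (simp add: power_Suc2 YV VY mult.assoc del: power_Suc)
qed simp

lemma V_power_XY: "\<phi> (V v) * (\<phi> (X ^ m) * \<phi> (Y ^ m)) = \<phi> (V v)"
proof (induction m)
  case (Suc m)
  have "\<phi> (X ^ Suc m) * \<phi> (Y ^ Suc m) = \<phi> (X ^ m) * (\<phi> (V v) * \<phi> (Y ^ m))"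
    by (simp add: power_Suc2[of X] mult.assoc \<phi>_assoc[OF XY] del: power_Suc) (simp add: mult.assoc \<phi>_assoc[OF XY])
  also have "\<dots> = \<phi> (V v) * (\<phi> (X ^ m) * \<phi> (Y ^ m))"
    using V_ev[of "indet ^ m"] by (simp add: ev_indet_power flip: mult.assoc)
  finally show ?case using Suc \<phi>_VV by (simp add: \<phi>_assoc[OF \<phi>_VV])
qed simp

lemma V_power_YX: "\<phi> (V v) * (\<phi> (Y ^ m) * (\<phi> (V v) * \<phi> (X ^ m))) = \<phi> (V v)"
proof -
  have "\<phi> (ge v (orbit v (m * period))) * \<phi> (pe v (orbit v (m * period))) = \<phi> (V v)"
    using ge_pe[OF walk_multiple] .
  then show ?thesis by (simp add: pe_multiple ge_multiple mult.assoc \<phi>_rules)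
qed

text \<open>Modulo N the corner consists of Laurent polynomials in the loop X; the exponent m is a
  common denominator, and the denominators of two summands are multiplied.\<close>

lemma corner_span: "a \<in> span v v n \<Longrightarrow> \<exists>m p. \<phi> a * \<phi> (X ^ m) = \<phi> (V v) * \<phi> (ev X p)"
proof (induction rule: span.induct)
  case (span_N a)
  then have "\<phi> a = 0" by (simp add: \<phi>_eq_0_iff)
  then show ?case by (intro exI[of _ 0]) simp
next
  case (span_add a b)
  then obtain m p l q where *: "\<phi> a * \<phi> (X ^ m) = \<phi> (V v) * \<phi> (ev X p)"
    "\<phi> b * \<phi> (X ^ l) = \<phi> (V v) * \<phi> (ev X q)"
    by blast
  have "\<phi> (a + b) * \<phi> (X ^ (m + l)) =
      \<phi> a * \<phi> (X ^ m) * \<phi> (X ^ l) + \<phi> b * \<phi> (X ^ l) * \<phi> (X ^ m)"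
    by (simp add: distrib_right mult.assoc power_add flip: proj_hom(5))
      (simp flip: power_add add: add.commute)
  also have "\<dots> = \<phi> (V v) * \<phi> (ev X (p * indet ^ l + q * indet ^ m))"
    by (simp add: * ev_add ev_mult ev_indet_power distrib_left mult.assoc)
  finally show ?case by blast
next
  case (span_term \<alpha> z \<beta> k)
  consider "pe v \<alpha> \<in> N" | "ge v \<beta> \<in> N"
    | "\<alpha> = orbit v (length \<alpha>)" "\<beta> = orbit v (length \<beta>)"
    using walk_cases v span_term by blast
  then show ?case
  proof cases
    case 1
    then have "\<phi> (pe v \<alpha>) = 0" by (simp add: \<phi>_eq_0_iff)
    then show ?thesis by (intro exI[of _ 0]) simp
  next
    case 2
    then have "\<phi> (ge v \<beta>) = 0" by (simp add: \<phi>_eq_0_iff)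
    then show ?thesis by (intro exI[of _ 0]) simp
  next
    case 3
    define a b where "a = length \<alpha>" and "b = length \<beta>"
    have \<alpha>: "\<alpha> = orbit v a" and \<beta>: "\<beta> = orbit v b" using 3 by (simp_all add: a_def b_def)
    have "(next_vertex ^^ a) v = z" "(next_vertex ^^ b) v = z"
      using span_term walk_orbit[OF v] walk_unique \<alpha> \<beta> by metis+
    then have ab: "(next_vertex ^^ a) v = (next_vertex ^^ b) v" by simp
    have return: "period dvd i - j" if "(next_vertex ^^ i) v = (next_vertex ^^ j) v" "j \<le> i" for i j
    proof -
      \<comment> \<open>After j steps from v, another \<open>j * period - j\<close> steps complete j
        turns and return to v. This replaces cancelling j steps, for which injectivity of
        \<open>next_vertex\<close> would be needed.\<close>
      have "j \<le> j * period" using period(1) by simp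
      have "(next_vertex ^^ (i - j + j * period)) v = (next_vertex ^^ (j * period - j + i)) v"
        using that(2) \<open>j \<le> j * period\<close> by (intro arg_cong2[where f = "\<lambda>n. next_vertex ^^ n"]
            arg_cong[where f = "\<lambda>n. (next_vertex ^^ n) v"]) simp
      also have "\<dots> = (next_vertex ^^ (j * period - j + j)) v"
        using that(1) by (simp only: funpow_add o_apply)
      also have "\<dots> = v" using \<open>j \<le> j * period\<close> period_multiple by simp
      finally have "(next_vertex ^^ (i - j)) v = v"
        using period_multiple by (simp add: funpow_add)
      then show ?thesis by (rule period_dvd)
    qed
    have orbit_ge: "orbit v i = orbit v (l * period) @ orbit v j" if "i = l * period + j" for i j l
      using that by (simp add: orbit_add period_multiple)
    \<comment> \<open>Both paths follow the orbit to the same vertex, so they differ by l full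
      turns: up to \<open>V v\<close> the monomial is \<open>X ^ l\<close> or
      \<open>Y ^ l\<close>.\<close>
    show ?thesis
    proof (cases "b \<le> a")
      case True
      then obtain l where "a - b = l * period" using return ab by (metis dvd_div_mult_self)
      then have "a = l * period + b" using True by simp
      then have "\<phi> (pe v \<alpha>) = \<phi> (V v * X ^ l) * \<phi> (pe v \<beta>)"
        using pe_append[OF walk_multiple] walk_orbit[OF v] orbit_ge \<alpha> \<beta> pe_multiple by metis
      then have "\<phi> (pe v \<alpha> * ge v \<beta>) = \<phi> (V v) * \<phi> (X ^ l)"
        using pe_ge_orbit[OF v, of b] \<beta> V_ev[of "indet ^ l"] V_ev_left[of "indet ^ l"]
        by (simp add: mult.assoc ev_indet_power \<phi>_VV)
      then have "\<phi> (sc k * (pe v \<alpha> * ge v \<beta>)) * \<phi> (X ^ 0) = \<phi> (V v) * \<phi> (ev X (smult k (indet ^ l)))"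
        by (simp add: ev_smult ev_indet_power \<phi>_sc_left mult.assoc del: proj_hom(5)) (simp add: \<phi>_sc_left mult.assoc)
      then show ?thesis by blast
    next
      case False
      then obtain l where "b - a = l * period" using return ab by (metis dvd_div_mult_self nle_le)
      then have "b = l * period + a" using False by simp
      then have "\<phi> (ge v \<beta>) = \<phi> (ge v \<alpha>) * \<phi> (Y ^ l * V v)"
        using ge_append[OF walk_multiple] walk_orbit[OF v] orbit_ge \<alpha> \<beta> ge_multiple by metis
      then have "\<phi> (pe v \<alpha> * ge v \<beta>) = \<phi> (V v) * (\<phi> (Y ^ l) * \<phi> (V v))"
        using pe_ge_orbit[OF v, of a] \<alpha> by (simp flip: mult.assoc)
      then have "\<phi> (pe v \<alpha> * ge v \<beta>) * \<phi> (X ^ l) = \<phi> (V v)"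
        using V_power_YX[of l] by (simp add: mult.assoc)
      then have "\<phi> (sc k * (pe v \<alpha> * ge v \<beta>)) * \<phi> (X ^ l) = \<phi> (V v) * \<phi> (ev X [:k:])"
        by (simp add: mult.assoc \<phi>_sc)
      then show ?thesis by blast
    qed
  qed
qed

lemma corner: "\<exists>m p. \<phi> (V v * y * V v) * \<phi> (X ^ m) = \<phi> (V v) * \<phi> (ev X p)"
proof -
  \<comment> \<open>The element y may lie outside M, for instance y = 1; the vertex factor brings it
    into M.\<close>
  have "V v * y \<in> M" using V_M M ring_idealD(4) by blast
  then obtain n where n: "V v * (V v * y) * V v \<in> span v v n" using M_span by blast
  have "V v * y * V v \<in> span v v n"
    by (rule span_cong[OF n]) (simp add: \<phi>_rules mult.assoc)
  then show ?thesis by (rule corner_span)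
qed

text \<open>The contraction of the corner of I to K[x]. Since X is invertible in the corner modulo
  N, it still determines the corner of an ideal containing N.\<close>

definition polys :: "'a set \<Rightarrow> 'k poly set" where "polys I = {p. V v * ev X p \<in> I}"

lemma poly_ideal_polys: "ring_ideal I \<Longrightarrow> N \<subseteq> I \<Longrightarrow> poly_ideal (polys I)"
  unfolding poly_ideal_def
proof (intro conjI ballI allI)
  assume I: "ring_ideal I" "N \<subseteq> I"
  show "0 \<in> polys I" using I by (simp add: polys_def ring_idealD(1))
  show "p + q \<in> polys I" if "p \<in> polys I" "q \<in> polys I" for p q
    using that I by (simp add: polys_def ev_add distrib_left ring_idealD(2))
  show "q * p \<in> polys I" if "p \<in> polys I" for p q
  proof -
    have "V v * ev X p * ev X q \<in> I" using that I ring_idealD(4) by (auto simp: polys_def)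
    then show ?thesis by (simp add: polys_def mult.commute[of q] ev_mult mult.assoc)
  qed
qed

text \<open>A power of X moves an element of the corner of I into K[x], where the hypothesis
  applies, and the same power of Y moves it back. Other cycles are reached by
  \<open>corners_transfer\<close>.\<close>

lemma subset_if_polys_subset:
  assumes I: "ring_ideal I" "N \<subseteq> I" "I \<subseteq> P" and J: "ring_ideal J" "N \<subseteq> J"
    and sub: "polys I \<subseteq> polys J"
  shows "I \<subseteq> J"
proof (rule subset_if_corners_subset[OF I J])
  have corner_v: "V v * y * V v \<in> J" if "y \<in> I" for y
  proof -
    obtain m p where mp: "\<phi> (V v * y * V v) * \<phi> (X ^ m) = \<phi> (V v) * \<phi> (ev X p)"
      using corner by blast
    have "V v * y * V v * X ^ m \<in> I" using that I by (intro ring_idealD(3,4)) auto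
    then have "V v * ev X p \<in> I" using \<phi>_mem[OF I(1,2)] mp by (metis proj_hom(5))
    then have "V v * ev X p \<in> J" using sub by (auto simp: polys_def)
    then have "V v * ev X p * Y ^ m \<in> J" using J ring_idealD(4) by blast
    moreover have "\<phi> (V v * y * V v) = \<phi> (V v * ev X p * Y ^ m)"
    proof -
      have "\<phi> (V v * ev X p * Y ^ m) = \<phi> (V v * y * V v) * \<phi> (X ^ m) * \<phi> (Y ^ m)"
        by (simp only: proj_hom(5) mp[unfolded proj_hom(5)])
      then show ?thesis by (simp add: mult.assoc V_power_XY)
    qed
    ultimately show ?thesis using \<phi>_mem[OF J] by blast
  qed
  show "V w * y * V w \<in> J" if "cyc w" "y \<in> I" for w y
    by (rule corners_transfer[OF I(1) J v that(1) corner_v that(2)])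
qed

text \<open>The corner is commutative modulo N: writing the corner of y as t(X) times
  \<open>Y ^ m\<close>, the product of p(X), y and q(X) between vertices becomes (p q)(X) t(X)
  \<open>Y ^ m\<close>, which is in P. Then \<open>prime\<close> applies to the two outer
  factors.\<close>

lemma polys_P_prime:
  assumes "p * q \<in> polys P"
  shows "p \<in> polys P \<or> q \<in> polys P"
proof -
  have M': "V v * ev X p \<in> M" for p using V_M M ring_idealD(4) by blast
  have "V v * ev X p * y * (V v * ev X q) \<in> P" for y
  proof -
    obtain m t where mt: "\<phi> (V v * y * V v) * \<phi> (X ^ m) = \<phi> (V v) * \<phi> (ev X t)"
      using corner by blast
    then have mt': "\<phi> (V v) * (\<phi> y * (\<phi> (V v) * (\<phi> (X ^ m) * z))) = \<phi> (V v) * (\<phi> (ev X t) * z)" for z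
      using \<phi>_assoc[OF mt, of z] by (simp add: mult.assoc)
    have "V v * ev X (p * q) * ev X t * Y ^ m \<in> P"
      using assms ring_idealD(4)[OF P] by (simp add: polys_def)
    moreover have "\<phi> (V v * ev X p * y * (V v * ev X q)) = \<phi> (V v * ev X (p * q) * ev X t * Y ^ m)"
    proof -
      have "\<phi> (V v * ev X p * y * (V v * ev X q)) =
          \<phi> (ev X p) * (\<phi> (V v) * (\<phi> y * (\<phi> (V v) * (\<phi> (V v) * \<phi> (ev X q)))))"
        by (simp add: mult.assoc \<phi>_assoc[OF \<phi>_VV] V_ev_left)
      \<comment> \<open>The vertex is replaced by \<open>X ^ m\<close> times \<open>Y ^ m\<close>,
        so that \<open>X ^ m\<close> can be moved next to y, where \<open>mt'\<close>
        applies.\<close>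
      also have "\<phi> (V v) * \<phi> (ev X q) = \<phi> (ev X q) * (\<phi> (V v) * (\<phi> (X ^ m) * \<phi> (Y ^ m)))"
        by (simp only: V_power_XY V_ev)
      also have "\<dots> = \<phi> (V v) * (\<phi> (X ^ m) * (\<phi> (ev X q) * \<phi> (Y ^ m)))"
        by (simp only: V_ev_left[symmetric] ev_comm_left[of q "indet ^ m", unfolded ev_indet_power])
      also have "\<phi> (V v) * (\<phi> (V v) * (\<phi> (X ^ m) * (\<phi> (ev X q) * \<phi> (Y ^ m)))) =
          \<phi> (V v) * (\<phi> (X ^ m) * (\<phi> (ev X q) * \<phi> (Y ^ m)))"
        by (simp add: \<phi>_assoc[OF \<phi>_VV])
      also have "\<phi> (V v) * (\<phi> y * (\<phi> (V v) * (\<phi> (X ^ m) * (\<phi> (ev X q) * \<phi> (Y ^ m))))) =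
          \<phi> (V v) * (\<phi> (ev X t) * (\<phi> (ev X q) * \<phi> (Y ^ m)))"
        by (rule mt')
      also have "\<phi> (ev X p) * (\<phi> (V v) * (\<phi> (ev X t) * (\<phi> (ev X q) * \<phi> (Y ^ m)))) =
          \<phi> (V v) * (\<phi> (ev X p) * (\<phi> (ev X q) * (\<phi> (ev X t) * \<phi> (Y ^ m))))"
        by (simp only: V_ev_left[symmetric] ev_comm_left[of t q])
      also have "\<dots> = \<phi> (V v * ev X (p * q) * ev X t * Y ^ m)"
        by (simp add: ev_mult mult.assoc)
      finally show ?thesis .
    qed
    ultimately show ?thesis using \<phi>_mem[OF P N_P] by blast
  qed
  then show ?thesis using prime[OF M' M', of p q] by (auto simp: polys_def)
qed

text \<open>The last factor \<open>V v\<close> is there for n = 0, where the power is 1 and not the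
  unit of the corner.\<close>

lemma V_ev_power: "\<phi> ((V v * ev X p) ^ n * V v) = \<phi> (V v * ev X (p ^ n))"
proof (induction n)
  case (Suc n)
  have "\<phi> ((V v * ev X p) ^ Suc n * V v) = \<phi> (V v * ev X p) * \<phi> ((V v * ev X p) ^ n * V v)"
    by (simp add: mult.assoc)
  also have "\<dots> = \<phi> (V v) * (\<phi> (ev X p) * \<phi> (V v)) * \<phi> (ev X (p ^ n))"
    using Suc by (simp add: mult.assoc)
  also have "\<dots> = \<phi> (V v * ev X (p ^ Suc n))"
    unfolding V_ev[symmetric] by (simp add: \<phi>_rules ev_mult mult.assoc)
  finally show ?case .
qed simp

end


section \<open>Ideals contained in the prime ideal\<close>

text \<open>The contraction of P is a prime ideal of K[x]: zero, or maximal. Inverses modulo f exist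
  in the second case, hence the guard \<open>f \<noteq> 0\<close>.\<close>

lemma poly_generator:
  assumes "cyc v"
  obtains f where "f \<in> polys v P" "\<And>p. p \<in> polys v P \<Longrightarrow> f dvd p"
    "\<And>q. f \<noteq> 0 \<Longrightarrow> \<not> f dvd q \<Longrightarrow> \<exists>u. f dvd 1 - u * q"
proof -
  note PP = poly_ideal_polys[OF assms P N_P]
  obtain f where f: "f \<in> polys v P" "\<And>p. p \<in> polys v P \<Longrightarrow> f dvd p"
    using poly_ideal_principal[OF PP] by blast
  have "\<exists>u. f dvd 1 - u * q" if "f \<noteq> 0" "\<not> f dvd q" for q
  proof -
    have "q \<notin> polys v P" using f(2) that(2) by blast
    from poly_prime_ideal_inverse[OF PP polys_P_prime[OF assms] f(1) that(1) f(2) this]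
    show ?thesis by blast
  qed
  then show ?thesis using that f by blast
qed

text \<open>Nilpotency modulo I and J puts a power of f into each contraction. For nonzero f both
  are then generated by powers of f, and such ideals form a chain.\<close>

theorem nil_ideals_comparable:
  assumes I: "ring_ideal I" "N \<subseteq> I" "I \<subseteq> P" "\<And>y. y \<in> P \<Longrightarrow> \<exists>n. y ^ n \<in> I"
    and J: "ring_ideal J" "N \<subseteq> J" "J \<subseteq> P" "\<And>y. y \<in> P \<Longrightarrow> \<exists>n. y ^ n \<in> J"
  shows "I \<subseteq> J \<or> J \<subseteq> I"
proof (cases "\<exists>v. cyc v")
  case False
  \<comment> \<open>Without cycles the condition on corners is vacuous.\<close>
  then show ?thesis using subset_if_corners_subset[OF I(1-3) J(1,2)] by blast
next
  case True
  then obtain v where v: "cyc v" ..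
  obtain f where f: "f \<in> polys v P" "\<And>p. p \<in> polys v P \<Longrightarrow> f dvd p"
    "\<And>q. f \<noteq> 0 \<Longrightarrow> \<not> f dvd q \<Longrightarrow> \<exists>u. f dvd 1 - u * q"
    using poly_generator[OF v] by blast
  have mono: "polys v I' \<subseteq> polys v P" if "I' \<subseteq> P" for I' using that v by (auto simp: polys_def)
  have "polys v I \<subseteq> polys v J \<or> polys v J \<subseteq> polys v I"
  proof (cases "f = 0")
    case True
    then have "polys v I \<subseteq> {0}" using f(2) mono[OF I(3)] by auto
    then show ?thesis using poly_ideal_polys[OF v J(1,2)] by (auto simp: poly_ideal_def)
  next
    case False
    have power: "\<exists>k. polys v I' = {p. f ^ k dvd p}"
      if I': "ring_ideal I'" "N \<subseteq> I'" "I' \<subseteq> P" "\<And>y. y \<in> P \<Longrightarrow> \<exists>n. y ^ n \<in> I'" for I'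
    proof -
      have "V v * ev (X v) f \<in> P" using f(1) v by (simp add: polys_def)
      then obtain n where "(V v * ev (X v) f) ^ n \<in> I'" using I'(4) by blast
      then have "(V v * ev (X v) f) ^ n * V v \<in> I'" using I' ring_idealD(4) by blast
      then have fn: "f ^ n \<in> polys v I'"
        using \<phi>_mem[OF I'(1,2) V_ev_power[OF v, symmetric]] v by (simp add: polys_def)
      have dvd: "f dvd p" if "p \<in> polys v I'" for p using f(2) mono[OF I'(3)] that by blast
      obtain k where "k \<le> n" "polys v I' = {p. f ^ k dvd p}"
        by (rule poly_ideal_power[OF poly_ideal_polys[OF v I'(1,2)] dvd fn f(3)[OF False]])
      then show ?thesis by blast
    qed
    obtain k where k: "polys v I = {p. f ^ k dvd p}" using power[OF I] ..
    obtain l where l: "polys v J = {p. f ^ l dvd p}" using power[OF J] ..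
    show ?thesis
      using le_imp_power_dvd[of k l f] le_imp_power_dvd[of l k f] linear[of k l]
      unfolding k l by (auto intro: dvd_trans)
  qed
  then show ?thesis
    using subset_if_polys_subset[OF v I(1-3) J(1,2)] subset_if_polys_subset[OF v J(1-3) I(1,2)] by blast
qed

text \<open>The contraction of Q contains the square of f, so for nonzero f that of B is generated
  by f^k with k \<le> 2: k = 2 puts B into Q, and k \<le> 1 puts P into B.\<close>

theorem no_ideal_between_square:
  assumes Q: "ring_ideal Q" "N \<subseteq> Q" "\<And>y z. y \<in> P \<Longrightarrow> z \<in> P \<Longrightarrow> y * z \<in> Q"
    and A: "ring_ideal B" "Q \<subseteq> B" "B \<subseteq> P"
  shows "B \<subseteq> Q \<or> P \<subseteq> B"
proof (cases "\<exists>v. cyc v")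
  case False
  then show ?thesis using subset_if_corners_subset[of B Q] Q A by blast
next
  case True
  then obtain v where v: "cyc v" ..
  have NB: "N \<subseteq> B" using Q A by blast
  obtain f where f: "f \<in> polys v P" "\<And>p. p \<in> polys v P \<Longrightarrow> f dvd p"
    "\<And>q. f \<noteq> 0 \<Longrightarrow> \<not> f dvd q \<Longrightarrow> \<exists>u. f dvd 1 - u * q"
    using poly_generator[OF v] by blast
  have sub: "polys v B \<subseteq> polys v P" using A(3) v by (auto simp: polys_def)
  have "V v * ev (X v) f \<in> P" using f(1) v by (simp add: polys_def)
  then have "(V v * ev (X v) f) ^ 2 * V v \<in> Q"
    using Q ring_idealD(4) unfolding power2_eq_square by blast
  then have fQ: "f ^ 2 \<in> polys v Q"
    using \<phi>_mem[OF Q(1,2) V_ev_power[OF v, symmetric]] v by (simp add: polys_def)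
  then have fB: "f ^ 2 \<in> polys v B" using A(2) v by (auto simp: polys_def)
  have "polys v B \<subseteq> polys v Q \<or> polys v P \<subseteq> polys v B"
  proof (cases "f = 0")
    case True
    then have "polys v P \<subseteq> {0}" using f(2) by auto
    then show ?thesis using poly_ideal_polys[OF v A(1) NB] by (auto simp: poly_ideal_def)
  next
    case False
    have dvd: "f dvd p" if "p \<in> polys v B" for p using f(2) sub that by blast
    obtain k where k: "k \<le> 2" "polys v B = {p. f ^ k dvd p}"
      by (rule poly_ideal_power[OF poly_ideal_polys[OF v A(1) NB] dvd fB f(3)[OF False]])
    show ?thesis
    proof (cases "k = 2")
      case True
      then show ?thesis
        using k(2) fQ poly_ideal_polys[OF v Q(1,2)] by (auto simp: poly_ideal_def dvd_def mult.commute)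
    next
      case False
      then have "f ^ k dvd f" using k(1) le_imp_power_dvd[of k 1 f] by simp
      then show ?thesis using k(2) f(2) dvd_trans by blast
    qed
  qed
  then show ?thesis
    using subset_if_polys_subset[OF v A(1) NB A(3) Q(1,2)]
      subset_if_polys_subset[OF v P N_P subset_refl A(1) NB] by blast
qed

end

section \<open>Elements that are nilpotent modulo an ideal\<close>

lemma ring_ideal_Union_chain:
  assumes "\<C> \<noteq> {}" "subset.chain {Q. ring_ideal Q} \<C>"
  shows "ring_ideal (\<Union>\<C>)"
  unfolding ring_ideal_def
proof (intro conjI ballI allI)
  have ideal: "ring_ideal Q" if "Q \<in> \<C>" for Q using assms(2) that by (auto simp: subset.chain_def)
  show "0 \<in> \<Union>\<C>" using assms(1) ideal ring_idealD(1) by blast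
  show "x + y \<in> \<Union>\<C>" if x: "x \<in> \<Union>\<C>" and y: "y \<in> \<Union>\<C>" for x y
  proof -
    obtain Q Q' where Q: "Q \<in> \<C>" "x \<in> Q" "Q' \<in> \<C>" "y \<in> Q'" using x y by blast
    then have "Q \<subseteq> Q' \<or> Q' \<subseteq> Q" using assms(2) by (auto simp: subset.chain_def)
    then show ?thesis using Q ideal ring_idealD(2) by (meson UnionI subsetD)
  qed
  show "a * x \<in> \<Union>\<C>" "x * a \<in> \<Union>\<C>" if "x \<in> \<Union>\<C>" for x a
    using that ideal ring_idealD(3,4) by blast+
qed

lemma ring_ideal_plus:
  assumes "ring_ideal Q" "ring_ideal B"
  shows "ring_ideal {q + b | q b. q \<in> Q \<and> b \<in> B}"
  unfolding ring_ideal_def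
proof (intro conjI ballI allI)
  show "0 \<in> {q + b | q b. q \<in> Q \<and> b \<in> B}"
    using assms by (intro CollectI exI[of _ 0]) (simp add: ring_idealD(1))
  show "x + y \<in> {q + b | q b. q \<in> Q \<and> b \<in> B}"
    if "x \<in> {q + b | q b. q \<in> Q \<and> b \<in> B}" "y \<in> {q + b | q b. q \<in> Q \<and> b \<in> B}" for x y
  proof -
    from that obtain q b q' b' where "x = q + b" "y = q' + b'" "q \<in> Q" "q' \<in> Q" "b \<in> B" "b' \<in> B"
      by blast
    moreover from this have "x + y = (q + q') + (b + b')" by (simp add: algebra_simps)
    ultimately show ?thesis using assms ring_idealD(2) by blast
  qed
  show "a * x \<in> {q + b | q b. q \<in> Q \<and> b \<in> B}" "x * a \<in> {q + b | q b. q \<in> Q \<and> b \<in> B}"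
    if x: "x \<in> {q + b | q b. q \<in> Q \<and> b \<in> B}" for x a
  proof -
    from x obtain q b where "x = q + b" "q \<in> Q" "b \<in> B" by blast
    moreover from this have "a * x = a * q + a * b" "x * a = q * a + b * a" by (simp_all add: algebra_simps)
    ultimately show "a * x \<in> {q + b | q b. q \<in> Q \<and> b \<in> B}" "x * a \<in> {q + b | q b. q \<in> Q \<and> b \<in> B}"
      using assms ring_idealD(3,4) by blast+
  qed
qed

text \<open>An ideal maximal among those missing all powers of y is prime, also without
  commutativity: if B and C are not inside Q, then y^n \<in> Q + B and y^m \<in> Q + C, so y^(n+m)
  would lie in Q.\<close>

lemma prime_avoiding_powers:
  fixes M :: "'a::ring_1 set"
  assumes M: "ring_ideal M" and I: "ring_ideal I" "I \<subseteq> M" and y: "y \<in> M" "\<And>n. y ^ n \<notin> I"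
  obtains Q where "ring_ideal Q" "I \<subseteq> Q" "Q \<subseteq> M" "y \<notin> Q"
    "\<And>B C. ring_ideal B \<Longrightarrow> ring_ideal C \<Longrightarrow> B \<subseteq> M \<Longrightarrow> C \<subseteq> M \<Longrightarrow>
      (\<And>b c. b \<in> B \<Longrightarrow> c \<in> C \<Longrightarrow> b * c \<in> Q) \<Longrightarrow> B \<subseteq> Q \<or> C \<subseteq> Q"
proof -
  let ?S = "{Q. ring_ideal Q \<and> I \<subseteq> Q \<and> Q \<subseteq> M \<and> (\<forall>n. y ^ n \<notin> Q)}"
  have "\<exists>Q\<in>?S. \<forall>Q'\<in>?S. Q \<subseteq> Q' \<longrightarrow> Q' = Q"
  proof (rule subset_Zorn_nonempty)
    show "?S \<noteq> {}" using I y by blast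
    show "\<Union>\<C> \<in> ?S" if "\<C> \<noteq> {}" "subset.chain ?S \<C>" for \<C>
    proof -
      have "Q \<in> ?S" if "Q \<in> \<C>" for Q using \<open>subset.chain ?S \<C>\<close> that by (auto simp: subset.chain_def)
      then have "\<forall>Q\<in>\<C>. I \<subseteq> Q \<and> Q \<subseteq> M \<and> (\<forall>n. y ^ n \<notin> Q)" by simp
      then have "I \<subseteq> \<Union>\<C> \<and> \<Union>\<C> \<subseteq> M \<and> (\<forall>n. y ^ n \<notin> \<Union>\<C>)" using that(1) by fast
      moreover have "subset.chain {Q. ring_ideal Q} \<C>" using that(2) by (auto simp: subset.chain_def)
      then have "ring_ideal (\<Union>\<C>)" using ring_ideal_Union_chain that(1) by blast
      ultimately show ?thesis by simp
    qed
  qed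
  then obtain Q where "Q \<in> ?S" and max: "\<forall>Q'\<in>?S. Q \<subseteq> Q' \<longrightarrow> Q' = Q" ..
  then have Q: "ring_ideal Q" "I \<subseteq> Q" "Q \<subseteq> M" "\<And>n. y ^ n \<notin> Q" by simp_all
  have power: "\<exists>n q b. y ^ n = q + b \<and> q \<in> Q \<and> b \<in> B"
    if B: "ring_ideal B" "B \<subseteq> M" "\<not> B \<subseteq> Q" for B
  proof (rule ccontr)
    let ?Q = "{q + b | q b. q \<in> Q \<and> b \<in> B}"
    assume "\<not> ?thesis"
    then have "\<forall>n. y ^ n \<notin> ?Q" by blast
    moreover have "ring_ideal ?Q" using Q B ring_ideal_plus by blast
    moreover have "q \<in> ?Q" if "q \<in> Q" for q
      using that B(1) ring_idealD(1) by (intro CollectI exI[of _ q] exI[of _ 0]) auto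
    then have QQ: "Q \<subseteq> ?Q" by blast
    moreover have "?Q \<subseteq> M" using Q(3) B(2) M ring_idealD(2) by blast
    ultimately have "?Q \<in> ?S" using Q(2) by simp
    then have "?Q = Q" using max QQ by simp
    moreover have "b \<in> ?Q" if "b \<in> B" for b
      using that Q(1) ring_idealD(1) by (intro CollectI exI[of _ 0] exI[of _ b]) auto
    ultimately show False using B(3) by blast
  qed
  have "B \<subseteq> Q \<or> C \<subseteq> Q"
    if BC: "ring_ideal B" "ring_ideal C" "B \<subseteq> M" "C \<subseteq> M" "\<And>b c. b \<in> B \<Longrightarrow> c \<in> C \<Longrightarrow> b * c \<in> Q" for B C
  proof (rule ccontr)
    assume "\<not> ?thesis"
    then obtain n m q q' b c where *: "y ^ n = q + b" "q \<in> Q" "b \<in> B" "y ^ m = q' + c" "q' \<in> Q" "c \<in> C"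
      using power BC by metis
    have "y ^ (n + m) = (q + b) * (q' + c)"
      by (simp only: power_add *)
    also have "\<dots> = q * (q' + c) + b * q' + b * c"
      by (simp add: distrib_left distrib_right)
    finally have "y ^ (n + m) = q * (q' + c) + b * q' + b * c" .
    moreover have "q * (q' + c) \<in> Q" "b * q' \<in> Q" "b * c \<in> Q"
      using * BC(5) Q(1) ring_idealD(3,4) by blast+
    ultimately have "y ^ (n + m) \<in> Q" using ring_idealD(2)[OF Q(1)] by presburger
    then show False using Q(4) by blast
  qed
  then show ?thesis using that Q Q(4)[of 1] by simp
qed


section \<open>Words in a set of letters\<close>

lemma free_elem_induct [case_names zero single add]:
  assumes "Q 0" "\<And>w c. Q (Poly_Mapping.single w c)" "\<And>p q. Q p \<Longrightarrow> Q q \<Longrightarrow> Q (p + q)"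
  shows "Q (p :: 'x free_word \<Rightarrow>\<^sub>0 'k::field)"
proof (induction p rule: Poly_Mapping.update_induct)
  case (update f a b)
  have "Poly_Mapping.update a b f = f + Poly_Mapping.single a b"
    using update(1) by (intro poly_mapping_eqI)
      (auto simp: lookup_update lookup_add lookup_single in_keys_iff when_def)
  then show ?case using assms update by simp
qed (rule assms(1))

text \<open>An idempotent ring endomorphism, because a concatenation has all letters in S exactly if
  both parts do. Membership in the free algebra on S thus becomes an equation.\<close>

lift_definition restrict_words :: "'x set \<Rightarrow> ('x free_word \<Rightarrow>\<^sub>0 'k::field) \<Rightarrow> ('x free_word \<Rightarrow>\<^sub>0 'k)"
  is "\<lambda>S f w. if set (letters w) \<subseteq> S then f w else 0"
  by (rule finite_subset[rotated]) auto

lemma lookup_restrict_words: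
  "Poly_Mapping.lookup (restrict_words S p) w =
    (if set (letters w) \<subseteq> S then Poly_Mapping.lookup p w else 0)"
  by transfer simp

lemma restrict_words_single:
  "restrict_words S (Poly_Mapping.single w c) =
    (if set (letters w) \<subseteq> S then Poly_Mapping.single w c else 0)"
  by (rule poly_mapping_eqI) (auto simp: lookup_restrict_words lookup_single when_def)

lemma restrict_words_simps [simp]:
  "restrict_words S 0 = 0"
  "restrict_words S (p + q) = restrict_words S p + restrict_words S q"
  "restrict_words S (p - q) = restrict_words S p - restrict_words S q"
  "restrict_words S (- p) = - restrict_words S p"
  "restrict_words S (restrict_words S p) = restrict_words S p"
  by (rule poly_mapping_eqI; simp add: lookup_restrict_words lookup_add lookup_minus)+

lemma restrict_words_sum [simp]: "restrict_words S (\<Sum>i\<in>T. f i) = (\<Sum>i\<in>T. restrict_words S (f i))"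
  by (induction T rule: infinite_finite_induct) auto

lemma letters_plus [simp]: "letters (u + w) = letters u @ letters w"
  by (simp add: plus_free_word_def)

lemma letters_0 [simp]: "letters 0 = []"
  by (simp add: zero_free_word_def)

lemma word_eq_0_iff: "w = 0 \<longleftrightarrow> letters w = []"
  by (cases w) (simp add: zero_free_word_def)

lemma restrict_words_mult [simp]:
  "restrict_words S (p * q) = restrict_words S p * restrict_words S q"
proof (induction p rule: free_elem_induct)
  case (single w c)
  show ?case
    by (induction q rule: free_elem_induct)
      (auto simp: distrib_left mult_single restrict_words_single)
qed (simp_all add: distrib_right)

lemma restrict_words_scalar [simp]:
  "restrict_words S (Poly_Mapping.single 0 c) = Poly_Mapping.single 0 c"
  by (simp add: restrict_words_single)

text \<open>A concatenation is empty only if both words are; hence the elements without constant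
  term form an ideal.\<close>

lemma lookup_mult_0:
  "Poly_Mapping.lookup (p * q) (0 :: 'x free_word) =
    Poly_Mapping.lookup p 0 * (Poly_Mapping.lookup q 0 :: 'k::field)"
proof (induction p rule: free_elem_induct)
  case (single w c)
  show ?case
  proof (induction q rule: free_elem_induct)
    case (single w' c')
    have "w + w' = 0 \<longleftrightarrow> w = 0 \<and> w' = 0" by (simp add: word_eq_0_iff)
    then show ?case by (auto simp: mult_single lookup_single when_def)
  qed (simp_all add: distrib_left lookup_add)
qed (simp_all add: distrib_right lookup_add)

lemma scalar_comm: "p * Poly_Mapping.single 0 c = Poly_Mapping.single 0 c * (p :: 'x free_word \<Rightarrow>\<^sub>0 'k::field)"
  by (induction p rule: free_elem_induct) (simp_all add: mult_single distrib_left distrib_right mult.commute)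

definition augmentation :: "('x free_word \<Rightarrow>\<^sub>0 'k::field) set" where
  "augmentation = {p. Poly_Mapping.lookup p 0 = 0}"

lemma ring_ideal_augmentation: "ring_ideal augmentation"
  by (simp add: ring_ideal_def augmentation_def lookup_mult_0 lookup_add)

lemma augmentation_uminus [simp]: "- p \<in> augmentation \<longleftrightarrow> p \<in> augmentation"
  by (simp add: augmentation_def)

lemma carrier_free_algebra:
  "p \<in> carrier (free_algebra S) \<longleftrightarrow> restrict_words S p = p \<and> p \<in> augmentation"
proof -
  have "restrict_words S p = p \<longleftrightarrow> (\<forall>w\<in>Poly_Mapping.keys p. set (letters w) \<subseteq> S)"
    by (auto simp: poly_mapping_eq_iff fun_eq_iff lookup_restrict_words in_keys_iff)
  then show ?thesis
    by (auto simp: free_algebra_def augmentation_def in_keys_iff)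
qed

lemma restrict_words_augmentation [simp]: "restrict_words S p \<in> augmentation \<longleftrightarrow> p \<in> augmentation"
  by (simp add: augmentation_def lookup_restrict_words)

lemma two_sided_ideal_free_algebra:
  "two_sided_ideal I (free_algebra S :: ('x free_word \<Rightarrow>\<^sub>0 'k::field) ring) \<longleftrightarrow>
    I \<subseteq> carrier (free_algebra S) \<and> 0 \<in> I \<and> (\<forall>x\<in>I. \<forall>y\<in>I. x + y \<in> I) \<and> (\<forall>x\<in>I. - x \<in> I) \<and>
    (\<forall>x\<in>I. \<forall>a\<in>carrier (free_algebra S). a * x \<in> I \<and> x * a \<in> I)"
proof -
  let ?F = "free_algebra S :: ('x free_word \<Rightarrow>\<^sub>0 'k) ring"
  have ops [simp]: "ring.add ?F = (+)" "monoid.mult ?F = (*)" "ring.zero ?F = 0" by (simp_all add: free_algebra_def)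
  have "m_inv (add_monoid ?F) x = - x" if "x \<in> carrier ?F" for x
    unfolding m_inv_def
  proof (rule the_equality)
    show "- x \<in> carrier (add_monoid ?F) \<and> x \<otimes>\<^bsub>add_monoid ?F\<^esub> - x = \<one>\<^bsub>add_monoid ?F\<^esub> \<and>
        - x \<otimes>\<^bsub>add_monoid ?F\<^esub> x = \<one>\<^bsub>add_monoid ?F\<^esub>"
      using that by (simp add: carrier_free_algebra)
  qed (auto simp: eq_neg_iff_add_eq_0)
  then have inv: "m_inv (add_monoid ?F) x = - x" if "x \<in> I" "I \<subseteq> carrier ?F" for x
    using that by blast
  show ?thesis
    by (cases "I \<subseteq> carrier ?F") (auto simp: two_sided_ideal_def additive_subgroup_def subgroup_def inv[simplified])
qed

section \<open>From a Leavitt path algebra to ideals of the free algebra\<close>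

locale leavitt_path =
  fixes E :: "('v, 'e) pre_digraph"
  assumes wf: "wf_digraph E"
begin

abbreviation \<pi> :: "('v, 'e, 'k::field) free_elem \<Rightarrow> ('v, 'e, 'k) free_elem" where
  "\<pi> \<equiv> restrict_words (generators E)"

abbreviation FA :: "('v, 'e, 'k::field) free_elem set" where
  "FA \<equiv> carrier (free_algebra (generators E))"

abbreviation L :: "('v, 'e, 'k::field) lpa_elem ring" where
  "L \<equiv> leavitt_path_algebra E"

abbreviation scalar :: "'k::field \<Rightarrow> ('v, 'e, 'k) free_elem" where
  "scalar \<equiv> Poly_Mapping.single 0"

lemma FA_closed:
  "x \<in> FA \<Longrightarrow> y \<in> FA \<Longrightarrow> x + y \<in> FA"
  "x \<in> FA \<Longrightarrow> - x \<in> FA"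
  "x \<in> FA \<Longrightarrow> y \<in> FA \<Longrightarrow> x - y \<in> FA"
  "0 \<in> FA"
  "x \<in> FA \<Longrightarrow> \<pi> a = a \<Longrightarrow> a * x \<in> FA"
  "x \<in> FA \<Longrightarrow> \<pi> a = a \<Longrightarrow> x * a \<in> FA"
  using ring_idealD[OF ring_ideal_augmentation] by (auto simp: carrier_free_algebra)

lemma \<pi>_FA: "x \<in> FA \<Longrightarrow> \<pi> x = x" and \<pi>_in_FA: "\<pi> x \<in> FA \<longleftrightarrow> x \<in> augmentation"
  by (simp_all add: carrier_free_algebra)

lemma FA_augmentation: "x \<in> FA \<Longrightarrow> x \<in> augmentation"
  by (simp add: carrier_free_algebra)

definition rel_ideal :: "('v, 'e, 'k::field) free_elem set" where
  "rel_ideal = generated_ideal (generators E) (leavitt_relations E)"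

lemma vx_FA: "v \<in> verts E \<Longrightarrow> vx v \<in> FA"
  and ed_FA: "e \<in> arcs E \<Longrightarrow> ed e \<in> FA" and gh_FA: "e \<in> arcs E \<Longrightarrow> gh e \<in> FA"
  by (simp_all add: vx_def ed_def gh_def free_algebra_def generators_def word_eq_0_iff)

lemma sum_FA: "(\<And>i. i \<in> S \<Longrightarrow> f i \<in> FA) \<Longrightarrow> (\<Sum>i\<in>S. f i) \<in> FA"
  by (induction S rule: infinite_finite_induct) (auto intro: FA_closed)

lemma leavitt_relations_FA: "leavitt_relations E \<subseteq> FA"
proof -
  have "head E e \<in> verts E" "tail E e \<in> verts E" if "e \<in> arcs E" for e
    using wf that by (auto simp: wf_digraph_def)
  then show ?thesis
    by (auto simp: leavitt_relations_def regular_vertex_def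
        intro!: FA_closed sum_FA vx_FA ed_FA gh_FA \<pi>_FA)
qed

lemma rel_ideal:
  shows rel_ideal_FA: "rel_ideal \<subseteq> FA" and rel_ideal_0: "0 \<in> rel_ideal"
    and rel_ideal_add: "x \<in> rel_ideal \<Longrightarrow> y \<in> rel_ideal \<Longrightarrow> x + y \<in> rel_ideal"
    and rel_ideal_uminus: "x \<in> rel_ideal \<Longrightarrow> - x \<in> rel_ideal"
    and rel_ideal_mult: "x \<in> rel_ideal \<Longrightarrow> a \<in> FA \<Longrightarrow> a * x \<in> rel_ideal"
      "x \<in> rel_ideal \<Longrightarrow> a \<in> FA \<Longrightarrow> x * a \<in> rel_ideal"
    and rel_ideal_scalar: "x \<in> rel_ideal \<Longrightarrow> scalar c * x \<in> rel_ideal"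
    and leavitt_relations_rel_ideal: "leavitt_relations E \<subseteq> rel_ideal"
proof -
  have "FA \<in> {I. two_sided_ideal I (free_algebra (generators E)) \<and>
      (\<forall>c. \<forall>p\<in>I. scalar c * p \<in> I) \<and> leavitt_relations E \<subseteq> I}"
    using leavitt_relations_FA by (simp add: two_sided_ideal_free_algebra FA_closed \<pi>_FA)
  then show "rel_ideal \<subseteq> FA" unfolding rel_ideal_def generated_ideal_def by blast
qed (auto simp: rel_ideal_def generated_ideal_def two_sided_ideal_free_algebra)

text \<open>The fixed points of \<pi> are the unitization of FA, so closure under FA and under
  scalars gives closure under all of them.\<close>

lemma split_constant:
  assumes "\<pi> a = a"
  obtains c a' where "a = scalar c + a'" "a' \<in> FA"
proof
  show "a = scalar (Poly_Mapping.lookup a 0) + (a - scalar (Poly_Mapping.lookup a 0))" by simp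
  show "a - scalar (Poly_Mapping.lookup a 0) \<in> FA"
    using assms by (simp add: carrier_free_algebra augmentation_def lookup_minus)
qed

lemma rel_ideal_mult':
  assumes "x \<in> rel_ideal" "\<pi> a = a"
  shows "a * x \<in> rel_ideal" "x * a \<in> rel_ideal"
proof -
  obtain c a' where "a = scalar c + a'" "a' \<in> FA" using split_constant assms(2) by blast
  then show "a * x \<in> rel_ideal" "x * a \<in> rel_ideal"
    using assms(1) by (simp_all add: distrib_left distrib_right scalar_comm rel_ideal)
qed

text \<open>Letters outside the graph are put into the kernel too; \<pi> then identifies
  \<open>augmentation\<close> modulo this ideal with the Leavitt path algebra.\<close>

definition rel_kernel :: "('v, 'e, 'k::field) free_elem set" where
  "rel_kernel = {x. \<pi> x \<in> rel_ideal}"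

lemma ring_ideal_rel_kernel: "ring_ideal rel_kernel"
  by (auto simp: ring_ideal_def rel_kernel_def rel_ideal rel_ideal_mult')

lemma rel_kernel_augmentation: "rel_kernel \<subseteq> augmentation"
  using rel_ideal_FA \<pi>_in_FA unfolding rel_kernel_def by blast

lemma \<pi>_generators:
  "\<pi> (vx v) = (if v \<in> verts E then vx v else 0)"
  "\<pi> (ed e) = (if e \<in> arcs E then ed e else 0)"
  "\<pi> (gh e) = (if e \<in> arcs E then gh e else 0)"
  by (auto simp: vx_def ed_def gh_def restrict_words_single generators_def)

lemma free_words_induct:
  assumes "p \<in> FA" and "0 \<in> S" and "\<And>x y. x \<in> S \<Longrightarrow> y \<in> S \<Longrightarrow> x + y \<in> S"
    and "\<And>k x. x \<in> S \<Longrightarrow> scalar k * x \<in> S"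
    and letter: "\<And>l. l \<in> generators E \<Longrightarrow> Poly_Mapping.single (Word [l]) 1 \<in> S"
    and mult: "\<And>l x. l \<in> generators E \<Longrightarrow> x \<in> S \<Longrightarrow> Poly_Mapping.single (Word [l]) 1 * x \<in> S"
  shows "p \<in> S"
proof -
  have word: "Poly_Mapping.single (Word ls) 1 \<in> S" if "ls \<noteq> []" "set ls \<subseteq> generators E" for ls
    using that
  proof (induction ls)
    case (Cons l ls)
    show ?case
    proof (cases "ls = []")
      case False
      then have "Poly_Mapping.single (Word [l]) 1 * Poly_Mapping.single (Word ls) 1 \<in> S"
        using Cons mult by simp
      then show ?thesis by (simp add: mult_single plus_free_word_def)
    qed (use Cons letter in auto)
  qed simp
  have "\<pi> p \<in> S" if "p \<in> augmentation" for p
  proof -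
    have "\<pi> (p - scalar (Poly_Mapping.lookup p 0)) \<in> S"
    proof (induction p rule: free_elem_induct)
      case (single w c)
      show ?case
      proof (cases "w \<noteq> 0 \<and> set (letters w) \<subseteq> generators E")
        case True
        then have "scalar c * Poly_Mapping.single (Word (letters w)) 1 \<in> S"
          using assms(4)[OF word[of "letters w"]] by (simp add: word_eq_0_iff)
        then show ?thesis
          using True by (simp add: mult_single restrict_words_single lookup_single)
      next
        case False
        then show ?thesis
          using assms(2) by (auto simp: restrict_words_single lookup_single when_def)
      qed
    next
      case (add p q)
      then have "\<pi> (p - scalar (Poly_Mapping.lookup p 0)) + \<pi> (q - scalar (Poly_Mapping.lookup q 0)) \<in> S"
        using assms(3) by blast
      then show ?case by (simp add: lookup_add single_add algebra_simps)
    qed (use assms(2) in simp)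
    then show ?thesis using that by (simp add: augmentation_def)
  qed
  then show ?thesis using assms(1) \<pi>_FA FA_augmentation by metis
qed

lemma rel_kernel_relations:
  assumes "x \<in> leavitt_relations E"
  shows "x \<in> rel_kernel"
proof -
  have "x \<in> rel_ideal" using assms leavitt_relations_rel_ideal by blast
  moreover from this have "\<pi> x = x" using rel_ideal_FA \<pi>_FA by blast
  ultimately show ?thesis by (simp add: rel_kernel_def)
qed

lemma family:
  "leavitt_family (rel_kernel :: ('v, 'e, 'k::field) free_elem set) augmentation scalar vx ed gh (arcs E) (tail E) (head E)"
proof
  show "ring_ideal rel_kernel" "ring_ideal augmentation" "rel_kernel \<subseteq> augmentation"
    by (rule ring_ideal_rel_kernel ring_ideal_augmentation rel_kernel_augmentation)+
  show "scalar (a + b) = scalar a + scalar b" "scalar (a * b) = scalar a * scalar b"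
    "scalar 1 = 1" for a b
    by (simp_all add: single_add mult_single)
  show "x * scalar a = scalar a * x" for x a by (rule scalar_comm)
  show "vx v \<in> augmentation" for v
    by (simp add: vx_def augmentation_def lookup_single word_eq_0_iff)
  show "vx v * vx w - (if v = w then vx v else 0) \<in> rel_kernel" for v w
  proof (cases "v \<in> verts E \<and> w \<in> verts E")
    case True
    then show ?thesis by (intro rel_kernel_relations) (auto simp: leavitt_relations_def)
  next
    \<comment> \<open>A vertex outside the graph vanishes under \<pi>, and with it the whole
      relation.\<close>
    case False
    then show ?thesis by (auto simp: rel_kernel_def \<pi>_generators rel_ideal_0)
  qed
  show "vx (tail E e) * ed e - ed e \<in> rel_kernel" "ed e * vx (head E e) - ed e \<in> rel_kernel"
    "vx (head E e) * gh e - gh e \<in> rel_kernel" "gh e * vx (tail E e) - gh e \<in> rel_kernel"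
    if "e \<in> arcs E" for e
    using that by (auto intro!: rel_kernel_relations simp: leavitt_relations_def)
  show "gh e * ed f - (if e = f then vx (head E f) else 0) \<in> rel_kernel"
    if "e \<in> arcs E" "f \<in> arcs E" for e f
  proof (rule rel_kernel_relations)
    have "gh e * ed f - (if e = f then vx (head E f) else 0) \<in>
        {gh e * ed f - (if e = f then vx (head E f) else 0) | e f. e \<in> arcs E \<and> f \<in> arcs E}"
      using that by blast
    then show "gh e * ed f - (if e = f then vx (head E f) else 0) \<in> leavitt_relations E"
      unfolding leavitt_relations_def by blast
  qed
  show "augmentation \<subseteq> S"
    if N: "\<And>x. x \<in> rel_kernel \<Longrightarrow> x \<in> S" and add: "\<And>x y. x \<in> S \<Longrightarrow> y \<in> S \<Longrightarrow> x + y \<in> S"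
      and gen: "\<And>v. vx v \<in> S" "\<And>e. e \<in> arcs E \<Longrightarrow> ed e \<in> S" "\<And>e. e \<in> arcs E \<Longrightarrow> gh e \<in> S"
      and "\<And>k x. x \<in> S \<Longrightarrow> scalar k * x \<in> S" and mult: "\<And>v x. x \<in> S \<Longrightarrow> vx v * x \<in> S"
        "\<And>e x. e \<in> arcs E \<Longrightarrow> x \<in> S \<Longrightarrow> ed e * x \<in> S"
        "\<And>e x. e \<in> arcs E \<Longrightarrow> x \<in> S \<Longrightarrow> gh e * x \<in> S" for S :: "('v, 'e, 'k) free_elem set"
  proof
    fix x :: "('v, 'e, 'k) free_elem" assume "x \<in> augmentation"
    have "\<pi> x \<in> S"
    proof (rule free_words_induct)
      show "\<pi> x \<in> FA" using \<open>x \<in> augmentation\<close> \<pi>_in_FA by blast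
      show "0 \<in> S" using N ring_idealD(1)[OF ring_ideal_rel_kernel] by blast
      show "Poly_Mapping.single (Word [l]) 1 \<in> S" if "l \<in> generators E" for l
        using that gen unfolding generators_def vx_def ed_def gh_def by blast
      show "Poly_Mapping.single (Word [l]) 1 * x \<in> S" if "l \<in> generators E" "x \<in> S" for l x
        using that mult unfolding generators_def vx_def ed_def gh_def by blast
    qed (fact add that(6))+
    moreover have "x - \<pi> x \<in> rel_kernel" by (simp add: rel_kernel_def rel_ideal_0)
    ultimately have "\<pi> x + (x - \<pi> x) \<in> S" using add N by blast
    then show "x \<in> S" by simp
  qed
qed

section \<open>The Leavitt path algebra as a ring of cosets\<close>

definition cl :: "('v, 'e, 'k::field) free_elem \<Rightarrow> ('v, 'e, 'k) lpa_elem" where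
  "cl x = (\<lambda>h. h + x) ` rel_ideal"

lemma cl_eq_iff: "cl x = cl y \<longleftrightarrow> x - y \<in> rel_ideal"
proof
  assume "cl x = cl y"
  moreover have "x \<in> cl x" unfolding cl_def using rel_ideal_0 by (intro image_eqI[of _ _ 0]) simp_all
  ultimately obtain h where "x = h + y" "h \<in> rel_ideal" unfolding cl_def by blast
  then show "x - y \<in> rel_ideal" by simp
next
  have *: "cl x \<subseteq> cl y" if "x - y \<in> rel_ideal" for x y :: "('v, 'e, 'k::field) free_elem"
  proof
    fix z assume "z \<in> cl x"
    then obtain h where "z = h + x" "h \<in> rel_ideal" unfolding cl_def by blast
    then have "z = (h + (x - y)) + y" "h + (x - y) \<in> rel_ideal" using that rel_ideal_add by auto
    then show "z \<in> cl y" unfolding cl_def by blast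
  qed
  assume xy: "x - y \<in> rel_ideal"
  then have "y - x \<in> rel_ideal" using rel_ideal_uminus[OF xy] by simp
  then show "cl x = cl y" using * xy by blast
qed

lemma mem_cl: "z \<in> cl x \<longleftrightarrow> z - x \<in> rel_ideal"
  unfolding cl_def by (auto intro: image_eqI[of _ _ "z - x"])

lemma a_r_coset_eq: "rel_ideal +>\<^bsub>free_algebra (generators E)\<^esub> x = cl x"
  by (auto simp: a_r_coset_def r_coset_def cl_def free_algebra_def)

lemma carrier_L: "carrier L = cl ` FA"
  unfolding leavitt_path_algebra_def FactRing_def A_RCOSETS_def RCOSETS_def rel_ideal_def[symmetric]
  by (auto simp: a_r_coset_eq[symmetric] a_r_coset_def)

lemma zero_L: "\<zero>\<^bsub>L\<^esub> = cl 0"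
  unfolding leavitt_path_algebra_def FactRing_def rel_ideal_def[symmetric]
  by (simp add: cl_def)

lemma add_L: "cl x \<oplus>\<^bsub>L\<^esub> cl y = cl (x + y)"
proof -
  have "cl x \<oplus>\<^bsub>L\<^esub> cl y = {a + b | a b. a \<in> cl x \<and> b \<in> cl y}"
    unfolding leavitt_path_algebra_def FactRing_def
    by (auto simp: set_add_def set_mult_def free_algebra_def)
  also have "\<dots> = cl (x + y)"
  proof (intro equalityI subsetI)
    fix z assume "z \<in> {a + b | a b. a \<in> cl x \<and> b \<in> cl y}"
    then obtain a b where ab: "z = a + b" "a - x \<in> rel_ideal" "b - y \<in> rel_ideal"
      by (auto simp: mem_cl)
    have "(a - x) + (b - y) \<in> rel_ideal" using ab rel_ideal_add by blast
    then show "z \<in> cl (x + y)" by (simp add: ab mem_cl algebra_simps)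
  next
    fix z assume "z \<in> cl (x + y)"
    then have "z - y \<in> cl x" "y \<in> cl y" by (simp_all add: mem_cl algebra_simps rel_ideal_0)
    moreover have "z = (z - y) + y" by simp
    ultimately show "z \<in> {a + b | a b. a \<in> cl x \<and> b \<in> cl y}" by blast
  qed
  finally show ?thesis .
qed

text \<open>The product of cosets is a union over representatives. All members of the union agree
  because representatives of elements of FA lie in FA, which \<open>rel_ideal\<close>
  absorbs.\<close>

lemma mult_L:
  assumes "x \<in> FA" "y \<in> FA"
  shows "cl x \<otimes>\<^bsub>L\<^esub> cl y = cl (x * y)"
proof -
  have "cl x \<otimes>\<^bsub>L\<^esub> cl y = (\<Union>a\<in>cl x. \<Union>b\<in>cl y. cl (a * b))"
    unfolding leavitt_path_algebra_def FactRing_def rel_ideal_def[symmetric]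
    by (simp add: rcoset_mult_def a_r_coset_eq) (simp add: free_algebra_def)
  also have "\<dots> = (\<Union>a\<in>cl x. \<Union>b\<in>cl y. cl (x * y))"
  proof (intro SUP_cong refl)
    fix a b assume that: "a \<in> cl x" "b \<in> cl y"
    have ab: "a - x \<in> rel_ideal" "b - y \<in> rel_ideal" using that by (simp_all add: mem_cl)
    then have "a = (a - x) + x" "a - x \<in> FA" using rel_ideal_FA by auto
    then have "a \<in> FA" using FA_closed(1)[OF \<open>a - x \<in> FA\<close> assms(1)] by simp
    then have "a * (b - y) + (a - x) * y \<in> rel_ideal"
      using ab assms by (intro rel_ideal_add rel_ideal_mult)
    then show "cl (a * b) = cl (x * y)" by (simp add: cl_eq_iff algebra_simps)
  qed
  also have "\<dots> = cl (x * y)"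
  proof -
    have "x \<in> cl x" "y \<in> cl y" by (simp_all add: mem_cl rel_ideal_0)
    then show ?thesis by blast
  qed
  finally show ?thesis .
qed

lemma two_sided_ideal_L:
  "two_sided_ideal I L \<longleftrightarrow> I \<subseteq> cl ` FA \<and> cl 0 \<in> I \<and>
    (\<forall>x\<in>FA. \<forall>y\<in>FA. cl x \<in> I \<longrightarrow> cl y \<in> I \<longrightarrow> cl (x + y) \<in> I) \<and>
    (\<forall>x\<in>FA. cl x \<in> I \<longrightarrow> cl (- x) \<in> I) \<and>
    (\<forall>x\<in>FA. \<forall>a\<in>FA. cl x \<in> I \<longrightarrow> cl (a * x) \<in> I \<and> cl (x * a) \<in> I)"
proof -
  have "m_inv (add_monoid L) (cl x) = cl (- x)" if x: "x \<in> FA" for x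
    unfolding m_inv_def
  proof (rule the_equality)
    show "cl (- x) \<in> carrier (add_monoid L) \<and> cl x \<otimes>\<^bsub>add_monoid L\<^esub> cl (- x) = \<one>\<^bsub>add_monoid L\<^esub> \<and>
        cl (- x) \<otimes>\<^bsub>add_monoid L\<^esub> cl x = \<one>\<^bsub>add_monoid L\<^esub>"
      using x by (simp add: carrier_L add_L zero_L FA_closed)
    fix z assume "z \<in> carrier (add_monoid L) \<and> cl x \<otimes>\<^bsub>add_monoid L\<^esub> z = \<one>\<^bsub>add_monoid L\<^esub> \<and>
        z \<otimes>\<^bsub>add_monoid L\<^esub> cl x = \<one>\<^bsub>add_monoid L\<^esub>"
    then obtain y where "z = cl y" "cl (y + x) = cl 0" by (auto simp: carrier_L add_L zero_L)
    then show "z = cl (- x)" by (simp add: cl_eq_iff)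
  qed
  note inv = this[simplified, unfolded carrier_L]
  have ball: "(\<forall>z\<in>I. Q z) \<longleftrightarrow> (\<forall>x\<in>FA. cl x \<in> I \<longrightarrow> Q (cl x))" if "I \<subseteq> cl ` FA" for Q
    using that by blast
  have "additive_subgroup I L \<longleftrightarrow> I \<subseteq> cl ` FA \<and> cl 0 \<in> I \<and> (\<forall>z\<in>I. \<forall>z'\<in>I. z \<oplus>\<^bsub>L\<^esub> z' \<in> I) \<and>
      (\<forall>z\<in>I. m_inv (add_monoid L) z \<in> I)"
    unfolding additive_subgroup_def subgroup_def by (simp add: carrier_L zero_L) blast
  then show ?thesis
    unfolding two_sided_ideal_def
    by (cases "I \<subseteq> cl ` FA") (simp_all add: ball carrier_L add_L mult_L inv cong: conj_cong ball_cong)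
qed

section \<open>Ideals of the quotient and of the free algebra\<close>

definition pull :: "('v, 'e, 'k::field) lpa_elem set \<Rightarrow> ('v, 'e, 'k) free_elem set" where
  "pull I = {x \<in> augmentation. cl (\<pi> x) \<in> I}"

text \<open>Inverse to \<open>pull\<close>, from ring ideals between \<open>rel_kernel\<close> and
  \<open>augmentation\<close> to ideals of L.\<close>

definition push :: "('v, 'e, 'k::field) free_elem set \<Rightarrow> ('v, 'e, 'k) lpa_elem set" where
  "push J = cl ` (J \<inter> FA)"

lemma pull_augmentation: "pull I \<subseteq> augmentation"
  by (auto simp: pull_def)

lemma two_sided_ideal_repr:
  assumes "two_sided_ideal I L" "z \<in> I"
  obtains x where "z = cl x" "x \<in> FA"
  using assms unfolding two_sided_ideal_L by blast

lemma rel_kernel_pull: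
  fixes I :: "('v, 'e, 'k::field) lpa_elem set"
  assumes I: "two_sided_ideal I L"
  shows "rel_kernel \<subseteq> pull I"
proof
  fix x :: "('v, 'e, 'k) free_elem" assume x: "x \<in> rel_kernel"
  then have "cl (\<pi> x) = cl 0" by (simp add: rel_kernel_def cl_eq_iff)
  then show "x \<in> pull I"
    using I x rel_kernel_augmentation by (auto simp: pull_def two_sided_ideal_L)
qed

text \<open>Ideals of L are only ring ideals, and L need not have a unit, so closure under scalars
  needs local units: y is a sum of terms u y w with vertices u and w, and c u is an element of
  FA.\<close>

lemma scalar_closed:
  fixes I :: "('v, 'e, 'k::field) lpa_elem set"
  assumes I: "two_sided_ideal I L" and y: "y \<in> FA" "cl y \<in> I"
  shows "cl (scalar c * y) \<in> I"
proof -
  interpret leavitt_family "rel_kernel :: ('v, 'e, 'k) free_elem set" augmentation scalar vx ed gh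
    "arcs E" "tail E" "head E"
    by (rule family)
  have \<pi>y: "\<pi> y = y" using y(1) \<pi>_FA by blast
  obtain U where U: "finite U" "\<phi> y = (\<Sum>u\<in>U. \<Sum>w\<in>U. \<phi> (vx u * y * vx w))"
    using M_local_units FA_augmentation[OF y(1)] by blast
  then have "\<phi> y = \<phi> (\<Sum>u\<in>U. \<Sum>w\<in>U. vx u * y * vx w)" by (simp only: proj_sum)
  then have "y - (\<Sum>u\<in>U. \<Sum>w\<in>U. vx u * y * vx w) \<in> rel_kernel" by (simp only: \<phi>_eq_iff)
  then have "y - (\<Sum>u\<in>U. \<Sum>w\<in>U. \<pi> (vx u) * y * \<pi> (vx w)) \<in> rel_ideal"
    by (simp add: rel_kernel_def \<pi>y)
  then have "scalar c * (y - (\<Sum>u\<in>U. \<Sum>w\<in>U. \<pi> (vx u) * y * \<pi> (vx w))) \<in> rel_ideal"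
    by (rule rel_ideal_scalar)
  then have eq: "cl (scalar c * y) = cl (\<Sum>u\<in>U. \<Sum>w\<in>U. (scalar c * \<pi> (vx u)) * y * \<pi> (vx w))"
    by (simp add: cl_eq_iff right_diff_distrib sum_distrib_left mult.assoc)
  let ?S = "{z \<in> FA. cl z \<in> I}"
  have sum: "(\<Sum>i\<in>T. f i) \<in> ?S" if "\<And>i. i \<in> T \<Longrightarrow> f i \<in> ?S" for T :: "'v set" and f
    using that
  proof (induction T rule: infinite_finite_induct)
    case (insert i T)
    then have "f i \<in> ?S" "(\<Sum>i\<in>T. f i) \<in> ?S" by auto
    then show ?case
      using I insert.hyps unfolding two_sided_ideal_L by (simp add: FA_closed)
  qed (use I in \<open>simp_all add: two_sided_ideal_L FA_closed\<close>)
  have vFA: "(\<pi> (vx u) :: ('v, 'e, 'k) free_elem) \<in> FA" "scalar c * \<pi> (vx u) \<in> FA" for u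
    by (simp_all add: \<pi>_in_FA FA_closed(5) V_M)
  have "(scalar c * \<pi> (vx u)) * y * \<pi> (vx w) \<in> ?S" for u w
  proof -
    have "(scalar c * \<pi> (vx u)) * y \<in> ?S"
      using I y vFA[of u] unfolding two_sided_ideal_L by (simp add: FA_closed(5) \<pi>_FA)
    then show ?thesis
      using I vFA[of w] unfolding two_sided_ideal_L by (simp add: FA_closed(6) \<pi>_FA)
  qed
  then have "(\<Sum>u\<in>U. \<Sum>w\<in>U. (scalar c * \<pi> (vx u)) * y * \<pi> (vx w)) \<in> ?S" by (intro sum)
  then show ?thesis using eq by simp
qed

text \<open>A factor from the unital ring is, under \<pi>, a scalar plus an element of FA; the
  scalar part is absorbed by \<open>scalar_closed\<close>.\<close>

lemma ring_ideal_pull: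
  assumes I: "two_sided_ideal I L"
  shows "ring_ideal (pull I)"
  unfolding ring_ideal_def
proof (intro conjI ballI allI)
  note aug = ring_idealD[OF ring_ideal_augmentation]
  note I' = I[unfolded two_sided_ideal_L]
  show "0 \<in> pull I" using I' by (simp add: pull_def aug(1))
  show "x + y \<in> pull I" if "x \<in> pull I" "y \<in> pull I" for x y
    using that I' by (simp add: pull_def \<pi>_in_FA aug(2))
  show "a * x \<in> pull I" "x * a \<in> pull I" if x: "x \<in> pull I" for x a
  proof -
    obtain c a' where a: "\<pi> a = scalar c + a'" "a' \<in> FA" using split_constant[of "\<pi> a"] by auto
    have \<pi>x: "\<pi> x \<in> FA" "cl (\<pi> x) \<in> I" using x by (simp_all add: pull_def \<pi>_in_FA)
    have sx: "cl (scalar c * \<pi> x) \<in> I" "scalar c * \<pi> x \<in> FA"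
      using scalar_closed[OF I \<pi>x] \<pi>x by (simp_all add: FA_closed(5))
    have "cl (a' * \<pi> x) \<in> I" "cl (\<pi> x * a') \<in> I" "a' * \<pi> x \<in> FA" "\<pi> x * a' \<in> FA"
      using I' \<pi>x a(2) by (simp_all add: FA_closed \<pi>_FA)
    then have "cl (scalar c * \<pi> x + a' * \<pi> x) \<in> I" "cl (scalar c * \<pi> x + \<pi> x * a') \<in> I"
      using I' sx by simp_all
    then have "cl (\<pi> (a * x)) \<in> I" "cl (\<pi> (x * a)) \<in> I"
      by (simp_all add: a(1) distrib_left distrib_right scalar_comm)
    then show "a * x \<in> pull I" "x * a \<in> pull I"
      using x by (simp_all add: pull_def aug(3,4))
  qed
qed

lemma pull_subset_iff:
  assumes "two_sided_ideal I L" "two_sided_ideal J L"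
  shows "pull I \<subseteq> pull J \<longleftrightarrow> I \<subseteq> J"
proof
  assume sub: "pull I \<subseteq> pull J"
  show "I \<subseteq> J"
  proof
    fix z assume z: "z \<in> I"
    then obtain x where x: "z = cl x" "x \<in> FA" using assms(1) by (auto simp: two_sided_ideal_L)
    then have "x \<in> pull I" using z by (simp add: pull_def \<pi>_FA FA_augmentation)
    then have "x \<in> pull J" using sub by blast
    then show "z \<in> J" using x by (simp add: pull_def \<pi>_FA)
  qed
qed (auto simp: pull_def)

context
  fixes J :: "('v, 'e, 'k::field) free_elem set"
  assumes J: "ring_ideal J" "rel_kernel \<subseteq> J" "J \<subseteq> augmentation"
begin

lemma \<pi>_mem_iff: "\<pi> x \<in> J \<longleftrightarrow> x \<in> J"
proof -
  have "x - \<pi> x \<in> J" using J(2) by (auto simp: rel_kernel_def rel_ideal_0)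
  then show ?thesis
    using ring_idealD(2,6)[OF J(1)] by (metis add_diff_cancel_left' diff_add_cancel)
qed

lemma cl_mem_push_iff: "x \<in> FA \<Longrightarrow> cl x \<in> push J \<longleftrightarrow> x \<in> J"
proof
  assume x: "x \<in> FA" and "cl x \<in> push J"
  then obtain y where y: "y \<in> J" "y \<in> FA" "x - y \<in> rel_ideal"
    by (auto simp: push_def cl_eq_iff)
  then have "x - y \<in> rel_kernel" using x by (simp add: rel_kernel_def \<pi>_FA)
  then have "x - y \<in> J" using J(2) by blast
  then have "(x - y) + y \<in> J" using ring_idealD(2)[OF J(1)] y(1) by blast
  then show "x \<in> J" by simp
qed (auto simp: push_def)

lemma pull_push: "pull (push J) = J"
  using J(3) by (auto simp: pull_def \<pi>_in_FA cl_mem_push_iff \<pi>_mem_iff)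

lemma two_sided_ideal_push: "two_sided_ideal (push J) L"
  unfolding two_sided_ideal_L
  using ring_idealD[OF J(1)] by (auto simp: cl_mem_push_iff FA_closed \<pi>_FA) (auto simp: push_def)

end

lemma ideal_prod_subset_iff:
  assumes "two_sided_ideal B L" "two_sided_ideal C L" "two_sided_ideal P L"
  shows "B \<cdot>\<^bsub>L\<^esub> C \<subseteq> P \<longleftrightarrow> (\<forall>x\<in>pull B. \<forall>y\<in>pull C. x * y \<in> pull P)"
proof
  assume sub: "B \<cdot>\<^bsub>L\<^esub> C \<subseteq> P"
  show "\<forall>x\<in>pull B. \<forall>y\<in>pull C. x * y \<in> pull P"
  proof (intro ballI)
    fix x y assume xy: "x \<in> pull B" "y \<in> pull C"
    then have "cl (\<pi> x) \<otimes>\<^bsub>L\<^esub> cl (\<pi> y) \<in> B \<cdot>\<^bsub>L\<^esub> C"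
      by (intro ideal_prod.prod) (simp_all add: pull_def)
    moreover have "cl (\<pi> x) \<otimes>\<^bsub>L\<^esub> cl (\<pi> y) = cl (\<pi> (x * y))"
      using xy by (subst mult_L) (simp_all add: \<pi>_in_FA pull_def)
    ultimately show "x * y \<in> pull P"
      using sub xy ring_idealD(3)[OF ring_ideal_augmentation] by (auto simp: pull_def)
  qed
next
  assume prod: "\<forall>x\<in>pull B. \<forall>y\<in>pull C. x * y \<in> pull P"
  show "B \<cdot>\<^bsub>L\<^esub> C \<subseteq> P"
  proof
    fix z assume "z \<in> B \<cdot>\<^bsub>L\<^esub> C"
    then show "z \<in> P"
    proof (induction rule: ideal_prod.induct)
      case (prod i j)
      obtain x where "i = cl x" "x \<in> FA" using two_sided_ideal_repr[OF assms(1)] prod.hyps(1) .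
      moreover obtain y where "j = cl y" "y \<in> FA" using two_sided_ideal_repr[OF assms(2)] prod.hyps(2) .
      ultimately have xy: "i = cl x" "x \<in> FA" "j = cl y" "y \<in> FA" .
      then have "x \<in> pull B" "y \<in> pull C"
        using prod by (simp_all add: pull_def \<pi>_FA FA_augmentation)
      then have "x * y \<in> pull P" using \<open>\<forall>x\<in>pull B. \<forall>y\<in>pull C. x * y \<in> pull P\<close> by blast
      then show ?case using xy by (simp add: mult_L pull_def \<pi>_FA)
    next
      case (sum s1 s2)
      obtain x where "s1 = cl x" "x \<in> FA" using two_sided_ideal_repr[OF assms(3)] sum.IH(1) .
      moreover obtain y where "s2 = cl y" "y \<in> FA" using two_sided_ideal_repr[OF assms(3)] sum.IH(2) .
      ultimately have "s1 = cl x" "x \<in> FA" "s2 = cl y" "y \<in> FA" .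
      then show ?case using sum assms(3) by (simp add: add_L two_sided_ideal_L)
    qed
  qed
qed

text \<open>Negation and multiplication are checked along the inductive construction of the product,
  for one representative at a time; \<open>cl_eq\<close> extends this to all
  representatives.\<close>

lemma two_sided_ideal_prod:
  assumes B: "two_sided_ideal B L" and C: "two_sided_ideal C L"
  shows "two_sided_ideal (B \<cdot>\<^bsub>L\<^esub> C) L"
proof -
  let ?BC = "B \<cdot>\<^bsub>L\<^esub> C"
  have prod_mem: "cl (x * y) \<in> ?BC" if "cl x \<in> B" "cl y \<in> C" "x \<in> FA" "y \<in> FA" for x y
    using ideal_prod.prod[OF that(1,2), of L] that(3,4) by (simp add: mult_L)
  have add: "cl (x + y) \<in> ?BC" if "cl x \<in> ?BC" "cl y \<in> ?BC" for x y
    using ideal_prod.sum[OF that] by (simp add: add_L)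
  have *: "\<exists>x\<in>FA. z = cl x \<and> cl (- x) \<in> ?BC \<and> (\<forall>a\<in>FA. cl (a * x) \<in> ?BC \<and> cl (x * a) \<in> ?BC)"
    if "z \<in> ?BC" for z
    using that
  proof (induction rule: ideal_prod.induct)
    case (prod i j)
    obtain x where "i = cl x" "x \<in> FA" using two_sided_ideal_repr[OF B] prod.hyps(1) .
    moreover obtain y where "j = cl y" "y \<in> FA" using two_sided_ideal_repr[OF C] prod.hyps(2) .
    ultimately have xy: "i = cl x" "x \<in> FA" "j = cl y" "y \<in> FA" .
    have "cl (- x * y) \<in> ?BC" using prod B xy prod_mem[of "- x" y]
      by (simp add: two_sided_ideal_L FA_closed)
    moreover have "cl ((a * x) * y) \<in> ?BC" "cl (x * (y * a)) \<in> ?BC" if "a \<in> FA" for a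
      using prod B C xy that ideal_prod.prod[of "cl (a * x)" B "cl y" C L]
        ideal_prod.prod[of "cl x" B "cl (y * a)" C L]
      by (simp_all add: two_sided_ideal_L FA_closed \<pi>_FA mult_L)
    ultimately show ?case
      using xy by (intro bexI[of _ "x * y"]) (simp_all add: mult_L FA_closed \<pi>_FA mult.assoc)
  next
    case (sum s1 s2)
    then obtain x y where "x \<in> FA" "s1 = cl x" "cl (- x) \<in> ?BC"
      "\<forall>a\<in>FA. cl (a * x) \<in> ?BC \<and> cl (x * a) \<in> ?BC" "y \<in> FA" "s2 = cl y" "cl (- y) \<in> ?BC"
      "\<forall>a\<in>FA. cl (a * y) \<in> ?BC \<and> cl (y * a) \<in> ?BC"
      by blast
    then show ?case
      using add[of "- x" "- y"]
      by (intro bexI[of _ "x + y"]) (simp_all add: add_L add FA_closed distrib_left distrib_right)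
  qed
  have cl_eq: "cl (- x) = cl (- y)" "\<And>a. a \<in> FA \<Longrightarrow> cl (a * x) = cl (a * y)"
    "\<And>a. a \<in> FA \<Longrightarrow> cl (x * a) = cl (y * a)" if "cl x = cl y" for x y
  proof -
    have xy: "x - y \<in> rel_ideal" using that by (simp add: cl_eq_iff)
    show "cl (- x) = cl (- y)" using rel_ideal_uminus[OF xy] by (simp add: cl_eq_iff)
    show "cl (a * x) = cl (a * y)" "cl (x * a) = cl (y * a)" if "a \<in> FA" for a
      using rel_ideal_mult[OF xy that] by (simp_all add: cl_eq_iff algebra_simps)
  qed
  show ?thesis
    unfolding two_sided_ideal_L
  proof (intro conjI ballI impI)
    show "?BC \<subseteq> cl ` FA" using * by blast
    have "cl 0 \<in> B" "cl 0 \<in> C" using B C by (simp_all add: two_sided_ideal_L)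
    then show "cl 0 \<in> ?BC" using prod_mem[of 0 0] by (simp add: FA_closed)
    show "cl (x + y) \<in> ?BC" if "cl x \<in> ?BC" "cl y \<in> ?BC" for x y using that by (rule add)
    show "cl (- x) \<in> ?BC" if "cl x \<in> ?BC" for x using *[OF that] cl_eq(1) by metis
    show "cl (a * x) \<in> ?BC" "cl (x * a) \<in> ?BC" if "cl x \<in> ?BC" "a \<in> FA" for x a
      using *[OF that(1)] cl_eq(2,3) that(2) by metis+
  qed
qed

section \<open>Prime ideals, radicals and idempotents\<close>

lemma prime_ideal_pull:
  assumes P: "prime_ideal P L"
    and B: "ring_ideal B" "rel_kernel \<subseteq> B" "B \<subseteq> augmentation"
    and C: "ring_ideal C" "rel_kernel \<subseteq> C" "C \<subseteq> augmentation"
    and prod: "\<And>b c. b \<in> B \<Longrightarrow> c \<in> C \<Longrightarrow> b * c \<in> pull P"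
  shows "B \<subseteq> pull P \<or> C \<subseteq> pull P"
proof -
  have tP: "two_sided_ideal P L" using P by (simp add: prime_ideal_def)
  note tB = two_sided_ideal_push[OF B] and tC = two_sided_ideal_push[OF C]
  have "push B \<cdot>\<^bsub>L\<^esub> push C \<subseteq> P"
    using prod by (simp add: ideal_prod_subset_iff[OF tB tC tP] pull_push[OF B] pull_push[OF C])
  then have "push B \<subseteq> P \<or> push C \<subseteq> P" using P tB tC by (simp add: prime_ideal_def)
  then show ?thesis
    using pull_subset_iff[OF tB tP] pull_subset_iff[OF tC tP] pull_push[OF B] pull_push[OF C] by simp
qed

lemma prime_ideal_push:
  assumes Q: "ring_ideal Q" "rel_kernel \<subseteq> Q" "Q \<subseteq> augmentation" and "Q \<noteq> augmentation"
    and prime: "\<And>B C. ring_ideal B \<Longrightarrow> ring_ideal C \<Longrightarrow> B \<subseteq> augmentation \<Longrightarrow> C \<subseteq> augmentation \<Longrightarrow>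
      (\<And>b c. b \<in> B \<Longrightarrow> c \<in> C \<Longrightarrow> b * c \<in> Q) \<Longrightarrow> B \<subseteq> Q \<or> C \<subseteq> Q"
  shows "prime_ideal (push Q) L"
  unfolding prime_ideal_def
proof (intro conjI allI impI)
  note tQ = two_sided_ideal_push[OF Q]
  show "two_sided_ideal (push Q) L" by (rule tQ)
  show "push Q \<noteq> carrier L"
  proof
    assume "push Q = carrier L"
    then have "pull (push Q) = augmentation"
      by (auto simp: pull_def carrier_L \<pi>_in_FA)
    then show False using pull_push[OF Q] \<open>Q \<noteq> augmentation\<close> by simp
  qed
  show "B \<subseteq> push Q \<or> C \<subseteq> push Q"
    if tB: "two_sided_ideal B L" and tC: "two_sided_ideal C L" and "B \<cdot>\<^bsub>L\<^esub> C \<subseteq> push Q" for B C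
  proof -
    have "\<forall>x\<in>pull B. \<forall>y\<in>pull C. x * y \<in> Q"
      using that(3) by (simp add: ideal_prod_subset_iff[OF tB tC tQ] pull_push[OF Q])
    then have "pull B \<subseteq> Q \<or> pull C \<subseteq> Q"
      using ring_ideal_pull[OF tB] ring_ideal_pull[OF tC] pull_augmentation by (intro prime) auto
    then show ?thesis
      using pull_subset_iff[OF tB tQ] pull_subset_iff[OF tC tQ] pull_push[OF Q] by simp
  qed
qed

text \<open>If no power of y were in the ideal, \<open>prime_avoiding_powers\<close> would give a
  prime above I without y, although the radical P is contained in every prime above I.\<close>

lemma primary_ideal_nil:
  fixes P :: "('v, 'e, 'k::field) lpa_elem set"
  assumes "primary_ideal P I L"
  shows "I \<subseteq> P" and "y \<in> pull P \<Longrightarrow> \<exists>n. y ^ n \<in> pull I"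
proof -
  have I: "two_sided_ideal I L" and rad: "P = prime_radical I L"
    using assms by (simp_all add: primary_ideal_def)
  have "I \<subseteq> carrier L" using I by (simp add: two_sided_ideal_L carrier_L)
  then show "I \<subseteq> P" by (auto simp: rad prime_radical_def)
  show "\<exists>n. y ^ n \<in> pull I" if y: "y \<in> pull P"
  proof (rule ccontr)
    assume "\<not> ?thesis"
    then have nil: "y ^ n \<notin> pull I" for n by blast
    have yM: "y \<in> augmentation" using y pull_augmentation by blast
    show False
    proof (rule prime_avoiding_powers[OF ring_ideal_augmentation ring_ideal_pull[OF I]
          pull_augmentation yM nil])
      fix Q assume Q: "ring_ideal Q" "pull I \<subseteq> Q" "Q \<subseteq> augmentation" "y \<notin> Q"
        "\<And>B C. ring_ideal B \<Longrightarrow> ring_ideal C \<Longrightarrow> B \<subseteq> augmentation \<Longrightarrow> C \<subseteq> augmentation \<Longrightarrow>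
          (\<And>b c. b \<in> B \<Longrightarrow> c \<in> C \<Longrightarrow> b * c \<in> Q) \<Longrightarrow> B \<subseteq> Q \<or> C \<subseteq> Q"
      have kQ: "rel_kernel \<subseteq> Q" using rel_kernel_pull[OF I] Q(2) by blast
      have "Q \<noteq> augmentation" using yM Q(4) by blast
      then have "prime_ideal (push Q) L"
        by (rule prime_ideal_push[OF Q(1) kQ Q(3)]) (rule Q(5))
      moreover have "I \<subseteq> push Q"
        using Q(2) pull_subset_iff[OF I two_sided_ideal_push[OF Q(1) kQ Q(3)]]
          pull_push[OF Q(1) kQ Q(3)] by simp
      ultimately have "P \<subseteq> push Q" by (auto simp: rad prime_radical_def)
      then have "pull P \<subseteq> Q" using pull_push[OF Q(1) kQ Q(3)] by (auto simp: pull_def)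
      then show False using y Q(4) by blast
    qed
  qed
qed

text \<open>The ideal N, pulled back. Idempotency is meant modulo the relations of the graph, so
  these are the idempotents of L itself.\<close>

definition idempotent_kernel :: "('v, 'e, 'k::field) free_elem set \<Rightarrow> ('v, 'e, 'k) free_elem set" where
  "idempotent_kernel J =
    \<Inter>{N. ring_ideal N \<and> rel_kernel \<subseteq> N \<and> (\<forall>x\<in>J. x * x - x \<in> rel_kernel \<longrightarrow> x \<in> N)}"

lemma idempotent_kernel:
  shows "ring_ideal (idempotent_kernel J)" and "rel_kernel \<subseteq> idempotent_kernel J"
    and "x \<in> J \<Longrightarrow> x * x - x \<in> rel_kernel \<Longrightarrow> x \<in> idempotent_kernel J"
    and "ring_ideal N \<Longrightarrow> rel_kernel \<subseteq> N \<Longrightarrow>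
      (\<And>x. x \<in> J \<Longrightarrow> x * x - x \<in> rel_kernel \<Longrightarrow> x \<in> N) \<Longrightarrow> idempotent_kernel J \<subseteq> N"
  unfolding idempotent_kernel_def by (auto simp: ring_ideal_def)

lemma prime_family:
  fixes P :: "('v, 'e, 'k::field) lpa_elem set"
  assumes P: "prime_ideal P L"
  shows "leavitt_prime (idempotent_kernel (pull P)) augmentation scalar vx ed gh
    (arcs E) (tail E) (head E) (pull P)"
proof -
  let ?N = "idempotent_kernel (pull P)"
  have tP: "two_sided_ideal P L" using P by (simp add: prime_ideal_def)
  note rP = ring_ideal_pull[OF tP] and kP = rel_kernel_pull[OF tP]
  interpret F: leavitt_family "rel_kernel :: ('v, 'e, 'k) free_elem set" augmentation scalar vx ed gh
    "arcs E" "tail E" "head E"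
    by (rule family)
  have NP: "?N \<subseteq> pull P" by (rule idempotent_kernel(4)[OF rP kP])
  then have "?N \<subseteq> augmentation" using pull_augmentation by blast
  then interpret leavitt_family ?N augmentation scalar vx ed gh "arcs E" "tail E" "head E"
    by (rule F.change_kernel[OF idempotent_kernel(1,2)])
  show ?thesis
  proof
    show "ring_ideal (pull P)" "?N \<subseteq> pull P" "pull P \<subseteq> augmentation"
      by (rule rP NP pull_augmentation)+
    \<comment> \<open>Idempotency is taken from the interpretation \<open>F\<close>, over
      \<open>rel_kernel\<close>, since idempotency modulo N alone does not give membership in
      N.\<close>
    show "gap w F \<in> ?N" if "finite F" "F \<subseteq> out w" "gap w F \<in> pull P" for F w
      using idempotent_kernel(3)[OF that(3) F.gap_idempotent[OF that(1,2)]] .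
    show "x \<in> pull P \<or> z \<in> pull P"
      if xz: "x \<in> augmentation" "z \<in> augmentation" "\<And>y. x * y * z \<in> pull P" for x z
    proof -
      note rPD = ring_idealD[OF rP] and MD = ring_idealD[OF ring_ideal_augmentation]
      \<comment> \<open>Primeness for ideals is turned into primeness for elements by two
        annihilators modulo P: \<open>?C\<close> consists of what x kills and contains z,
        \<open>?B\<close> of what kills \<open>?C\<close> and contains x.\<close>
      let ?C = "{y \<in> augmentation. \<forall>a. x * a * y \<in> pull P}"
      let ?B = "{t \<in> augmentation. \<forall>y\<in>?C. \<forall>a. t * a * y \<in> pull P}"
      have C: "ring_ideal ?C"
        unfolding ring_ideal_def
      proof (intro conjI ballI allI)
        show "0 \<in> ?C" by (simp add: rPD MD)
        show "y + y' \<in> ?C" if "y \<in> ?C" "y' \<in> ?C" for y y'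
          using that by (simp add: distrib_left rPD MD)
        show "b * y \<in> ?C" if "y \<in> ?C" for y b
        proof -
          have "x * (a * b) * y \<in> pull P" for a using that by blast
          then show ?thesis using that by (simp add: MD mult.assoc)
        qed
        show "y * b \<in> ?C" if "y \<in> ?C" for y b
          using that by (simp add: MD rPD flip: mult.assoc)
      qed
      have B: "ring_ideal ?B"
        unfolding ring_ideal_def
      proof (intro conjI ballI allI)
        show "0 \<in> ?B" by (simp add: rPD MD)
        show "t + t' \<in> ?B" if "t \<in> ?B" "t' \<in> ?B" for t t'
          using that by (simp add: distrib_right rPD MD)
        show "b * t \<in> ?B" if "t \<in> ?B" for t b
          using that by (simp add: MD rPD mult.assoc)
        show "t * b \<in> ?B" if "t \<in> ?B" for t b
        proof -
          have "t * (b * a) * y \<in> pull P" if "y \<in> ?C" for a y using \<open>t \<in> ?B\<close> that by blast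
          then show ?thesis using that by (simp add: MD mult.assoc)
        qed
      qed
      have k: "t \<in> ?C \<and> t \<in> ?B" if "t \<in> rel_kernel" for t
      proof -
        have "t \<in> pull P" "t \<in> augmentation" using that kP rel_kernel_augmentation by blast+
        then show ?thesis by (simp add: rPD(3,4))
      qed
      have kC: "rel_kernel \<subseteq> ?C" and kB: "rel_kernel \<subseteq> ?B"
        by (rule subsetI, drule k, erule conjunct1) (rule subsetI, drule k, erule conjunct2)
      have BC: "t * y \<in> pull P" if "t \<in> ?B" "y \<in> ?C" for t y
      proof -
        have "\<forall>y\<in>?C. \<forall>a. t * a * y \<in> pull P" using that(1) by (elim CollectE conjE)
        then have "\<forall>a. t * a * y \<in> pull P" using that(2) by (rule bspec)
        then have "t * 1 * y \<in> pull P" by (rule spec)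
        then show ?thesis by simp
      qed
      have "?B \<subseteq> pull P \<or> ?C \<subseteq> pull P"
        by (rule prime_ideal_pull[OF P B kB _ C kC _ BC]) (rule Collect_subset, rule Collect_subset)
      moreover have "z \<in> ?C" using xz(2,3) by simp
      moreover have "x \<in> ?B" using xz(1) by simp
      ultimately show ?thesis by blast
    qed
  qed
qed

end

theorem corollary9:
  fixes E :: "('v, 'e) pre_digraph"
    and P :: "('v, 'e, 'k::field) lpa_elem set"
  assumes "wf_digraph E" and "countable (verts E)" and "countable (arcs E)"
    and "prime_ideal P (leavitt_path_algebra E)"
    and "P \<noteq> {\<zero>\<^bsub>leavitt_path_algebra E\<^esub>}"
  shows "(\<forall>I J. primary_ideal P I (leavitt_path_algebra E) \<longrightarrow>
                primary_ideal P J (leavitt_path_algebra E) \<longrightarrow> I \<subseteq> J \<or> J \<subseteq> I) \<and>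
         \<not> (\<exists>A. two_sided_ideal A (leavitt_path_algebra E) \<and>
                P \<cdot>\<^bsub>leavitt_path_algebra E\<^esub> P \<subset> A \<and> A \<subset> P)"
proof (intro conjI allI impI notI)
  interpret leavitt_path E by (rule leavitt_path.intro[OF assms(1)])
  let ?N = "idempotent_kernel (pull P)"
  interpret leavitt_prime ?N augmentation scalar vx ed gh "arcs E" "tail E" "head E" "pull P"
    by (rule prime_family[OF assms(4)])
  have P: "two_sided_ideal P L" using assms(4) by (simp add: prime_ideal_def)
  show "I \<subseteq> J \<or> J \<subseteq> I"
    if I: "primary_ideal P I (leavitt_path_algebra E)" and J: "primary_ideal P J (leavitt_path_algebra E)"
    for I J
  proof -
    have tsi: "two_sided_ideal I L" if "primary_ideal P I L" for I
      using that by (simp add: primary_ideal_def)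
    have kernel: "?N \<subseteq> pull I" if I: "primary_ideal P I L" for I
    proof (rule idempotent_kernel(4))
      note rI = ring_ideal_pull[OF tsi[OF I]] and kI = rel_kernel_pull[OF tsi[OF I]]
      show "ring_ideal (pull I)" "rel_kernel \<subseteq> pull I" by (rule rI kI)+
      show "x \<in> pull I" if x: "x \<in> pull P" "x * x - x \<in> rel_kernel" for x
      proof -
        obtain n where n: "x ^ n \<in> pull I" using primary_ideal_nil(2)[OF I x(1)] by blast
        \<comment> \<open>Positive powers of x equal x modulo the relations. The shift by
          \<open>Suc\<close> matters because the exponent with a power in the ideal could formally
          be 0.\<close>
        have "x ^ Suc n - x \<in> rel_kernel" for n
        proof (induction n)
          case (Suc n)
          have "x * (x ^ Suc n - x) + (x * x - x) \<in> rel_kernel"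
            using Suc x(2) ring_idealD(2,3)[OF ring_ideal_rel_kernel] by blast
          then show ?case by (simp add: algebra_simps)
        qed (simp add: ring_idealD(1)[OF ring_ideal_rel_kernel])
        then have "x ^ Suc n - x \<in> pull I" using kI by blast
        moreover have "x ^ Suc n \<in> pull I" using n ring_idealD(3)[OF rI] by simp
        ultimately have "x ^ Suc n - (x ^ Suc n - x) \<in> pull I" using ring_idealD(6)[OF rI] by blast
        then show ?thesis by simp
      qed
    qed
    have sub: "pull I \<subseteq> pull P" if "primary_ideal P I L" for I
      using primary_ideal_nil(1)[OF that] pull_subset_iff[OF tsi[OF that] P] by simp
    have "pull I \<subseteq> pull J \<or> pull J \<subseteq> pull I"
      by (rule nil_ideals_comparable[OF
            ring_ideal_pull[OF tsi[OF I]] kernel[OF I] sub[OF I] primary_ideal_nil(2)[OF I]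
            ring_ideal_pull[OF tsi[OF J]] kernel[OF J] sub[OF J] primary_ideal_nil(2)[OF J]])
    then show ?thesis
      using pull_subset_iff[OF tsi[OF I] tsi[OF J]] pull_subset_iff[OF tsi[OF J] tsi[OF I]] by simp
  qed
  show False if ex: "\<exists>A. two_sided_ideal A (leavitt_path_algebra E) \<and>
      P \<cdot>\<^bsub>leavitt_path_algebra E\<^esub> P \<subset> A \<and> A \<subset> P"
  proof -
    let ?PP = "P \<cdot>\<^bsub>L\<^esub> P"
    obtain B where B: "two_sided_ideal B L" "?PP \<subset> B" "B \<subset> P" using ex by blast
    note PP = two_sided_ideal_prod[OF P P]
    note rPP = ring_ideal_pull[OF PP]
    have prod: "x * y \<in> pull ?PP" if "x \<in> pull P" "y \<in> pull P" for x y
      using ideal_prod_subset_iff[OF P P PP] that by blast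
    have "?N \<subseteq> pull ?PP"
    proof (rule idempotent_kernel(4)[OF rPP rel_kernel_pull[OF PP]])
      fix x assume x: "x \<in> pull P" "x * x - x \<in> rel_kernel"
      \<comment> \<open>Modulo the relations x is its own square, which is a product of two elements
        of P.\<close>
      then have "x * x - x \<in> pull ?PP" using rel_kernel_pull[OF PP] by blast
      then have "x * x - (x * x - x) \<in> pull ?PP"
        using prod[OF x(1) x(1)] ring_idealD(6)[OF rPP] by blast
      then show "x \<in> pull ?PP" by simp
    qed
    moreover have "pull ?PP \<subseteq> pull B" "pull B \<subseteq> pull P"
      using B pull_subset_iff[OF PP B(1)] pull_subset_iff[OF B(1) P] by blast+
    ultimately have "pull B \<subseteq> pull ?PP \<or> pull P \<subseteq> pull B"
      by (intro no_ideal_between_square[OF rPP _ prod ring_ideal_pull[OF B(1)]])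
    then show False
      using B pull_subset_iff[OF B(1) PP] pull_subset_iff[OF P B(1)] by blast
  qed
qed

end
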